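(* Let $H$ be a complex Hilbert space and let $T=\begin{pmatrix}A&B\\ C&-A^*\end{pmatrix}$ be a nonnegative diagonally $p$-dominant Hamiltonian in $H\times H$ with $p<1$ such that $A$ is sectorially dichotomous and \[\bigcap_{t\in\mathbb R}\ker\bigl(B(A^*+\mathrm i t)^{-1}\bigr)=\{0\}.\] Then: (i) $T$ is dichotomous and its spectral subspaces $V_+,V_-$ are graph subspaces, i.e. $V_\pm=G(X_\pm)$ for linear operators $X_+,X_-$ on $H$; (ii) $X_+$ and $X_-$ are selfadjoint, $X_+$ is nonnegative, and $X_-$ is nonpositive; (iii) $\mathcal D(A)\cap X_\pm^{-1}\mathcal D(A^* )$ is a core for $X_\pm$, and $X_\pm$ satisfies the Riccati equation \[(A^*X_\pm+X_\pm(A+BX_\pm)-C)u=0,\qquad u\in\mathcal D(A)\cap X_\pm^{-1}\mathcal D(A^* )\] (in particular $(A+BX_\pm)u\in\mathcal D(X_\pm)$ for all such $u$).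
   Context: $\mathcal D(\cdot)$ is the domain, $\varrho(\cdot)$ the resolvent set, $\sigma(\cdot)$ the spectrum; $\mathbb C_\pm$ are the open right/left half-planes. Linear operators need not be everywhere defined or bounded. Subordination: a linear operator $R$ is $p$-subordinate to $S$, $p\in[0,1]$, if $\mathcal D(S)\subset\mathcal D(R)$ and there is $c\ge0$ with $\|Rx\|\le c\|x\|^{1-p}\|Sx\|^p$ for all $x\in\mathcal D(S)$. Hamiltonian: $T=\begin{pmatrix}A&B\\ C&-A^*\end{pmatrix}$ in $H\times H$ with $A,B,C$ densely defined linear operators in $H$, $A$ closed, and $B,C$ symmetric. It is nonnegative if $B$ and $C$ are nonnegative ($(Bu|u)\ge0$ for $u\in\mathcal D(B)$, similarly $C$). It is diagonally $p$-dominant if $C$ is $p$-subordinate to $A$ and $B$ is $p$-subordinate to $A^*$; then $\mathcal D(T)=\mathcal D(A)\times\mathcal D(A^* )$. Dichotomous: a densely defined linear operator $S$ on a Banach space $V$ is dichotomous if there exist $h>0$ and complementary closed subspaces $V=V_+\oplus V_-$ (not necessarily orthogonal) with (a) $\{z\in\mathbb C:|\operatorname{Re}z|<h\}\subset\varrho(S)$; (b) $S(\mathcal D(S)\cap V_\pm)\subset V_\pm$; (c) $\sigma(S|_{V_+})\subset\mathbb C_+$, $\sigma(S|_{V_-})\subset\mathbb C_-$. $V_\pm$ are called the spectral subspaces, $P_\pm$ the projections onto $V_\pm$ along $V_\mp$, and $S_\pm:=S|_{V_\pm}$. For $T$ as in the claim, the spectral subspaces meant are the ones whose projections satisfy $\frac1{\pi\mathrm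 i}\int_{\mathrm i\mathbb R}'(T-z)^{-1}x\,dz=P_+x-P_-x$ for all $x\in H\times H$, where $\int'_{\mathrm i\mathbb R}$ denotes the Cauchy principal value at infinity, $\lim_{\rho\to\infty}\int_{-\mathrm i\rho}^{\mathrm i\rho}$. Sectorial: a densely defined linear operator $S$ is sectorial with angle $\theta\in[0,\pi[$ if $\sigma(S)\subset\Sigma_\theta:=\{z:|\arg z|\le\theta\}$ (with $-\pi<\arg z\le\pi$, $\arg 0=0$) and for every $\theta'\in\,]\theta,\pi]$ there is $M>0$ with $\|(S-z)^{-1}\|\le M/|z|$ for $|\arg z|\ge\theta'$, $|z|>0$. A dichotomous operator $S$ is sectorially dichotomous (with angle $\theta\in[0,\pi/2[$) if $S_+$ and $-S_-$ are sectorial with angle $\theta$. Graph: $G(X)=\{(u,Xu):u\in\mathcal D(X)\}\subset H\times H$. $X^{-1}\mathcal D(A^* )=\{u\in\mathcal D(X):Xu\in\mathcal D(A^* )\}$. A subspace $D\subset\mathcal D(X)$ is a core for closed $X$ if $X$ is the closure of $X|_D$. *)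

theory Defs
  imports "HOL-Analysis.Analysis"
begin

section \<open>Complex Banach and Hilbert spaces\<close>

class complex_normed_vector = real_normed_vector +
  fixes scaleC :: "complex \<Rightarrow> 'a \<Rightarrow> 'a"  (infixr \<open>*\<^sub>C\<close> 75)
  assumes scaleC_add_right: "a *\<^sub>C (x + y) = a *\<^sub>C x + a *\<^sub>C y"
    and scaleC_add_left: "(a + b) *\<^sub>C x = a *\<^sub>C x + b *\<^sub>C x"
    and scaleC_scaleC: "a *\<^sub>C b *\<^sub>C x = (a * b) *\<^sub>C x"
    and scaleC_of_real: "complex_of_real r *\<^sub>C x = r *\<^sub>R x"
    and norm_scaleC: "norm (a *\<^sub>C x) = cmod a * norm x"

class complex_banach = complex_normed_vector + banach

(* The inner product is linear in the first argument. *)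
class complex_hilbert = complex_banach +
  fixes cinner :: "'a \<Rightarrow> 'a \<Rightarrow> complex"
  assumes cinner_add_left: "cinner (x + y) z = cinner x z + cinner y z"
    and cinner_scaleC_left: "cinner (a *\<^sub>C x) y = a * cinner x y"
    and cinner_commute: "cinner x y = cnj (cinner y x)"
    and cinner_self: "cinner x x = complex_of_real ((norm x)\<^sup>2)"

lemma vector_space_scaleC: "vector_space ((*\<^sub>C) :: complex \<Rightarrow> 'a \<Rightarrow> 'a::complex_normed_vector)"
proof
  show "1 *\<^sub>C x = x" for x :: 'a
    using scaleC_of_real[of 1 x] by simp
qed (simp_all add: scaleC_add_right scaleC_add_left scaleC_scaleC)

abbreviation csubspace :: "'a::complex_normed_vector set \<Rightarrow> bool"
  where "csubspace \<equiv> module.subspace (*\<^sub>C)"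

(* The norm on the product is the library's l2 norm, so that the product of two Hilbert
   spaces carries the Hilbert space norm. *)
instantiation prod :: (complex_normed_vector, complex_normed_vector) complex_normed_vector
begin

definition scaleC_prod_def: "a *\<^sub>C x = (a *\<^sub>C fst x, a *\<^sub>C snd x)"

instance
proof
  fix a b :: complex and r :: real and x y :: "'a \<times> 'b"
  show "a *\<^sub>C (x + y) = a *\<^sub>C x + a *\<^sub>C y"
    by (simp add: scaleC_prod_def scaleC_add_right)
  show "(a + b) *\<^sub>C x = a *\<^sub>C x + b *\<^sub>C x"
    by (simp add: scaleC_prod_def scaleC_add_left)
  show "a *\<^sub>C b *\<^sub>C x = (a * b) *\<^sub>C x"
    by (simp add: scaleC_prod_def scaleC_scaleC)
  show "complex_of_real r *\<^sub>C x = r *\<^sub>R x"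
    by (simp add: scaleC_prod_def scaleC_of_real scaleR_prod_def)
  have "(norm (a *\<^sub>C x))\<^sup>2 = (cmod a * norm x)\<^sup>2"
    by (simp add: scaleC_prod_def norm_prod_def norm_scaleC power_mult_distrib distrib_left)
  then show "norm (a *\<^sub>C x) = cmod a * norm x"
    by (simp add: power2_eq_iff_nonneg)
qed

end

instance prod :: (complex_banach, complex_banach) complex_banach ..


section \<open>Unbounded linear operators\<close>

(* A not necessarily everywhere defined operator is a domain together with a map. The values
   of the map outside the domain are irrelevant, so equality of operators is equality of graphs. *)
datatype ('a, 'b) op = Op (Dom: "'a set") (App: "'a \<Rightarrow> 'b")

definition linear_op :: "('a::complex_normed_vector, 'b::complex_normed_vector) op \<Rightarrow> bool" where
  "linear_op S \<longleftrightarrow> csubspace (Dom S)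
     \<and> (\<forall>x\<in>Dom S. \<forall>y\<in>Dom S. App S (x + y) = App S x + App S y)
     \<and> (\<forall>a. \<forall>x\<in>Dom S. App S (a *\<^sub>C x) = a *\<^sub>C App S x)"

definition graph :: "('a, 'b) op \<Rightarrow> ('a \<times> 'b) set" where
  "graph S = {(x, App S x) | x. x \<in> Dom S}"

definition restrict_op :: "('a, 'b) op \<Rightarrow> 'a set \<Rightarrow> ('a, 'b) op" where
  "restrict_op S V = Op (Dom S \<inter> V) (App S)"

definition uminus_op :: "('a, 'b::uminus) op \<Rightarrow> ('a, 'b) op" where
  "uminus_op S = Op (Dom S) (\<lambda>x. - App S x)"

(* S - z *)
definition shift_op :: "('a::complex_normed_vector, 'a) op \<Rightarrow> complex \<Rightarrow> ('a, 'a) op" where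
  "shift_op S z = Op (Dom S) (\<lambda>x. App S x - z *\<^sub>C x)"

definition comp_op :: "('b, 'c) op \<Rightarrow> ('a, 'b) op \<Rightarrow> ('a, 'c) op" where
  "comp_op R S = Op {x \<in> Dom S. App S x \<in> Dom R} (\<lambda>x. App R (App S x))"

(* meaningful for injective S only *)
definition inverse_op :: "('a, 'b) op \<Rightarrow> ('b, 'a) op" where
  "inverse_op S = Op (App S ` Dom S) (inv_into (Dom S) (App S))"

definition kernel_op :: "('a, 'b::zero) op \<Rightarrow> 'a set" where
  "kernel_op S = {x \<in> Dom S. App S x = 0}"

definition densely_defined :: "('a::topological_space, 'b) op \<Rightarrow> bool" where
  "densely_defined S \<longleftrightarrow> closure (Dom S) = UNIV"

definition closed_op :: "('a::topological_space, 'b::topological_space) op \<Rightarrow> bool" where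
  "closed_op S \<longleftrightarrow> closed (graph S)"

definition core :: "('a::complex_normed_vector, 'b::complex_normed_vector) op \<Rightarrow> 'a set \<Rightarrow> bool" where
  "core X D \<longleftrightarrow> closed_op X \<and> csubspace D \<and> D \<subseteq> Dom X
     \<and> graph X = closure (graph (restrict_op X D))"

(* adjoint of a densely defined operator; density makes the value unique *)
definition adjoint_op :: "('a::complex_hilbert, 'b::complex_hilbert) op \<Rightarrow> ('b, 'a) op" where
  "adjoint_op S = Op {y. \<exists>z. \<forall>x\<in>Dom S. cinner (App S x) y = cinner x z}
     (\<lambda>y. THE z. \<forall>x\<in>Dom S. cinner (App S x) y = cinner x z)"

definition symmetric_op :: "('a::complex_hilbert, 'a) op \<Rightarrow> bool" where
  "symmetric_op S \<longleftrightarrow> linear_op S \<and> densely_defined S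
     \<and> (\<forall>x\<in>Dom S. \<forall>y\<in>Dom S. cinner (App S x) y = cinner x (App S y))"

definition selfadjoint_op :: "('a::complex_hilbert, 'a) op \<Rightarrow> bool" where
  "selfadjoint_op S \<longleftrightarrow> linear_op S \<and> densely_defined S \<and> graph S = graph (adjoint_op S)"

definition nonnegative_op :: "('a::complex_hilbert, 'a) op \<Rightarrow> bool" where
  "nonnegative_op S \<longleftrightarrow> (\<forall>u\<in>Dom S. cinner (App S u) u \<in> \<real>\<^sub>\<ge>\<^sub>0)"

definition nonpositive_op :: "('a::complex_hilbert, 'a) op \<Rightarrow> bool" where
  "nonpositive_op S \<longleftrightarrow> (\<forall>u\<in>Dom S. cinner (App S u) u \<in> \<real>\<^sub>\<le>\<^sub>0)"


section \<open>Spectrum, sectorial and dichotomous operators\<close>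

(* Resolvent set and spectrum of a linear operator S in the closed subspace V, regarded as a
   Banach space: S - z is a bijection of Dom S onto V with bounded inverse. *)
definition resolvent_set :: "'a::complex_normed_vector set \<Rightarrow> ('a, 'a) op \<Rightarrow> complex set" where
  "resolvent_set V S = {z. bij_betw (App (shift_op S z)) (Dom S) V
     \<and> (\<exists>c. \<forall>y\<in>V. norm (App (inverse_op (shift_op S z)) y) \<le> c * norm y)}"

definition spectrum :: "'a::complex_normed_vector set \<Rightarrow> ('a, 'a) op \<Rightarrow> complex set" where
  "spectrum V S = - resolvent_set V S"

abbreviation resolvent :: "('a::complex_normed_vector, 'a) op \<Rightarrow> complex \<Rightarrow> 'a \<Rightarrow> 'a" where
  "resolvent S z \<equiv> App (inverse_op (shift_op S z))"

(* S is a sectorial operator in the Banach space V. The library's Arg takes values in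
   (-pi, pi] and satisfies Arg 0 = 0. *)
definition sectorial :: "'a::complex_normed_vector set \<Rightarrow> real \<Rightarrow> ('a, 'a) op \<Rightarrow> bool" where
  "sectorial V \<theta> S \<longleftrightarrow> 0 \<le> \<theta> \<and> \<theta> < pi
     \<and> linear_op S \<and> Dom S \<subseteq> V \<and> App S ` Dom S \<subseteq> V \<and> V \<subseteq> closure (Dom S)
     \<and> spectrum V S \<subseteq> {z. \<bar>Arg z\<bar> \<le> \<theta>}
     \<and> (\<forall>\<theta>'. \<theta> < \<theta>' \<and> \<theta>' \<le> pi \<longrightarrow>
          (\<exists>M>0. \<forall>z. \<bar>Arg z\<bar> \<ge> \<theta>' \<and> cmod z > 0 \<longrightarrow>
             (\<forall>y\<in>V. norm (resolvent S z y) \<le> M / cmod z * norm y)))"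

definition complementary :: "'a::complex_normed_vector set \<Rightarrow> 'a set \<Rightarrow> bool" where
  "complementary V W \<longleftrightarrow> csubspace V \<and> csubspace W \<and> closed V \<and> closed W
     \<and> V \<inter> W = {0} \<and> {v + w | v w. v \<in> V \<and> w \<in> W} = UNIV"

(* projection onto V along W *)
definition proj_along :: "'a::complex_normed_vector set \<Rightarrow> 'a set \<Rightarrow> 'a \<Rightarrow> 'a" where
  "proj_along V W x = (THE v. v \<in> V \<and> x - v \<in> W)"

definition dichotomy ::
    "('a::complex_banach, 'a) op \<Rightarrow> 'a set \<Rightarrow> 'a set \<Rightarrow> bool" where
  "dichotomy S Vp Vm \<longleftrightarrow> linear_op S \<and> densely_defined S \<and> complementary Vp Vm
     \<and> (\<exists>h>0. {z. \<bar>Re z\<bar> < h} \<subseteq> resolvent_set UNIV S)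
     \<and> App S ` (Dom S \<inter> Vp) \<subseteq> Vp \<and> App S ` (Dom S \<inter> Vm) \<subseteq> Vm
     \<and> spectrum Vp (restrict_op S Vp) \<subseteq> {z. Re z > 0}
     \<and> spectrum Vm (restrict_op S Vm) \<subseteq> {z. Re z < 0}"

definition dichotomous :: "('a::complex_banach, 'a) op \<Rightarrow> bool" where
  "dichotomous S \<longleftrightarrow> (\<exists>Vp Vm. dichotomy S Vp Vm)"

definition sectorially_dichotomous :: "('a::complex_banach, 'a) op \<Rightarrow> bool" where
  "sectorially_dichotomous S \<longleftrightarrow> (\<exists>Vp Vm \<theta>. dichotomy S Vp Vm \<and> 0 \<le> \<theta> \<and> \<theta> < pi / 2
     \<and> sectorial Vp \<theta> (restrict_op S Vp)
     \<and> sectorial Vm \<theta> (uminus_op (restrict_op S Vm)))"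

(* I is the principal value at infinity of the integral of f along the imaginary axis,
   parametrised by z = i t, dz = i dt *)
definition has_pv_integral_iR :: "(complex \<Rightarrow> 'a::complex_banach) \<Rightarrow> 'a \<Rightarrow> bool" where
  "has_pv_integral_iR f I \<longleftrightarrow>
     (\<forall>\<rho>>0. (\<lambda>t. f (\<i> * complex_of_real t)) integrable_on {-\<rho>..\<rho>})
     \<and> ((\<lambda>\<rho>. \<i> *\<^sub>C integral {-\<rho>..\<rho>} (\<lambda>t. f (\<i> * complex_of_real t))) \<longlongrightarrow> I) at_top"

(* A dichotomous operator can have several decompositions; the integral formula singles out
   one, since it determines the difference of the projections, whose sum is the identity. *)
definition spectral_subspaces ::
    "('a::complex_banach, 'a) op \<Rightarrow> 'a set \<Rightarrow> 'a set \<Rightarrow> bool" where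
  "spectral_subspaces S Vp Vm \<longleftrightarrow> dichotomy S Vp Vm
     \<and> (\<forall>x. \<exists>I. has_pv_integral_iR (\<lambda>z. resolvent S z x) I
          \<and> (1 / (complex_of_real pi * \<i>)) *\<^sub>C I = proj_along Vp Vm x - proj_along Vm Vp x)"


section \<open>Hamiltonians\<close>

(* (norm x) to the power p, with the convention 0 to the power 0 = 1, whereas 0 powr 0 = 0 *)
definition norm_pow :: "'a::real_normed_vector \<Rightarrow> real \<Rightarrow> real" where
  "norm_pow x p = (if p = 0 then 1 else norm x powr p)"

definition subordinate ::
    "real \<Rightarrow> ('a::complex_normed_vector, 'b::complex_normed_vector) op
      \<Rightarrow> ('a, 'c::complex_normed_vector) op \<Rightarrow> bool" where
  "subordinate p R S \<longleftrightarrow> 0 \<le> p \<and> p \<le> 1 \<and> Dom S \<subseteq> Dom R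
     \<and> (\<exists>c\<ge>0. \<forall>x\<in>Dom S. norm (App R x) \<le> c * norm_pow x (1 - p) * norm_pow (App S x) p)"

definition hamiltonian ::
    "('a::complex_hilbert, 'a) op \<Rightarrow> ('a, 'a) op \<Rightarrow> ('a, 'a) op \<Rightarrow> bool" where
  "hamiltonian A B C \<longleftrightarrow> linear_op A \<and> densely_defined A \<and> closed_op A
     \<and> symmetric_op B \<and> symmetric_op C"

(* the block operator matrix with rows A, B and C, - A* *)
definition hamiltonian_op ::
    "('a::complex_hilbert, 'a) op \<Rightarrow> ('a, 'a) op \<Rightarrow> ('a, 'a) op \<Rightarrow> ('a \<times> 'a, 'a \<times> 'a) op" where
  "hamiltonian_op A B C =
     Op ((Dom A \<inter> Dom C) \<times> (Dom B \<inter> Dom (adjoint_op A)))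
        (\<lambda>(u, v). (App A u + App B v, App C u - App (adjoint_op A) v))"

definition nonnegative_hamiltonian ::
    "('a::complex_hilbert, 'a) op \<Rightarrow> ('a, 'a) op \<Rightarrow> ('a, 'a) op \<Rightarrow> bool" where
  "nonnegative_hamiltonian A B C \<longleftrightarrow> hamiltonian A B C \<and> nonnegative_op B \<and> nonnegative_op C"

definition diagonally_dominant ::
    "real \<Rightarrow> ('a::complex_hilbert, 'a) op \<Rightarrow> ('a, 'a) op \<Rightarrow> ('a, 'a) op \<Rightarrow> bool" where
  "diagonally_dominant p A B C \<longleftrightarrow> subordinate p C A \<and> subordinate p B (adjoint_op A)"

(* the elements u of Dom A with u in Dom X and X u in the domain of the adjoint of A *)
definition riccati_dom :: "('a::complex_hilbert, 'a) op \<Rightarrow> ('a, 'a) op \<Rightarrow> 'a set" where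
  "riccati_dom A X = Dom A \<inter> {u \<in> Dom X. App X u \<in> Dom (adjoint_op A)}"

(* (A* X + X (A + B X) - C) u = 0 for all u in D, including that every term is defined *)
definition riccati_on ::
    "('a::complex_hilbert, 'a) op \<Rightarrow> ('a, 'a) op \<Rightarrow> ('a, 'a) op \<Rightarrow> ('a, 'a) op \<Rightarrow> 'a set \<Rightarrow> bool" where
  "riccati_on A B C X D \<longleftrightarrow> (\<forall>u\<in>D.
     u \<in> Dom A \<and> u \<in> Dom C \<and> u \<in> Dom X \<and> App X u \<in> Dom (adjoint_op A) \<and> App X u \<in> Dom B
     \<and> App A u + App B (App X u) \<in> Dom X
     \<and> App (adjoint_op A) (App X u) + App X (App A u + App B (App X u)) - App C u = 0)"

end

theory Submission
  imports Defs "HOL-Complex_Analysis.Complex_Analysis" "HOL-Real_Asymp.Real_Asymp"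
begin

text \<open>
  Write \<open>T\<close> for the Hamiltonian and \<open>(u, v)\<close>, \<open>(a, b)\<close> for elements of \<open>H \<times> H\<close>. Two indefinite
  forms govern the proof. With respect to \<open>{x, y} = (u | b) - (v | a)\<close> the operator \<open>T\<close> is skew,
  \<open>{T x, y} = - {x, T y}\<close>, and with respect to \<open>[x, y] = (u | b) + (v | a)\<close> it is accretive: \<open>Re [T x, x]\<close>
  is the energy \<open>(B v | v) + (C u | u)\<close>, because the contribution of the diagonal entries is purely imaginary.

  The energy controls the resolvent on the imaginary axis. If \<open>f = (T - \<i> t) x\<close>, then
  \<open>u = (A - \<i> t)\<^sup>-\<^sup>1 (f\<^sub>1 - B v)\<close>; here \<open>(A - \<i> t)\<^sup>-\<^sup>1 B v\<close> is bounded by the square root of the energy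
  (Cauchy-Schwarz for the form of \<open>B\<close>), and the energy is at most \<open>\<parallel>f\<parallel> \<parallel>x\<parallel>\<close>. With the same
  argument for \<open>v\<close> this gives \<open>\<parallel>x\<parallel> \<le> M / (1 + \<bar>t\<bar>) \<parallel>f\<parallel>\<close> (\<open>T_bounded_below\<close>). As \<open>p < 1\<close>, the
  off-diagonal entries are a small perturbation of \<open>diag (A, - A\<^sup>*)\<close> for large \<open>t\<close>, so \<open>T - \<i> t\<close>
  is surjective there, and by the lower bound it is surjective for every \<open>t\<close>.

  This decay of the resolvent makes the principal value
  \<open>Q x = (1 / \<pi>) lim \<integral>\<^sub>-\<^sub>r\<^sup>r (T - \<i> t)\<^sup>-\<^sup>1 x dt\<close> converge for \<open>x\<close> in the domain. It converges everywhere
  as soon as the truncated integrals are uniformly bounded: for \<open>A\<close> by Cauchy's theorem on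
  each of its spectral subspaces (\<open>sectorial_integral_bound\<close>), for \<open>- A\<^sup>*\<close> by duality, and for \<open>T\<close> because its
  resolvent differs from that of \<open>diag (A, - A\<^sup>*)\<close> by \<open>O (\<bar>t\<bar>\<^bsup>p - 2\<^esup>)\<close> (\<open>T_integral_bound\<close>). The
  Cauchy type integral \<open>\<Psi> z = (1 / 2 \<pi> \<i>) \<integral> (T - w)\<^sup>-\<^sup>1 / (w - z) dw\<close> satisfies \<open>(T - z) \<Psi> z = (Q \<plusminus> 1) / 2\<close> in the
  left and the right half-plane respectively. A Liouville argument turns this into \<open>Q\<^sup>2 = 1\<close> (\<open>Q_involution\<close>);
  then \<open>\<plusminus> \<Psi> z\<close> is the resolvent of the part of \<open>T\<close> in the range \<open>V\<^sub>\<plusminus>\<close> of the projection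
  \<open>(1 \<plusminus> Q) / 2\<close>, and \<open>V\<^sub>\<plusminus>\<close> are the spectral subspaces (\<open>spectral_subspaces_V\<close>).

  Integrating the two forms along the axis gives the assertions on \<open>X\<^sub>\<plusminus>\<close>. From
  \<open>{Q x, y} = - {x, Q y}\<close> each of \<open>V\<^sub>\<plusminus>\<close> is its own orthogonal complement for \<open>{_, _}\<close>, which for a graph
  means selfadjointness (\<open>V_lagrangian\<close>). Since \<open>\<pi> Re [Q x, x]\<close> is the integral of the energy of
  \<open>(T - \<i> t)\<^sup>-\<^sup>1 x\<close>, the form \<open>[_, _]\<close> is nonnegative on \<open>V\<^sub>+\<close> and nonpositive on \<open>V\<^sub>-\<close>. For
  \<open>x = (0, v)\<close> in one of the subspaces it vanishes, hence so does the energy for all \<open>t\<close>; this means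
  \<open>B (A\<^sup>* + \<i> t)\<^sup>-\<^sup>1 v = 0\<close> for all \<open>t\<close> and thus \<open>v = 0\<close>, so that \<open>V\<^sub>\<plusminus>\<close> are graphs (\<open>V_graph\<close>). Finally the
  projections preserve the domain of \<open>T\<close>, which makes \<open>V\<^sub>\<plusminus> \<inter> D(T)\<close> dense in \<open>V\<^sub>\<plusminus>\<close>, the
  core property; and the Riccati equation is the invariance of \<open>V\<^sub>\<plusminus>\<close> read on graphs.
\<close>

section \<open>Complex Hilbert spaces\<close>

interpretation cvs: vector_space "(*\<^sub>C) :: complex \<Rightarrow> 'a \<Rightarrow> 'a::complex_normed_vector"
  by (rule vector_space_scaleC)

lemma scaleR_scaleC: "r *\<^sub>R x = complex_of_real r *\<^sub>C (x::'a::complex_normed_vector)"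
  by (simp add: scaleC_of_real)

lemma bounded_linear_scaleC: "bounded_linear (\<lambda>x::'a::complex_normed_vector. c *\<^sub>C x)"
  by (rule bounded_linear_intro[where K="cmod c"])
     (simp_all add: scaleC_add_right scaleR_scaleC scaleC_scaleC norm_scaleC mult.commute)

lemma bounded_bilinear_scaleC:
  "bounded_bilinear ((*\<^sub>C) :: complex \<Rightarrow> 'a \<Rightarrow> 'a::complex_normed_vector)"
  by (rule bounded_bilinear.intro)
     (auto simp: scaleC_add_right scaleC_add_left scaleR_scaleC scaleC_scaleC norm_scaleC
         scaleR_conv_of_real mult.commute intro!: exI[of _ 1])

lemmas continuous_on_scaleC [continuous_intros] =
  bounded_bilinear.continuous_on[OF bounded_bilinear_scaleC]
lemmas tendsto_scaleC [tendsto_intros] = bounded_bilinear.tendsto[OF bounded_bilinear_scaleC]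

lemma csubspace_scaleR: "csubspace V \<Longrightarrow> x \<in> V \<Longrightarrow> r *\<^sub>R x \<in> V"
  by (simp add: scaleR_scaleC cvs.subspace_scale)

lemma csubspace_closure:
  fixes V :: "'a::complex_normed_vector set"
  assumes "csubspace V"
  shows "csubspace (closure V)"
proof (rule cvs.subspaceI)
  show "0 \<in> closure V"
    using cvs.subspace_0[OF assms] closure_subset by blast
next
  fix x y assume "x \<in> closure V" "y \<in> closure V"
  then obtain f g where "\<forall>n. f n \<in> V" "f \<longlonglongrightarrow> x" "\<forall>n. g n \<in> V" "g \<longlonglongrightarrow> y"
    by (auto simp: closure_sequential)
  then show "x + y \<in> closure V"
    unfolding closure_sequential
    by (intro exI[of _ "\<lambda>n. f n + g n"]) (auto intro: tendsto_add cvs.subspace_add[OF assms])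
next
  fix c x assume "x \<in> closure V"
  then obtain f where "\<forall>n. f n \<in> V" "f \<longlonglongrightarrow> x"
    by (auto simp: closure_sequential)
  then show "c *\<^sub>C x \<in> closure V"
    unfolding closure_sequential
    by (intro exI[of _ "\<lambda>n. c *\<^sub>C f n"]) (auto intro: tendsto_intros cvs.subspace_scale[OF assms])
qed

lemma cinner_add_right: "cinner x (y + z) = cinner x y + cinner x (z::'a::complex_hilbert)"
  using cinner_add_left[of y z x] cinner_commute[of x] by (metis complex_cnj_add)

lemma cinner_scaleC_right: "cinner x (a *\<^sub>C y) = cnj a * cinner x (y::'a::complex_hilbert)"
  using cinner_scaleC_left[of a y x] cinner_commute[of x] by (metis complex_cnj_mult)

lemma cinner_zero_left [simp]: "cinner 0 (y::'a::complex_hilbert) = 0"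
  using cinner_scaleC_left[of 0 0 y] by simp

lemma cinner_zero_right [simp]: "cinner (y::'a::complex_hilbert) 0 = 0"
  using cinner_scaleC_right[of y 0 0] by simp

lemma cinner_minus_left: "cinner (- x) (y::'a::complex_hilbert) = - cinner x y"
  using cinner_add_left[of x "-x" y] by (simp add: add_eq_0_iff)

lemma cinner_minus_right: "cinner x (- y) = - cinner x (y::'a::complex_hilbert)"
  using cinner_add_right[of x y "-y"] by (simp add: add_eq_0_iff)

lemma cinner_diff_left: "cinner (x - y) z = cinner x z - cinner y (z::'a::complex_hilbert)"
  using cinner_add_left[of x "-y" z] by (simp add: cinner_minus_left)

lemma cinner_diff_right: "cinner x (y - z) = cinner x y - cinner x (z::'a::complex_hilbert)"
  using cinner_add_right[of x y "-z"] by (simp add: cinner_minus_right)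

lemmas cinner_simps = cinner_add_left cinner_add_right cinner_diff_left cinner_diff_right
  cinner_minus_left cinner_minus_right cinner_scaleC_left cinner_scaleC_right

lemma cinner_eq_zero_iff [simp]: "cinner x x = 0 \<longleftrightarrow> (x::'a::complex_hilbert) = 0"
  by (simp add: cinner_self)

text \<open>The form is not required to be definite: the lemma serves the inner product and the forms
  of nonnegative symmetric operators alike. If \<^term>\<open>h y y\<close> vanishes, a large multiple of
  \<^term>\<open>y\<close> still contradicts positivity unless \<^term>\<open>h x y\<close> vanishes.\<close>

lemma cauchy_schwarz_form:
  fixes h :: "'a::complex_normed_vector \<Rightarrow> 'a \<Rightarrow> complex"
  assumes D: "csubspace D"
    and add: "\<And>x y z. x \<in> D \<Longrightarrow> y \<in> D \<Longrightarrow> z \<in> D \<Longrightarrow> h (x + y) z = h x z + h y z"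
    and scale: "\<And>a x y. x \<in> D \<Longrightarrow> y \<in> D \<Longrightarrow> h (a *\<^sub>C x) y = a * h x y"
    and sym: "\<And>x y. x \<in> D \<Longrightarrow> y \<in> D \<Longrightarrow> h x y = cnj (h y x)"
    and pos: "\<And>x. x \<in> D \<Longrightarrow> 0 \<le> Re (h x x)"
    and x: "x \<in> D" and y: "y \<in> D"
  shows "(cmod (h x y))\<^sup>2 \<le> Re (h x x) * Re (h y y)"
proof -
  let ?b = "h x y"
  have key: "0 \<le> Re (h x x) - 2 * s * (cmod ?b)\<^sup>2 + s\<^sup>2 * (cmod ?b)\<^sup>2 * Re (h y y)" for s :: real
  proof -
    \<comment> \<open>The phase of \<^term>\<open>?b\<close> makes the cross terms real.\<close>
    define c where "c = - complex_of_real s * ?b"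
    have cy: "c *\<^sub>C y \<in> D" and xcy: "x + c *\<^sub>C y \<in> D"
      using x y D by (auto intro: cvs.subspace_add cvs.subspace_scale)
    have yx: "h y x = cnj ?b" by (rule sym[OF y x])
    have bb: "?b * cnj ?b = complex_of_real ((cmod ?b)\<^sup>2)" by (rule complex_norm_square[symmetric])
    have r: "h u (x + c *\<^sub>C y) = h u x + cnj c * h u y" if "u \<in> D" for u
    proof -
      have "h u (x + c *\<^sub>C y) = cnj (h x u + c * h y u)"
        using sym[OF that xcy] add[OF x cy that] scale[OF y that] by simp
      then show ?thesis
        using sym[OF that x] sym[OF that y] by simp
    qed
    have "h (x + c *\<^sub>C y) (x + c *\<^sub>C y) = h x x + cnj c * ?b + c * (cnj ?b + cnj c * h y y)"
      using add[OF x cy xcy] scale[OF y xcy] r[OF x] r[OF y] yx by simp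
    moreover have "cnj c * ?b = - complex_of_real s * (cmod ?b)\<^sup>2"
      and "c * cnj ?b = - complex_of_real s * (cmod ?b)\<^sup>2"
      and "c * cnj c = complex_of_real (s\<^sup>2 * (cmod ?b)\<^sup>2)"
      using bb by (simp_all add: c_def power2_eq_square mult_ac)
    moreover have "c * (cnj ?b + cnj c * h y y) = c * cnj ?b + (c * cnj c) * h y y"
      by (simp add: algebra_simps)
    ultimately have "Re (h (x + c *\<^sub>C y) (x + c *\<^sub>C y)) =
        Re (h x x) - 2 * s * (cmod ?b)\<^sup>2 + s\<^sup>2 * (cmod ?b)\<^sup>2 * Re (h y y)"
      by (simp del: of_real_mult of_real_power add: of_real_mult[symmetric] of_real_power[symmetric] Re_complex_of_real)
    with pos[OF xcy] show ?thesis by simp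
  qed
  show ?thesis
  proof (cases "?b = 0")
    case True
    then show ?thesis using pos[OF x] pos[OF y] by simp
  next
    case b: False
    then have b2: "0 < (cmod ?b)\<^sup>2" by simp
    show ?thesis
    proof (cases "Re (h y y) = 0")
      case True
      have "0 \<le> Re (h x x) - (Re (h x x) + 1)"
        using key[of "(Re (h x x) + 1) / (2 * (cmod ?b)\<^sup>2)"] b2 True by simp
      then show ?thesis by simp
    next
      case False
      with pos[OF y] have hy: "0 < Re (h y y)" by simp
      have "0 \<le> Re (h x x) - (cmod ?b)\<^sup>2 / Re (h y y)"
        using key[of "1 / Re (h y y)"] hy by (simp add: power2_eq_square field_simps)
      with hy show ?thesis by (simp add: field_simps)
    qed
  qed
qed

lemma cinner_cauchy_schwarz: "cmod (cinner x y) \<le> norm x * norm (y::'a::complex_hilbert)"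
proof -
  have "(cmod (cinner x y))\<^sup>2 \<le> Re (cinner x x) * Re (cinner y y)"
    by (rule cauchy_schwarz_form[where D=UNIV])
       (auto simp: cinner_add_left cinner_scaleC_left cinner_self cvs.subspace_UNIV
         intro: cinner_commute simp flip: of_real_power)
  also have "\<dots> = (norm x * norm y)\<^sup>2"
    by (simp add: cinner_self power_mult_distrib flip: of_real_power)
  finally show ?thesis
    by (rule power2_le_imp_le) simp
qed

lemma bounded_linear_cinner_left: "bounded_linear (\<lambda>x. cinner x (y::'a::complex_hilbert))"
  by (rule bounded_linear_intro[where K="norm y"])
     (simp_all add: cinner_add_left scaleR_scaleC cinner_scaleC_left scaleR_conv_of_real
        cinner_cauchy_schwarz)

lemma bounded_bilinear_cinner: "bounded_bilinear (cinner :: 'a::complex_hilbert \<Rightarrow> 'a \<Rightarrow> complex)"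
  by (rule bounded_bilinear.intro)
     (auto simp: cinner_add_left cinner_add_right scaleR_scaleC cinner_scaleC_left
        cinner_scaleC_right scaleR_conv_of_real cinner_cauchy_schwarz intro!: exI[of _ 1])

lemmas tendsto_cinner [tendsto_intros] = bounded_bilinear.tendsto[OF bounded_bilinear_cinner]
lemmas continuous_on_cinner [continuous_intros] =
  bounded_bilinear.continuous_on[OF bounded_bilinear_cinner]

lemma norm_le_if_cinner_le:
  fixes x :: "'a::complex_hilbert"
  assumes "0 \<le> c" "\<And>y. cmod (cinner x y) \<le> c * norm y"
  shows "norm x \<le> c"
proof (cases "x = 0")
  case False
  have "norm x * norm x \<le> c * norm x"
    using assms(2)[of x] by (simp add: cinner_self norm_power power2_eq_square norm_mult)
  with False show ?thesis by simp
qed (use assms(1) in simp)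

instantiation prod :: (complex_hilbert, complex_hilbert) complex_hilbert
begin

definition cinner_prod_def: "cinner x y = cinner (fst x) (fst y) + cinner (snd x) (snd y)"

instance
proof
  fix a :: complex and x y z :: "'a \<times> 'b"
  show "cinner (x + y) z = cinner x z + cinner y z"
    by (simp add: cinner_prod_def cinner_add_left)
  show "cinner (a *\<^sub>C x) y = a * cinner x y"
    by (simp add: cinner_prod_def scaleC_prod_def cinner_scaleC_left distrib_left)
  show "cinner x y = cnj (cinner y x)"
    unfolding cinner_prod_def by (metis cinner_commute complex_cnj_add)
  show "cinner x x = complex_of_real ((norm x)\<^sup>2)"
    by (simp add: cinner_prod_def cinner_self norm_prod_def)
qed

end

lemma norm_diff_square:
  fixes x y :: "'a::complex_hilbert"
  shows "(norm (x - y))\<^sup>2 = (norm x)\<^sup>2 - 2 * Re (cinner x y) + (norm y)\<^sup>2"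
proof -
  have "complex_of_real ((norm (x - y))\<^sup>2) = cinner (x - y) (x - y)"
    by (rule cinner_self[symmetric])
  also have "\<dots> = complex_of_real ((norm x)\<^sup>2) - (cinner x y + cnj (cinner x y)) + complex_of_real ((norm y)\<^sup>2)"
    by (subst cinner_diff_left, subst (1 2) cinner_diff_right)
       (simp add: cinner_self cinner_commute[of y x])
  also have "cinner x y + cnj (cinner x y) = complex_of_real (2 * Re (cinner x y))"
    by (simp add: complex_eq_iff)
  finally show ?thesis
    by (simp only: of_real_diff[symmetric] of_real_add[symmetric] of_real_eq_iff)
qed

lemma parallelogram_law:
  fixes x y :: "'a::complex_hilbert"
  shows "(norm (x - y))\<^sup>2 + (norm (x + y))\<^sup>2 = 2 * (norm x)\<^sup>2 + 2 * (norm y)\<^sup>2"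
  using norm_diff_square[of x y] norm_diff_square[of x "-y"] by (simp add: cinner_minus_right)

text \<open>A minimising sequence for the distance to the subspace is Cauchy by the parallelogram_law
  law, and its limit is the orthogonal projection.\<close>

lemma orthogonal_projection_exists:
  fixes V :: "'a::complex_hilbert set"
  assumes V: "csubspace V" and cl: "closed V"
  shows "\<exists>v\<in>V. \<forall>w\<in>V. cinner w (x - v) = 0"
proof -
  define d where "d = infdist x V"
  have d0: "0 \<le> d" by (simp add: d_def infdist_nonneg)
  have ne: "V \<noteq> {}" using cvs.subspace_0[OF V] by blast
  have dle: "d \<le> norm (x - v)" if "v \<in> V" for v
    using infdist_le[OF that, of x] by (simp add: d_def dist_norm)
  have "\<exists>v\<in>V. (norm (x - v))\<^sup>2 < d\<^sup>2 + 1 / real (Suc n)" for n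
  proof -
    have "d < sqrt (d\<^sup>2 + 1 / real (Suc n))"
      using d0 by (intro real_less_rsqrt) simp
    then have "(INF v\<in>V. dist x v) < sqrt (d\<^sup>2 + 1 / real (Suc n))"
      using ne by (simp add: d_def infdist_notempty)
    then obtain v where v: "v \<in> V" "dist x v < sqrt (d\<^sup>2 + 1 / real (Suc n))"
      using cINF_less_iff[OF ne, of "dist x"] by (auto simp: bdd_below_def intro: zero_le_dist)
    then have "(norm (x - v))\<^sup>2 < (sqrt (d\<^sup>2 + 1 / real (Suc n)))\<^sup>2"
      by (intro power_strict_mono) (auto simp: dist_norm)
    also have "\<dots> = d\<^sup>2 + 1 / real (Suc n)" by simp
    finally show ?thesis using v by blast
  qed
  then obtain f where fV: "\<And>n. f n \<in> V" and f: "\<And>n. (norm (x - f n))\<^sup>2 < d\<^sup>2 + 1 / real (Suc n)"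
    by metis
  have diff: "(norm (f m - f n))\<^sup>2 \<le> 2 / real (Suc m) + 2 / real (Suc n)" for m n
  proof -
    have "d \<le> norm (x - (1/2) *\<^sub>R (f m + f n))"
      by (intro dle csubspace_scaleR cvs.subspace_add V fV)
    also have "x - (1/2) *\<^sub>R (f m + f n) = (1/2) *\<^sub>R ((x - f m) + (x - f n))"
      by (simp add: scaleR_right_distrib scaleR_right_diff_distrib flip: scaleR_2 scaleR_add_left)
    finally have "2 * d \<le> norm ((x - f m) + (x - f n))" by simp
    then have "(2 * d)\<^sup>2 \<le> (norm ((x - f m) + (x - f n)))\<^sup>2"
      using d0 by (intro power_mono) auto
    moreover have "norm ((x - f m) - (x - f n)) = norm (f m - f n)"
      by (simp add: norm_minus_commute)
    ultimately show ?thesis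
      using parallelogram_law[of "x - f m" "x - f n"] f[of m] f[of n]
      by (simp add: power2_eq_square)
  qed
  have "Cauchy f"
  proof (rule CauchyI)
    fix e :: real assume e: "0 < e"
    obtain N where N: "4 / e\<^sup>2 < real (Suc N)"
      using reals_Archimedean2[of "4 / e\<^sup>2"] by (metis less_trans lessI of_nat_less_iff)
    have "norm (f m - f n) < e" if "N \<le> m" "N \<le> n" for m n
    proof -
      have "2 / real (Suc m) \<le> 2 / real (Suc N)" "2 / real (Suc n) \<le> 2 / real (Suc N)"
        using that by (auto intro!: divide_left_mono)
      with diff[of m n] have "(norm (f m - f n))\<^sup>2 \<le> 4 / real (Suc N)" by simp
      also have "\<dots> < e\<^sup>2" using N e by (simp add: field_simps)
      finally show ?thesis using e by (simp add: power2_less_imp_less)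
    qed
    then show "\<exists>N. \<forall>m\<ge>N. \<forall>n\<ge>N. norm (f m - f n) < e" by blast
  qed
  then obtain v where v: "f \<longlonglongrightarrow> v" using Cauchy_convergent convergent_def by blast
  have vV: "v \<in> V" using closed_sequentially[OF cl _ v] fV by blast
  have vd: "(norm (x - v))\<^sup>2 \<le> d\<^sup>2"
  proof (rule LIMSEQ_le)
    show "(\<lambda>n. (norm (x - f n))\<^sup>2) \<longlonglongrightarrow> (norm (x - v))\<^sup>2" by (intro tendsto_intros v)
    show "(\<lambda>n. d\<^sup>2 + 1 / real (Suc n)) \<longlonglongrightarrow> d\<^sup>2"
      using tendsto_add[OF tendsto_const LIMSEQ_inverse_real_of_nat, of "d\<^sup>2"] by (simp add: inverse_eq_divide)
    show "\<exists>N. \<forall>n\<ge>N. (norm (x - f n))\<^sup>2 \<le> d\<^sup>2 + 1 / real (Suc n)" using f less_imp_le by blast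
  qed
  have "cinner w (x - v) = 0" if w: "w \<in> V" for w
  proof (rule ccontr)
    assume b: "cinner w (x - v) \<noteq> 0"
    define e where "e = x - v"
    define b where "b = cinner w e"
    \<comment> \<open>A step \<open>c w\<close> towards \<^term>\<open>x\<close>, short enough for the linear gain to exceed the
        quadratic loss, would bring \<^term>\<open>v\<close> closer to \<^term>\<open>x\<close>.\<close>
    define s where "s = 1 / ((norm w)\<^sup>2 + 1)"
    define c where "c = complex_of_real s * cnj b"
    have s: "0 < s" "s * (norm w)\<^sup>2 < 1"
      by (auto simp: s_def add_nonneg_pos intro: add_nonneg_pos)
    have b0: "0 < (cmod b)\<^sup>2" using \<open>cinner w (x - v) \<noteq> 0\<close> by (simp add: b_def e_def)
    have "d\<^sup>2 \<le> (norm (x - (v + c *\<^sub>C w)))\<^sup>2"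
      using d0 by (intro power_mono dle cvs.subspace_add cvs.subspace_scale V vV w)
    also have "x - (v + c *\<^sub>C w) = e - c *\<^sub>C w" by (simp add: e_def)
    also have "(norm (e - c *\<^sub>C w))\<^sup>2 = (norm e)\<^sup>2 - 2 * Re (cinner (c *\<^sub>C w) e) + (cmod c)\<^sup>2 * (norm w)\<^sup>2"
      using norm_diff_square[of e "c *\<^sub>C w"] cinner_commute[of e "c *\<^sub>C w"]
      by (simp add: norm_scaleC power_mult_distrib)
    also have "Re (cinner (c *\<^sub>C w) e) = s * (cmod b)\<^sup>2"
      by (simp add: cinner_scaleC_left c_def b_def[symmetric] mult.assoc mult.commute[of "cnj b"]
          complex_norm_square[symmetric] flip: of_real_power of_real_mult)
    also have "(cmod c)\<^sup>2 = s\<^sup>2 * (cmod b)\<^sup>2"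
      by (simp add: c_def norm_mult power_mult_distrib)
    finally have "2 * s * (cmod b)\<^sup>2 \<le> s * (cmod b)\<^sup>2 * (s * (norm w)\<^sup>2)"
      using vd by (simp add: e_def power2_eq_square algebra_simps)
    also have "\<dots> \<le> s * (cmod b)\<^sup>2 * 1"
      using s b0 by (intro mult_left_mono) auto
    finally show False using s b0 by simp
  qed
  with vV show ?thesis by blast
qed

lemma dense_if_orthogonal_trivial:
  fixes V :: "'a::complex_hilbert set"
  assumes V: "csubspace V" and triv: "\<And>w. (\<And>v. v \<in> V \<Longrightarrow> cinner v w = 0) \<Longrightarrow> w = 0"
  shows "closure V = UNIV"
proof -
  have "x \<in> closure V" for x
  proof -
    obtain v where v: "v \<in> closure V" "\<forall>w\<in>closure V. cinner w (x - v) = 0"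
      using orthogonal_projection_exists[OF csubspace_closure[OF V] closed_closure] by blast
    have "x - v = 0" using v closure_subset by (intro triv) blast
    with v show ?thesis by simp
  qed
  then show ?thesis by blast
qed

lemma riesz_representation:
  fixes f :: "'a::complex_hilbert \<Rightarrow> complex"
  assumes add: "\<And>x y. f (x + y) = f x + f y" and scale: "\<And>a x. f (a *\<^sub>C x) = a * f x"
    and bd: "\<And>x. cmod (f x) \<le> c * norm x"
  shows "\<exists>z. \<forall>x. f x = cinner x z"
proof -
  define V where "V = {x. f x = 0}"
  have bl: "bounded_linear f"
    by (rule bounded_linear_intro[where K=c])
       (simp_all add: add scaleR_scaleC scale scaleR_conv_of_real bd mult.commute)
  have f0: "f 0 = 0" using scale[of 0 0] by simp
  have V: "csubspace V" by (rule cvs.subspaceI) (auto simp: V_def add scale f0)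
  have cl: "closed V"
    unfolding V_def by (intro closed_Collect_eq continuous_on_const linear_continuous_on bl)
  show ?thesis
  proof (cases "V = UNIV")
    case True
    then show ?thesis by (intro exI[of _ 0]) (auto simp: V_def)
  next
    case False
    then obtain x where x: "x \<notin> V" by blast
    obtain v where v: "v \<in> V" "\<forall>w\<in>V. cinner w (x - v) = 0"
      using orthogonal_projection_exists[OF V cl] by blast
    define w where "w = x - v"
    have fw: "f w \<noteq> 0"
      using cvs.subspace_add[OF V, of "x - v" v] x v(1) by (auto simp: w_def V_def)
    then have w0: "w \<noteq> 0" using f0 by auto
    have "f y = cinner y ((cnj (f w) / (norm w)\<^sup>2) *\<^sub>C w)" for y
    proof -
      have "f (y + (- (f y / f w)) *\<^sub>C w) = 0" unfolding add scale using fw by simp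
      then have "y + (- (f y / f w)) *\<^sub>C w \<in> V" by (simp add: V_def)
      with v have "cinner (y + (- (f y / f w)) *\<^sub>C w) w = 0" by (simp add: w_def)
      then have "cinner y w = (f y / f w) * (norm w)\<^sup>2"
        by (simp add: cinner_diff_left cinner_scaleC_left cinner_self)
      then show ?thesis using fw w0 by (simp add: cinner_scaleC_right)
    qed
    then show ?thesis by blast
  qed
qed

section \<open>Banach space tools\<close>

text \<open>The open mapping theorem for the addition map. By Baire's theorem the vectors
  whose \<^term>\<open>V\<close>-part has a bounded norm are dense in some ball, hence, by taking differences,
  in a ball around the origin. Correcting the error of the approximation again and again then
  reaches every vector of that ball at the expense of a geometric series.\<close>

lemma complementary_imp_bounded_projection:
  fixes V W :: "'a::complex_banach set"
  assumes "complementary V W"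
  shows "\<exists>c\<ge>0. \<forall>v\<in>V. \<forall>w\<in>W. norm v \<le> c * norm (v + w)"
proof -
  have V: "csubspace V" "closed V" and W: "csubspace W" "closed W"
    and VW: "V \<inter> W = {0}" and all: "\<And>x. \<exists>v\<in>V. \<exists>w\<in>W. x = v + w"
    using assms unfolding complementary_def by blast+
  define A where "A n = {v + w | v w. v \<in> V \<and> w \<in> W \<and> norm v \<le> n}" for n :: real
  have "\<exists>n::nat. interior (closure (A n)) \<noteq> {}"
  proof (rule ccontr)
    assume "\<not> ?thesis"
    then have "euclidean interior_of \<Union>(range (\<lambda>n::nat. closure (A n))) = {}"
      by (intro Baire_category_alt disjI1 completely_metrizable_space_euclidean) auto
    moreover have "\<Union>(range (\<lambda>n::nat. closure (A n))) = UNIV"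
    proof -
      have "x \<in> \<Union>(range (\<lambda>n::nat. closure (A n)))" for x
      proof -
        obtain v w where vw: "v \<in> V" "w \<in> W" "x = v + w" using all by blast
        then have "x \<in> A (nat \<lceil>norm v\<rceil>)" using real_nat_ceiling_ge[of "norm v"] unfolding A_def mem_Collect_eq by blast
        then show ?thesis using closure_subset by fast
      qed
      then show ?thesis by blast
    qed
    ultimately show False by simp
  qed
  then obtain n :: nat and x0 e where e: "0 < e" and ball: "ball x0 e \<subseteq> closure (A n)"
    by (auto simp: mem_interior)
  define m where "m = 2 * real n"
  have approx0: "\<exists>v\<in>V. \<exists>w\<in>W. norm v \<le> m \<and> norm (y - v - w) < d"
    if y: "norm y < e" and d: "0 < d" for y d
  proof -
    have "x0 + y \<in> closure (A n)" "x0 \<in> closure (A n)"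
      using ball y e by (auto simp: dist_norm subset_iff)
    then obtain a b where a: "a \<in> A n" "dist a (x0 + y) < d / 2" and b: "b \<in> A n" "dist b x0 < d / 2"
      using d unfolding closure_approachable by (meson half_gt_zero)
    obtain v1 w1 where 1: "v1 \<in> V" "w1 \<in> W" "norm v1 \<le> n" "a = v1 + w1" using a by (auto simp: A_def)
    obtain v2 w2 where 2: "v2 \<in> V" "w2 \<in> W" "norm v2 \<le> n" "b = v2 + w2" using b by (auto simp: A_def)
    have "norm (v1 - v2) \<le> m" using norm_triangle_ineq4[of v1 v2] 1 2 by (simp add: m_def)
    moreover have "norm (y - (v1 - v2) - (w1 - w2)) < d"
    proof -
      have "y - (v1 - v2) - (w1 - w2) = (x0 + y - a) + (b - x0)" using 1 2 by simp
      also have "norm \<dots> < d / 2 + d / 2"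
        using a b by (intro norm_triangle_lt add_strict_mono) (auto simp: dist_norm norm_minus_commute)
      finally show ?thesis by simp
    qed
    moreover have "v1 - v2 \<in> V" "w1 - w2 \<in> W"
      using 1(1,2) 2(1,2) cvs.subspace_diff V(1) W(1) by auto
    ultimately show ?thesis by blast
  qed
  have "\<exists>v w. norm y < e / 2 ^ k \<longrightarrow> v \<in> V \<and> w \<in> W \<and> norm v \<le> m / 2 ^ k \<and> norm (y - v - w) < e / 2 ^ Suc k"
    for y and k :: nat
  proof (cases "norm y < e / 2 ^ k")
    case True
    have "norm ((2 ^ k) *\<^sub>R y) < e" using True by (simp add: field_simps)
    then obtain v w where vw: "v \<in> V" "w \<in> W" "norm v \<le> m" "norm ((2 ^ k) *\<^sub>R y - v - w) < e / 2"
      using approx0[of "(2 ^ k) *\<^sub>R y" "e / 2"] e by auto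
    define t :: real where "t = 1 / 2 ^ k"
    have "y - t *\<^sub>R v - t *\<^sub>R w = t *\<^sub>R ((2 ^ k) *\<^sub>R y - v - w)"
      by (simp add: t_def scaleR_right_diff_distrib)
    then have "norm (y - t *\<^sub>R v - t *\<^sub>R w) = norm ((2 ^ k) *\<^sub>R y - v - w) / 2 ^ k" by (simp add: t_def)
    also have "\<dots> < e / 2 ^ Suc k" using vw(4) by (simp add: field_simps)
    finally have "norm (y - t *\<^sub>R v - t *\<^sub>R w) < e / 2 ^ Suc k" .
    moreover have "norm (t *\<^sub>R v) \<le> m / 2 ^ k" using vw(3) by (simp add: t_def field_simps)
    moreover have "t *\<^sub>R v \<in> V" "t *\<^sub>R w \<in> W"
      using vw(1,2) csubspace_scaleR V(1) W(1) by auto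
    ultimately show ?thesis by blast
  qed blast
  then obtain f g where fg: "\<And>y k. norm y < e / 2 ^ k \<Longrightarrow> f y k \<in> V \<and> g y k \<in> W \<and>
      norm (f y k) \<le> m / 2 ^ k \<and> norm (y - f y k - g y k) < e / 2 ^ Suc k"
    by metis
  have key: "norm v \<le> 2 * m" if v: "v \<in> V" and w: "w \<in> W" and x: "norm (v + w) < e" for v w
  proof -
    define X where "X = rec_nat (v + w) (\<lambda>k y. y - f y k - g y k)"
    have X0: "X 0 = v + w" and XS: "\<And>k. X (Suc k) = X k - f (X k) k - g (X k) k"
      by (simp_all add: X_def)
    have Xn: "norm (X k) < e / 2 ^ k" for k
      by (induction k) (use x fg in \<open>auto simp: X0 XS\<close>)
    note fg' = fg[OF Xn]
    define a where "a k = f (X k) k" for k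
    define b where "b k = g (X k) k" for k
    have an: "norm (a k) \<le> m * (1 / 2) ^ k" for k using fg'[of k] by (simp add: a_def power_divide)
    have geo: "(\<lambda>k. m * (1 / 2) ^ k) sums (m * 2)" using sums_mult[OF geometric_sums[of "1/2::real"], of m] by simp
    have suma: "summable a" by (rule summable_comparison_test'[OF sums_summable[OF geo]]) (use an in auto)
    define v' where "v' = suminf a"
    have limv: "(\<lambda>n. sum a {..<n}) \<longlonglongrightarrow> v'" using suma unfolding v'_def by (rule summable_LIMSEQ)
    have v'V: "v' \<in> V"
      by (rule closed_sequentially[OF V(2) _ limv]) (auto simp: a_def intro!: cvs.subspace_sum[OF V(1)] fg'[THEN conjunct1])
    have v'n: "norm v' \<le> 2 * m"
      using norm_suminf_le[OF an sums_summable[OF geo]] sums_unique[OF geo] by (simp add: v'_def)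
    have part: "sum a {..<n} + sum b {..<n} = v + w - X n" for n
      by (induction n) (auto simp: X0 XS a_def b_def algebra_simps)
    have "(\<lambda>n. e / 2 ^ n) \<longlonglongrightarrow> 0"
      using tendsto_mult_right_zero[OF LIMSEQ_power_zero[of "1/2::real"], of e] by (simp add: power_divide)
    then have limX: "X \<longlonglongrightarrow> 0" by (rule Lim_null_comparison[rotated]) (intro always_eventually allI less_imp_le Xn)
    have "(\<lambda>n. v + w - X n - sum a {..<n}) \<longlonglongrightarrow> v + w - 0 - v'"
      by (rule tendsto_diff[OF tendsto_diff[OF tendsto_const limX] limv])
    moreover have "v + w - X n - sum a {..<n} = sum b {..<n}" for n using part[of n] by (simp add: algebra_simps)
    ultimately have limw: "(\<lambda>n. sum b {..<n}) \<longlonglongrightarrow> v + w - v'" by simp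
    have "b k \<in> W" for k unfolding b_def using fg'[of k] by blast
    then have w'W: "v + w - v' \<in> W"
      by (intro closed_sequentially[OF W(2) _ limw] allI cvs.subspace_sum[OF W(1)])
    have "v + w - v' - w = v - v'" by simp
    then have "v - v' \<in> W" using cvs.subspace_diff[OF W(1) w'W w] by simp
    then have "v - v' \<in> V \<inter> W" using cvs.subspace_diff[OF V(1) v v'V] by blast
    then have "v = v'" unfolding VW by simp
    with v'n show ?thesis by simp
  qed
  have "norm v \<le> (4 * m / e) * norm (v + w)" if v: "v \<in> V" and w: "w \<in> W" for v w
  proof (cases "v + w = 0")
    case True
    then have "v = - w" by (simp add: eq_neg_iff_add_eq_0)
    then have "v \<in> W" using w cvs.subspace_neg[OF W(1)] by simp
    then have "v \<in> V \<inter> W" using v by blast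
    then show ?thesis unfolding VW using e by (simp add: m_def)
  next
    case False
    define r where "r = e / (2 * norm (v + w))"
    have r: "0 < r" using False e by (simp add: r_def)
    have "norm (r *\<^sub>R v + r *\<^sub>R w) = e / 2"
      using False e by (simp add: r_def flip: scaleR_add_right)
    then have "norm (r *\<^sub>R v) \<le> 2 * m"
      using v w e V W by (intro key[of _ "r *\<^sub>R w"] csubspace_scaleR) auto
    then show ?thesis using r e False by (simp add: r_def field_simps)
  qed
  moreover have "0 \<le> 4 * m / e" using e by (simp add: m_def)
  ultimately show ?thesis by blast
qed

text \<open>The equation is a fixed point problem for a contraction, so that no operator series has to be
  summed.\<close>

lemma neumann_solve:
  fixes k :: "'a::banach \<Rightarrow> 'a"
  assumes diff: "\<And>x y. k (x - y) = k x - k y" and bd: "\<And>x. norm (k x) \<le> q * norm x"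
    and q: "0 \<le> q" "q < 1"
  shows "\<exists>y. y + k y = f"
proof -
  have "dist (f - k x) (f - k y) \<le> q * dist x y" for x y
  proof -
    have "dist (f - k x) (f - k y) = norm (k (y - x))" unfolding diff by (simp add: dist_norm)
    also have "\<dots> \<le> q * norm (y - x)" by (rule bd)
    finally show ?thesis by (simp add: dist_norm norm_minus_commute)
  qed
  then have "\<exists>!y. f - k y = y" by (intro banach_fix_type[OF q] allI)
  then obtain y where "f - k y = y" by blast
  then have "y + k y = f" by (simp add: algebra_simps)
  then show ?thesis by blast
qed

section \<open>Improper integrals\<close>

text \<open>A bounded \<^term>\<open>H\<close> that dominates the increments is increasing, hence convergent, and
  passes the Cauchy property on to \<^term>\<open>F\<close>.\<close>

lemma convergent_at_top_if_increment_le: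
  fixes F :: "real \<Rightarrow> 'a::banach"
  assumes inc: "\<And>s r. 0 \<le> s \<Longrightarrow> s \<le> r \<Longrightarrow> norm (F r - F s) \<le> H r - H s"
    and bd: "\<And>r. 0 \<le> r \<Longrightarrow> H r \<le> (b::real)"
  shows "\<exists>I. (F \<longlongrightarrow> I) at_top \<and> norm (I - F 0) \<le> b - H 0"
proof -
  define L where "L = (SUP r\<in>{0..}. H r)"
  have bdd: "bdd_above (H ` {0..})" using bd by (auto simp: bdd_above_def)
  have HL: "H r \<le> L" if "0 \<le> r" for r unfolding L_def using that by (intro cSUP_upper bdd) auto
  have mono: "H s \<le> H r" if "0 \<le> s" "s \<le> r" for s r using inc[OF that] norm_ge_zero[of "F r - F s"] by linarith
  have near: "\<exists>s\<ge>0. L - e < H s" if "0 < e" for e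
    using less_cSUP_iff[of "{0..}" H "L - e"] bdd that by (auto simp: L_def)
  have "Cauchy (\<lambda>n. F (real n))"
  proof (rule CauchyI)
    fix e :: real assume e: "0 < e"
    obtain s where s: "0 \<le> s" "L - e / 2 < H s" using near[of "e / 2"] e by auto
    obtain N :: nat where N: "s \<le> real N" using real_arch_simple by blast
    have *: "norm (F (real n) - F s) < e / 2" if "N \<le> n" for n
    proof -
      have "s \<le> real n" using N that by linarith
      then show ?thesis using inc[of s "real n"] HL[of "real n"] s by simp
    qed
    have "norm (F (real m) - F (real n)) < e" if "N \<le> m" "N \<le> n" for m n
      using norm_triangle_lt[of "F (real m) - F s" "F s - F (real n)" e] *[OF that(1)] *[OF that(2)]
      by (simp add: norm_minus_commute)
    then show "\<exists>N. \<forall>m\<ge>N. \<forall>n\<ge>N. norm (F (real m) - F (real n)) < e" by blast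
  qed
  then obtain I where I: "(\<lambda>n. F (real n)) \<longlonglongrightarrow> I" using Cauchy_convergent convergent_def by blast
  have dist: "norm (I - F s) \<le> L - H s" if "0 \<le> s" for s
  proof (rule tendsto_upperbound)
    show "(\<lambda>n. norm (F (real n) - F s)) \<longlonglongrightarrow> norm (I - F s)" by (intro tendsto_intros I)
    obtain N :: nat where N: "s \<le> real N" using real_arch_simple by blast
    have "norm (F (real n) - F s) \<le> L - H s" if "N \<le> n" for n
    proof -
      have "s \<le> real n" using N that by linarith
      then show ?thesis using inc[of s "real n"] HL[of "real n"] \<open>0 \<le> s\<close> by simp
    qed
    then show "\<forall>\<^sub>F n in sequentially. norm (F (real n) - F s) \<le> L - H s" by (auto simp: eventually_sequentially)
  qed simp
  have "(F \<longlongrightarrow> I) at_top"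
  proof (rule tendstoI)
    fix e :: real assume "0 < e"
    then obtain s where s: "0 \<le> s" "L - e < H s" using near by blast
    have "dist (F r) I < e" if "s \<le> r" for r
      using dist[of r] mono[OF s(1) that] s that by (simp add: dist_norm norm_minus_commute)
    then show "\<forall>\<^sub>F r in at_top. dist (F r) I < e" by (auto simp: eventually_at_top_linorder)
  qed
  moreover have "L \<le> b" unfolding L_def by (intro cSUP_least) (use bd in auto)
  ultimately show ?thesis using dist[of 0] by fastforce
qed

abbreviation (input) pv_integral :: "(real \<Rightarrow> 'a::banach) \<Rightarrow> 'a \<Rightarrow> bool" where
  "pv_integral f I \<equiv> ((\<lambda>r. integral {-r..r} f) \<longlongrightarrow> I) at_top"

text \<open>The majorant enters through its primitive \<^term>\<open>G\<close>, which bounds the integrals over the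
  tails; the bound on \<^term>\<open>G\<close> expresses the integrability of the majorant.\<close>

lemma integral_symmetric_convergent:
  fixes f :: "real \<Rightarrow> 'a::banach"
  assumes cont: "continuous_on UNIV f" and le: "\<And>t. norm (f t) \<le> g t"
    and G: "\<And>t. (G has_real_derivative g t) (at t)" and bd: "\<And>t. \<bar>G t\<bar> \<le> b"
  shows "\<exists>I. pv_integral f I \<and> norm I \<le> 2 * b"
proof -
  have int: "f integrable_on {s..r}" for s r
    by (intro integrable_continuous_real continuous_on_subset[OF cont]) auto
  have gint: "(g has_integral (G r - G s)) {s..r}" if "s \<le> r" for s r
    using that G by (intro fundamental_theorem_of_calculus)
      (auto intro: has_field_derivative_at_within simp flip: has_real_derivative_iff_has_vector_derivative)
  have nint: "norm (integral {s..r} f) \<le> G r - G s" if "s \<le> r" for s r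
    using integral_norm_bound_integral[OF int has_integral_integrable[OF gint[OF that]]] le
      integral_unique[OF gint[OF that]] by simp
  define F where "F r = integral {-r..r} f" for r
  define H where "H r = G r - G (- r)" for r
  have inc: "norm (F r - F s) \<le> H r - H s" if "0 \<le> s" "s \<le> r" for s r
  proof -
    have "F r = integral {-r..-s} f + integral {-s..r} f"
      unfolding F_def using that by (intro Henstock_Kurzweil_Integration.integral_combine[symmetric] int) auto
    also have "integral {-s..r} f = F s + integral {s..r} f"
      unfolding F_def using that by (intro Henstock_Kurzweil_Integration.integral_combine[symmetric] int) auto
    finally have "F r - F s = integral {-r..-s} f + integral {s..r} f" by simp
    also have "norm \<dots> \<le> (G (-s) - G (-r)) + (G r - G s)"
      using that by (intro norm_triangle_mono nint) auto
    finally show ?thesis by (simp add: H_def)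
  qed
  have "H r \<le> 2 * b" if "0 \<le> r" for r using bd[of r] bd[of "-r"] by (simp add: H_def)
  with inc obtain I where "(F \<longlongrightarrow> I) at_top" "norm (I - F 0) \<le> 2 * b - H 0"
    using convergent_at_top_if_increment_le[of F H "2 * b"] by blast
  then show ?thesis unfolding F_def H_def by auto
qed

lemma integral_symmetric_reflect:
  "integral {-r..r} (\<lambda>t. f (- t)) = integral {-r..r::real} f"
  using Henstock_Kurzweil_Integration.integral_reflect_real[of r "-r" f] by simp

lemma integral_symmetric_odd:
  fixes f :: "real \<Rightarrow> 'a::banach"
  assumes "\<And>t. f (- t) = - f t"
  shows "integral {-r..r} f = 0"
proof -
  have "integral {-r..r} f = - integral {-r..r} f"
    using integral_symmetric_reflect[of r f] by (simp add: assms)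
  then have "2 *\<^sub>R integral {-r..r} f = 0" unfolding scaleR_2 by (metis add.right_inverse)
  then show ?thesis by simp
qed

section \<open>Resolvents\<close>

abbreviation (input) iax :: "real \<Rightarrow> complex" where
  "iax t \<equiv> \<i> * complex_of_real t"

lemma linear_opD:
  assumes "linear_op S"
  shows "csubspace (Dom S)"
    and "x \<in> Dom S \<Longrightarrow> y \<in> Dom S \<Longrightarrow> App S (x + y) = App S x + App S y"
    and "x \<in> Dom S \<Longrightarrow> App S (a *\<^sub>C x) = a *\<^sub>C App S x"
    and "x \<in> Dom S \<Longrightarrow> y \<in> Dom S \<Longrightarrow> App S (x - y) = App S x - App S y"
    and "App S 0 = 0"
proof -
  show 1: "csubspace (Dom S)"
    and 2: "\<And>x y. x \<in> Dom S \<Longrightarrow> y \<in> Dom S \<Longrightarrow> App S (x + y) = App S x + App S y"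
    and 3: "\<And>a x. x \<in> Dom S \<Longrightarrow> App S (a *\<^sub>C x) = a *\<^sub>C App S x"
    using assms unfolding linear_op_def by blast+
  show "x \<in> Dom S \<Longrightarrow> y \<in> Dom S \<Longrightarrow> App S (x - y) = App S x - App S y"
    using 2[of "x - y" y] cvs.subspace_diff[OF 1] by simp
  show "App S 0 = 0" using 3[of 0 0] cvs.subspace_0[OF 1] by simp
qed

lemma App_shift_op: "App (shift_op S z) u = App S u - z *\<^sub>C u" and Dom_shift_op: "Dom (shift_op S z) = Dom S"
  by (simp_all add: shift_op_def)

lemma resolvent_setI:
  assumes G: "\<And>y. y \<in> V \<Longrightarrow> G y \<in> Dom S \<and> App S (G y) - z *\<^sub>C G y = y"
    and inv: "\<And>u. u \<in> Dom S \<Longrightarrow> App S u - z *\<^sub>C u \<in> V \<and> G (App S u - z *\<^sub>C u) = u"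
    and bd: "\<And>y. y \<in> V \<Longrightarrow> norm (G y) \<le> c * norm y"
  shows "z \<in> resolvent_set V S" and "\<And>y. y \<in> V \<Longrightarrow> resolvent S z y = G y"
proof -
  have bij: "bij_betw (App (shift_op S z)) (Dom S) V"
    by (rule bij_betw_byWitness[where f'=G]) (use G inv in \<open>auto simp: App_shift_op\<close>)
  show *: "resolvent S z y = G y" if "y \<in> V" for y
  proof -
    have "inv_into (Dom S) (App (shift_op S z)) y = G y"
      by (rule inv_into_f_eq[OF bij_betw_imp_inj_on[OF bij]]) (use G[OF that] in \<open>auto simp: App_shift_op\<close>)
    then show ?thesis by (simp add: inverse_op_def Dom_shift_op)
  qed
  show "z \<in> resolvent_set V S"
    unfolding resolvent_set_def using bij bd * by auto
qed

lemma resolvent_setD: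
  assumes "z \<in> resolvent_set V S"
  shows "y \<in> V \<Longrightarrow> resolvent S z y \<in> Dom S"
    and "y \<in> V \<Longrightarrow> App S (resolvent S z y) - z *\<^sub>C resolvent S z y = y"
    and "u \<in> Dom S \<Longrightarrow> App S u - z *\<^sub>C u \<in> V"
    and "u \<in> Dom S \<Longrightarrow> resolvent S z (App S u - z *\<^sub>C u) = u"
    and "\<exists>c>0. \<forall>y\<in>V. norm (resolvent S z y) \<le> c * norm y"
proof -
  have bij: "bij_betw (App (shift_op S z)) (Dom S) V"
    and "\<exists>c. \<forall>y\<in>V. norm (resolvent S z y) \<le> c * norm y"
    using assms by (auto simp: resolvent_set_def)
  then obtain c where c: "\<And>y. y \<in> V \<Longrightarrow> norm (resolvent S z y) \<le> c * norm y" by blast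
  have r: "resolvent S z = inv_into (Dom S) (App (shift_op S z))"
    by (simp add: inverse_op_def Dom_shift_op)
  show "y \<in> V \<Longrightarrow> resolvent S z y \<in> Dom S"
    using bij inv_into_into[of y "App (shift_op S z)" "Dom S"] unfolding r by (auto simp: bij_betw_def)
  show "y \<in> V \<Longrightarrow> App S (resolvent S z y) - z *\<^sub>C resolvent S z y = y"
    using bij_betw_inv_into_right[OF bij] unfolding r by (simp add: App_shift_op)
  show "u \<in> Dom S \<Longrightarrow> App S u - z *\<^sub>C u \<in> V"
    using bij by (auto simp: bij_betw_def App_shift_op)
  show "u \<in> Dom S \<Longrightarrow> resolvent S z (App S u - z *\<^sub>C u) = u"
    using bij_betw_inv_into_left[OF bij] unfolding r by (simp add: App_shift_op)
  have "norm (resolvent S z y) \<le> (\<bar>c\<bar> + 1) * norm y" if "y \<in> V" for y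
  proof -
    have "c * norm y \<le> (\<bar>c\<bar> + 1) * norm y" by (intro mult_right_mono) auto
    then show ?thesis using c[OF that] by linarith
  qed
  then show "\<exists>c>0. \<forall>y\<in>V. norm (resolvent S z y) \<le> c * norm y"
    by (intro exI[of _ "\<bar>c\<bar> + 1"]) auto
qed

lemma resolvent_set_UNIV_if_bounded_below:
  fixes S :: "('a::complex_normed_vector, 'a) op"
  assumes lin: "linear_op S"
    and surj: "\<And>f. \<exists>u\<in>Dom S. App S u - z *\<^sub>C u = f"
    and bd: "\<And>u. u \<in> Dom S \<Longrightarrow> norm u \<le> c * norm (App S u - z *\<^sub>C u)"
  shows "z \<in> resolvent_set UNIV S" and "norm (resolvent S z f) \<le> c * norm f"
proof -
  obtain G where G: "\<And>f. G f \<in> Dom S \<and> App S (G f) - z *\<^sub>C G f = f" using surj by metis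
  have inv: "G (App S u - z *\<^sub>C u) = u" if u: "u \<in> Dom S" for u
  proof -
    define v where "v = G (App S u - z *\<^sub>C u)"
    have v: "v \<in> Dom S" "App S v - z *\<^sub>C v = App S u - z *\<^sub>C u" using G by (auto simp: v_def)
    have "norm (v - u) \<le> c * norm (App S (v - u) - z *\<^sub>C (v - u))" by (intro bd cvs.subspace_diff linear_opD(1)[OF lin] v u)
    also have "App S (v - u) - z *\<^sub>C (v - u) = (App S v - z *\<^sub>C v) - (App S u - z *\<^sub>C u)"
      by (simp add: linear_opD(4)[OF lin] v(1) u cvs.scale_right_diff_distrib)
    also have "(App S v - z *\<^sub>C v) - (App S u - z *\<^sub>C u) = 0" unfolding v(2) by simp
    finally show ?thesis by (simp add: v_def)
  qed
  have n: "norm (G f) \<le> c * norm f" for f using bd[of "G f"] G by simp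
  show "z \<in> resolvent_set UNIV S" by (rule resolvent_setI(1)[of _ G S z c]) (use G inv n in auto)
  have "resolvent S z f = G f" by (rule resolvent_setI(2)[of UNIV G S z c]) (use G inv n in auto)
  with n show "norm (resolvent S z f) \<le> c * norm f" by simp
qed

text \<open>An operator together with its resolvent \<^term>\<open>R t\<close> at the points \<open>\<i> t\<close>. The decay
  \<open>O (1 / \<bar>t\<bar>)\<close> is what survives of sectoriality on the axis; it is shared by \<open>A\<close>, by \<open>- A\<^sup>*\<close> and
  by the Hamiltonian, to which the following lemmas apply alike.\<close>

locale axis_resolvent =
  fixes S :: "('a::complex_banach, 'a) op" and R :: "real \<Rightarrow> 'a \<Rightarrow> 'a" and M :: real
  assumes linear_S: "linear_op S"
    and M_pos: "0 < M"
    and R_Dom: "R t x \<in> Dom S"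
    and S_R: "App S (R t x) - iax t *\<^sub>C R t x = x"
    and R_S: "u \<in> Dom S \<Longrightarrow> R t (App S u - iax t *\<^sub>C u) = u"
    and norm_R: "norm (R t x) \<le> M / (1 + \<bar>t\<bar>) * norm x"
begin

lemmas subspace_Dom = linear_opD(1)[OF linear_S]

lemma R_eqI: "u \<in> Dom S \<Longrightarrow> App S u - iax t *\<^sub>C u = x \<Longrightarrow> R t x = u"
  using R_S by blast

lemma S_R': "App S (R t x) = x + iax t *\<^sub>C R t x"
  using S_R[of t x] by (simp add: algebra_simps)

lemma R_add: "R t (x + y) = R t x + R t y"
  by (rule R_eqI)
     (auto simp: linear_opD(2)[OF linear_S] R_Dom S_R' scaleC_add_right intro: cvs.subspace_add subspace_Dom)

lemma R_scaleC: "R t (c *\<^sub>C x) = c *\<^sub>C R t x"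
  by (rule R_eqI)
     (auto simp: linear_opD(3)[OF linear_S] R_Dom S_R' scaleC_add_right scaleC_scaleC mult_ac
       intro: cvs.subspace_scale subspace_Dom)

lemma norm_R_le: "norm (R t x) \<le> M * norm x"
proof -
  have "M / (1 + \<bar>t\<bar>) \<le> M / 1" using M_pos by (intro divide_left_mono) auto
  then show ?thesis using norm_R[of t x] mult_right_mono[of _ M "norm x"] by fastforce
qed

lemma bounded_linear_R: "bounded_linear (R t)"
  by (rule bounded_linear_intro[where K=M])
     (simp_all add: R_add scaleR_scaleC R_scaleC norm_R_le mult.commute)

lemma R_diff: "R t (x - y) = R t x - R t y"
  by (rule linear_diff[OF bounded_linear.linear[OF bounded_linear_R]])

lemma resolvent_identity:
  "R t x - R s x = iax (t - s) *\<^sub>C R t (R s x)"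
proof -
  have "R t x = R s x + iax (t - s) *\<^sub>C R t (R s x)" (is "_ = ?u")
  proof (rule R_eqI)
    show "?u \<in> Dom S" by (intro cvs.subspace_add cvs.subspace_scale subspace_Dom R_Dom)
    have "App S ?u = App S (R s x) + iax (t - s) *\<^sub>C App S (R t (R s x))"
      by (simp add: linear_opD(2,3)[OF linear_S] R_Dom cvs.subspace_scale[OF subspace_Dom])
    then show "App S ?u - iax t *\<^sub>C ?u = x"
      by (simp add: S_R' scaleC_add_right scaleC_scaleC cvs.scale_left_diff_distrib algebra_simps)
  qed
  then show ?thesis by simp
qed

lemma R_commute: "R t (R s x) = R s (R t x)"
proof (cases "t = s")
  case False
  have "iax (t - s) *\<^sub>C R t (R s x) = iax (t - s) *\<^sub>C R s (R t x)"
    using resolvent_identity[of t x s] resolvent_identity[of s x t]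
    by (simp add: cvs.scale_left_diff_distrib right_diff_distrib) (metis minus_diff_eq)
  with False show ?thesis by (simp add: cvs.scale_left_imp_eq)
qed simp

lemma R_lipschitz: "norm (R t x - R s x) \<le> \<bar>t - s\<bar> * (M * (M * norm x))"
proof -
  have "norm (R t x - R s x) = \<bar>t - s\<bar> * norm (R t (R s x))"
    unfolding resolvent_identity norm_scaleC norm_mult by (simp flip: of_real_diff)
  also have "norm (R t (R s x)) \<le> M * (M * norm x)"
    using norm_R_le[of t "R s x"] mult_left_mono[OF norm_R_le[of s x], of M] M_pos by linarith
  finally show ?thesis by (simp add: mult_left_mono)
qed

lemma continuous_R: "continuous_on A (\<lambda>t. R t x)"
proof -
  have "(M * (M * norm x))-lipschitz_on A (\<lambda>t. R t x)"
    using R_lipschitz M_pos by (intro lipschitz_onI) (auto simp: dist_norm mult.commute)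
  then show ?thesis by (rule lipschitz_on_continuous_on)
qed

lemma integrable_R: "(\<lambda>t. R t x) integrable_on {a..b}"
  by (intro integrable_continuous_real continuous_R)

lemma resolvent_R:
  shows "iax t \<in> resolvent_set UNIV S"
    and "resolvent S (iax t) x = R t x"
proof -
  show "iax t \<in> resolvent_set UNIV S"
    by (rule resolvent_setI(1)[of _ "R t" _ _ M]) (auto simp: R_Dom S_R R_S norm_R_le)
  show "resolvent S (iax t) x = R t x"
    by (rule resolvent_setI(2)[of UNIV "R t" _ _ M]) (auto simp: R_Dom S_R R_S norm_R_le)
qed

text \<open>Horizontally a point \<^term>\<open>z\<close> of the strip is at distance \<open>\<bar>Re z\<bar>\<close> from the axis, where the resolvent
  is bounded by \<^term>\<open>M\<close>, so the Neumann series reaches it.\<close>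

lemma resolvent_strip:
  assumes z: "\<bar>Re z\<bar> * M < 1"
  shows "z \<in> resolvent_set UNIV S"
    and "norm (resolvent S z f) \<le> M / (1 - \<bar>Re z\<bar> * M) * norm f"
proof -
  define t where "t = Im z"
  have zt: "z = complex_of_real (Re z) + iax t" by (simp add: t_def complex_eq_iff)
  have shift: "App S u - z *\<^sub>C u = (App S u - iax t *\<^sub>C u) - Re z *\<^sub>R u" for u
    by (subst zt) (simp add: scaleC_add_left scaleR_scaleC)
  have surj: "\<exists>u\<in>Dom S. App S u - z *\<^sub>C u = f" for f
  proof -
    have "\<exists>y. y + - Re z *\<^sub>R R t y = f"
    proof (rule neumann_solve[of _ "\<bar>Re z\<bar> * M"])
      show "- Re z *\<^sub>R R t (x - y) = - Re z *\<^sub>R R t x - - Re z *\<^sub>R R t y" for x y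
        unfolding R_diff by (rule scaleR_right_diff_distrib)
      show "norm (- Re z *\<^sub>R R t x) \<le> \<bar>Re z\<bar> * M * norm x" for x
        using norm_R_le[of t x] by (simp add: mult_left_mono mult.assoc)
    qed (use z M_pos in auto)
    then obtain y where y: "y + - Re z *\<^sub>R R t y = f" ..
    show ?thesis
      by (rule bexI[of _ "R t y"]) (use y in \<open>auto simp: shift S_R R_Dom\<close>)
  qed
  have bd: "norm u \<le> M / (1 - \<bar>Re z\<bar> * M) * norm (App S u - z *\<^sub>C u)" if u: "u \<in> Dom S" for u
  proof -
    define f where "f = App S u - z *\<^sub>C u"
    have "u = R t (f + Re z *\<^sub>R u)" using R_S[OF u, of t] by (simp add: f_def shift)
    then have "norm u \<le> M * norm (f + Re z *\<^sub>R u)" using norm_R_le by metis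
    also have "\<dots> \<le> M * (norm f + \<bar>Re z\<bar> * norm u)"
      using M_pos norm_triangle_ineq[of f "Re z *\<^sub>R u"] by (intro mult_left_mono) auto
    finally have "(1 - \<bar>Re z\<bar> * M) * norm u \<le> M * norm f" by (simp add: algebra_simps)
    then show ?thesis using z by (simp add: f_def[symmetric] field_simps)
  qed
  show "z \<in> resolvent_set UNIV S" by (rule resolvent_set_UNIV_if_bounded_below(1)[OF linear_S surj bd])
  show "norm (resolvent S z f) \<le> M / (1 - \<bar>Re z\<bar> * M) * norm f"
    by (rule resolvent_set_UNIV_if_bounded_below(2)[OF linear_S surj bd])
qed

end

section \<open>Sectorial operators\<close>

lemma resolvent_identity_on:
  assumes S: "linear_op S" "Dom S \<subseteq> V" and V: "csubspace V"
    and z: "z \<in> resolvent_set V S" and w: "w \<in> resolvent_set V S" and y: "y \<in> V"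
  shows "resolvent S z y - resolvent S w y = (z - w) *\<^sub>C resolvent S z (resolvent S w y)"
proof -
  define u where "u = resolvent S w y"
  have u: "u \<in> Dom S" "App S u - w *\<^sub>C u = y"
    using resolvent_setD[OF w] y by (auto simp: u_def)
  define v where "v = resolvent S z u"
  have uV: "u \<in> V" using u S by blast
  have v: "v \<in> Dom S" "App S v - z *\<^sub>C v = u"
    using resolvent_setD[OF z] uV by (auto simp: v_def)
  have cv: "(z - w) *\<^sub>C v \<in> Dom S" by (intro cvs.subspace_scale linear_opD(1)[OF S(1)] v)
  have uv: "u + (z - w) *\<^sub>C v \<in> Dom S" by (intro cvs.subspace_add linear_opD(1)[OF S(1)] u cv)
  have Su: "App S u = y + w *\<^sub>C u" and Sv: "App S v = u + z *\<^sub>C v"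
    using u(2) v(2) by (metis diff_add_cancel)+
  have "App S (u + (z - w) *\<^sub>C v) = (y + w *\<^sub>C u) + (z - w) *\<^sub>C (u + z *\<^sub>C v)"
    unfolding linear_opD(2)[OF S(1) u(1) cv] linear_opD(3)[OF S(1) v(1)] Su Sv ..
  then have "App S (u + (z - w) *\<^sub>C v) - z *\<^sub>C (u + (z - w) *\<^sub>C v) = y"
    by (simp add: scaleC_add_right scaleC_scaleC cvs.scale_left_diff_distrib algebra_simps)
  then have "resolvent S z y = u + (z - w) *\<^sub>C v"
    using resolvent_setD(4)[OF z uv] by simp
  then show ?thesis by (simp add: u_def v_def)
qed

text \<open>Sectoriality gives the bound \<open>O (1 / \<bar>z\<bar>)\<close>, which is useless at \<open>0\<close>. There the point \<open>0\<close> of the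
  resolvent set helps: by the resolvent identity the resolvent at most doubles within the radius
  \<open>1 / 2 b\<close>, where \<open>b\<close> bounds the resolvent at \<open>0\<close>.\<close>

lemma sectorial_half_plane:
  fixes S :: "('a::complex_normed_vector, 'a) op"
  assumes sec: "sectorial V \<theta> S" and \<theta>: "\<theta> < pi / 2" and V: "csubspace V"
    and 0: "0 \<in> resolvent_set V S"
  shows "\<exists>M>0. \<forall>z. Re z \<le> 0 \<longrightarrow> z \<in> resolvent_set V S \<and>
      (\<forall>y\<in>V. norm (resolvent S z y) \<le> M / (1 + cmod z) * norm y)"
proof -
  have S: "linear_op S" "Dom S \<subseteq> V" and spec: "spectrum V S \<subseteq> {z. \<bar>Arg z\<bar> \<le> \<theta>}"
    using sec by (auto simp: sectorial_def)
  have "\<exists>M>0. \<forall>z. \<bar>Arg z\<bar> \<ge> pi / 2 \<and> cmod z > 0 \<longrightarrow> (\<forall>y\<in>V. norm (resolvent S z y) \<le> M / cmod z * norm y)"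
  proof -
    have "\<theta> < pi / 2 \<and> pi / 2 \<le> pi" using \<theta> by simp
    then show ?thesis using sec unfolding sectorial_def by blast
  qed
  then obtain M0 where M0: "0 < M0"
    and far: "\<And>z y. \<bar>Arg z\<bar> \<ge> pi / 2 \<Longrightarrow> z \<noteq> 0 \<Longrightarrow> y \<in> V \<Longrightarrow> norm (resolvent S z y) \<le> M0 / cmod z * norm y"
    by auto
  obtain b where b: "0 < b" and b0: "\<And>y. y \<in> V \<Longrightarrow> norm (resolvent S 0 y) \<le> b * norm y"
    using resolvent_setD(5)[OF 0] by blast
  have arg: "\<bar>Arg z\<bar> \<ge> pi / 2" if "Re z \<le> 0" "z \<noteq> 0" for z
    using Arg_Re_pos[of z] that by auto
  have res: "z \<in> resolvent_set V S" if "Re z \<le> 0" for z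
  proof (cases "z = 0")
    case False
    have "\<not> \<bar>Arg z\<bar> \<le> \<theta>" using arg[OF that False] \<theta> by simp
    then show ?thesis using spec by (auto simp: spectrum_def)
  qed (use 0 in simp)
  define M where "M = (2 * b + 1) + M0 * (1 + 2 * b)"
  have M: "0 < M" using b M0 by (simp add: M_def add_pos_pos)
  have "norm (resolvent S z y) \<le> M / (1 + cmod z) * norm y" if z: "Re z \<le> 0" and y: "y \<in> V" for z y
  proof (cases "cmod z \<le> 1 / (2 * b)")
    case True
    let ?u = "resolvent S z y"
    have uV: "?u \<in> V" using resolvent_setD(1)[OF res[OF z] y] S by blast
    have "resolvent S 0 y - ?u = (0 - z) *\<^sub>C resolvent S 0 ?u"
      by (rule resolvent_identity_on[OF S V 0 res[OF z] y])
    then have "?u = resolvent S 0 y + z *\<^sub>C resolvent S 0 ?u" by (simp add: algebra_simps)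
    then have "norm ?u \<le> norm (resolvent S 0 y) + cmod z * norm (resolvent S 0 ?u)"
      by (metis norm_triangle_ineq norm_scaleC)
    also have "\<dots> \<le> b * norm y + cmod z * (b * norm ?u)"
      by (intro add_mono mult_left_mono b0 y uV) auto
    also have "cmod z * (b * norm ?u) \<le> norm ?u / 2"
      using mult_right_mono[OF True, of "b * norm ?u"] b by simp
    finally have "norm ?u \<le> 2 * b * norm y" by simp
    also have "2 * b \<le> M / (1 + cmod z)"
    proof -
      have "2 * b * (1 + cmod z) \<le> 2 * b + 1" using True b by (simp add: field_simps)
      also have "\<dots> \<le> M" using M0 b by (simp add: M_def)
      finally show ?thesis by (simp add: pos_le_divide_eq add_pos_nonneg)
    qed
    finally show ?thesis by (simp add: mult_right_mono)
  next
    case False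
    moreover have "0 < 1 / (2 * b)" using b by simp
    ultimately have z0: "0 < cmod z" by linarith
    have "norm (resolvent S z y) \<le> M0 / cmod z * norm y"
      using z0 by (intro far arg z y) auto
    also have "M0 / cmod z \<le> M / (1 + cmod z)"
    proof -
      have "1 + cmod z \<le> (1 + 2 * b) * cmod z" using False b by (simp add: field_simps)
      then have "M0 * (1 + cmod z) \<le> M0 * (1 + 2 * b) * cmod z" using M0 by (simp add: mult.assoc)
      also have "\<dots> \<le> M * cmod z" using b by (intro mult_right_mono) (auto simp: M_def)
      finally show ?thesis using z0 by (simp add: field_simps add_pos_pos)
    qed
    finally show ?thesis by (simp add: mult_right_mono)
  qed
  with M res show ?thesis by blast
qed

text \<open>The segment of the imaginary axis is deformed into the two other sides of the triangle with
  vertices \<open>\<plusminus>\<i> r\<close> and \<open>- r\<close>. There the resolvent is of size \<open>1 / r\<close>, which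
  compensates their length.\<close>

lemma sectorial_integral_bound:
  fixes S :: "('a::complex_hilbert, 'a) op"
  assumes S: "linear_op S" "Dom S \<subseteq> V" and V: "csubspace V" and M: "0 < M"
    and half: "\<And>z. Re z \<le> 0 \<Longrightarrow> z \<in> resolvent_set V S"
    and bound: "\<And>z y. Re z \<le> 0 \<Longrightarrow> y \<in> V \<Longrightarrow> norm (resolvent S z y) \<le> M / (1 + cmod z) * norm y"
    and y: "y \<in> V" and r: "0 < r"
  shows "continuous_on A (\<lambda>t. resolvent S (iax t) y)"
    and "norm (integral {-r..r} (\<lambda>t. resolvent S (iax t) y)) \<le> 8 * M * norm y"
proof -
  have bound': "norm (resolvent S z y) \<le> M * norm y" if "Re z \<le> 0" "y \<in> V" for z y
  proof -
    have "M / (1 + cmod z) \<le> M / 1" using M by (intro divide_left_mono) (auto intro: add_pos_nonneg)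
    then show ?thesis using bound[OF that] mult_right_mono[of _ M "norm y"] by fastforce
  qed
  have inV: "resolvent S z x \<in> V" if "Re z \<le> 0" "x \<in> V" for z x
    using resolvent_setD(1)[OF half[OF that(1)] that(2)] S by blast
  have lip: "(M * (M * norm x))-lipschitz_on {z. Re z \<le> 0} (\<lambda>z. resolvent S z x)" if x: "x \<in> V" for x
  proof (rule lipschitz_onI)
    fix z w assume z: "z \<in> {z. Re z \<le> 0}" and w: "w \<in> {z. Re z \<le> 0}"
    have "norm (resolvent S z x - resolvent S w x) = cmod (z - w) * norm (resolvent S z (resolvent S w x))"
      using resolvent_identity_on[OF S V half half x] z w by (simp add: norm_scaleC)
    moreover have "norm (resolvent S z (resolvent S w x)) \<le> M * (M * norm x)"
      using z w bound'[of z "resolvent S w x"] bound'[of w x] inV x M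
      by (intro order_trans[OF bound'] mult_left_mono) auto
    ultimately have "norm (resolvent S z x - resolvent S w x) \<le> cmod (z - w) * (M * (M * norm x))"
      by (simp add: mult_left_mono)
    then show "dist (resolvent S z x) (resolvent S w x) \<le> M * (M * norm x) * dist z w"
      by (simp add: dist_norm mult.commute)
  qed (use M in simp)
  note cont = lipschitz_on_continuous_on[OF lip]
  have cont_axis: "continuous_on A (\<lambda>t. resolvent S (iax t) y)" for A
    by (rule continuous_on_compose2[OF cont[OF y], of A "\<lambda>t. iax t"])
       (auto intro!: continuous_intros)
  then show "continuous_on A (\<lambda>t. resolvent S (iax t) y)" .
  define J where "J = integral {-r..r} (\<lambda>t. resolvent S (iax t) y)"
  have "cmod (cinner J w) \<le> 8 * M * norm y * norm w" for w
  proof -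
    define f where "f z = cinner (resolvent S z y) w" for z
    define a b c where "a = Complex 0 (-r)" and "b = Complex 0 r" and "c = Complex (-r) 0"
    have hull: "convex hull {a, b, c} \<subseteq> {z. Re z \<le> 0}"
      by (rule hull_minimal) (use r in \<open>auto simp: a_def b_def c_def convex_halfspace_Re_le\<close>)
    have "f holomorphic_on {z. Re z \<le> 0}"
      unfolding holomorphic_on_def field_differentiable_def
    proof (intro ballI exI)
      fix z0 assume z0: "z0 \<in> {z. Re z \<le> 0}"
      define x where "x = resolvent S z0 y"
      have x: "x \<in> V" using z0 y by (auto simp: x_def intro: inV)
      have "((\<lambda>z. cinner (resolvent S z x) w) \<longlongrightarrow> cinner (resolvent S z0 x) w) (at z0 within {z. Re z \<le> 0})"
        using cont[OF x] z0 by (intro tendsto_cinner tendsto_const) (auto simp: continuous_on_def)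
      moreover have "\<forall>\<^sub>F z in at z0 within {z. Re z \<le> 0}. cinner (resolvent S z x) w = (f z - f z0) / (z - z0)"
      proof -
        have "cinner (resolvent S z x) w = (f z - f z0) / (z - z0)" if "Re z \<le> 0" "z \<noteq> z0" for z
        proof -
          have "f z - f z0 = (z - z0) * cinner (resolvent S z x) w"
            using resolvent_identity_on[OF S V half half y, of z z0] that z0
            by (simp add: f_def x_def flip: cinner_diff_left cinner_scaleC_left)
          with that show ?thesis by simp
        qed
        then show ?thesis unfolding eventually_at by (intro exI[of _ 1]) auto
      qed
      ultimately show "(f has_field_derivative cinner (resolvent S z0 x) w) (at z0 within {z. Re z \<le> 0})"
        unfolding has_field_derivative_iff by (rule Lim_transform_eventually)
    qed
    then have hol: "f holomorphic_on (convex hull {a, b, c})" by (rule holomorphic_on_subset) (rule hull)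
    have fbd: "cmod (f z) \<le> 2 * M / r * norm y * norm w" if z: "Re z \<le> 0" "r \<le> 2 * cmod z" for z
    proof -
      have "cmod (f z) \<le> norm (resolvent S z y) * norm w" unfolding f_def by (rule cinner_cauchy_schwarz)
      also have "\<dots> \<le> (M / (1 + cmod z) * norm y) * norm w" by (intro mult_right_mono bound y z) auto
      also have "M / (1 + cmod z) \<le> M / (r / 2)" using r z M by (intro divide_left_mono) (auto intro: add_pos_nonneg)
      finally show ?thesis using r by (simp add: mult_right_mono mult.commute[of M])
    qed
    have side: "cmod (contour_integral (linepath u v) f) \<le> 4 * M * norm y * norm w"
      if uv: "f contour_integrable_on linepath u v" "dist u v \<le> 2 * r" "closed_segment u v \<subseteq> {z. Re z \<le> 0 \<and> r \<le> 2 * cmod z}"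
      for u v
    proof -
      have "cmod (contour_integral (linepath u v) f) \<le> 2 * M / r * norm y * norm w * cmod (v - u)"
        using uv(3) r M by (intro contour_integral_bound_linepath uv(1) fbd) auto
      also have "\<dots> \<le> 2 * M / r * norm y * norm w * (2 * r)"
        using uv(2) r M by (intro mult_left_mono) (auto simp: dist_norm norm_minus_commute)
      also have "\<dots> = 4 * M * norm y * norm w" using r by simp
      finally show ?thesis .
    qed
    have chain: "contour_integral (linepath a b) f + contour_integral (linepath b c) f + contour_integral (linepath c a) f = 0"
      by (rule has_chain_integral_chain_integral3[OF Cauchy_theorem_triangle[OF hol]])
    have seg: "f contour_integrable_on linepath u v" if "{u, v} \<subseteq> {a, b, c}" for u v
    proof (rule contour_integrable_continuous_linepath)
      have "closed_segment u v \<subseteq> convex hull {a, b, c}" 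
        unfolding segment_convex_hull by (rule hull_mono) (use that in auto)
      then show "continuous_on (closed_segment u v) f"
        using holomorphic_on_imp_continuous_on[OF hol] continuous_on_subset by blast
    qed
    have norm1: "r \<le> 2 * cmod z" if "\<bar>Re z\<bar> + \<bar>Im z\<bar> = r" for z
      using abs_Re_le_cmod[of z] abs_Im_le_cmod[of z] that by linarith
    have seg_bc: "z \<in> {z. Re z \<le> 0 \<and> r \<le> 2 * cmod z}" if "z \<in> closed_segment b c \<or> z \<in> closed_segment c a" for z
    proof -
      have "\<exists>u. \<bar>Re z\<bar> = u * r \<and> \<bar>Im z\<bar> = (1 - u) * r \<and> Re z \<le> 0"
        using that
      proof
        assume "z \<in> closed_segment b c"
        then obtain u where "0 \<le> u" "u \<le> 1" "z = (1 - u) *\<^sub>R b + u *\<^sub>R c" by (auto simp: in_segment)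
        then show ?thesis using r by (intro exI[of _ u]) (auto simp: b_def c_def abs_mult)
      next
        assume "z \<in> closed_segment c a"
        then obtain u where "0 \<le> u" "u \<le> 1" "z = (1 - u) *\<^sub>R c + u *\<^sub>R a" by (auto simp: in_segment)
        then show ?thesis using r by (intro exI[of _ "1 - u"]) (auto simp: a_def c_def abs_mult mult_nonneg_nonneg)
      qed
      then have "\<bar>Re z\<bar> + \<bar>Im z\<bar> = r" "Re z \<le> 0" by (auto simp: algebra_simps)
      then show ?thesis using norm1 by blast
    qed
    have dists: "dist b c \<le> 2 * r" "dist c a \<le> 2 * r"
      using r cmod_le[of "b - c"] cmod_le[of "c - a"] by (auto simp: dist_norm a_def b_def c_def)
    have "cmod (contour_integral (linepath a b) f) \<le> 8 * M * norm y * norm w"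
    proof -
      have "contour_integral (linepath a b) f = - (contour_integral (linepath b c) f + contour_integral (linepath c a) f)"
        using chain by (simp add: add_eq_0_iff2 add.assoc)
      then have "cmod (contour_integral (linepath a b) f) \<le> cmod (contour_integral (linepath b c) f) + cmod (contour_integral (linepath c a) f)"
        using norm_triangle_ineq by (metis norm_minus_cancel)
      also have "\<dots> \<le> 4 * M * norm y * norm w + 4 * M * norm y * norm w"
        using seg_bc dists by (intro add_mono side seg) auto
      finally show ?thesis by (simp add: mult_ac)
    qed
    moreover have "contour_integral (linepath a b) f = \<i> * integral {-r..r} (\<lambda>t. f (Complex 0 t))"
      by (rule contour_integral_linepath_same_Re) (use r in \<open>auto simp: a_def b_def\<close>)
    moreover have "integral {-r..r} (\<lambda>t. f (Complex 0 t)) = cinner J w"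
    proof -
      have "cinner J w = integral {-r..r} ((\<lambda>x. cinner x w) \<circ> (\<lambda>t. resolvent S (iax t) y))"
        unfolding J_def
        by (intro integral_linear[symmetric] bounded_linear_cinner_left integrable_continuous_real cont_axis)
      then show ?thesis by (simp add: f_def Complex_eq o_def)
    qed
    ultimately show ?thesis by (simp add: norm_mult)
  qed
  then show "norm (integral {-r..r} (\<lambda>t. resolvent S (iax t) y)) \<le> 8 * M * norm y"
    using M unfolding J_def by (intro norm_le_if_cinner_le) auto
qed

section \<open>Sectorially dichotomous operators\<close>

lemma complementary_commute:
  assumes "complementary V W"
  shows "complementary W V"
proof -
  have "x \<in> {w + v |w v. w \<in> W \<and> v \<in> V}" for x
  proof -
    have "x \<in> {v + w |v w. v \<in> V \<and> w \<in> W}" using assms unfolding complementary_def by simp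
    then obtain v w where "v \<in> V" "w \<in> W" "x = v + w" by blast
    then have "x = w + v \<and> w \<in> W \<and> v \<in> V" by (simp add: add.commute)
    then show ?thesis unfolding mem_Collect_eq by (intro exI)
  qed
  then have "{w + v |w v. w \<in> W \<and> v \<in> V} = UNIV" by (intro UNIV_eq_I[symmetric])
  then show ?thesis using assms unfolding complementary_def by (simp add: Int_commute)
qed

lemma resolvent_set_uminus_op:
  assumes S: "linear_op S" and V: "csubspace V" and z: "z \<in> resolvent_set V S"
  shows "- z \<in> resolvent_set V (uminus_op S)"
proof -
  have neg: "- u \<in> Dom S" "App S (- u) = - App S u" if "u \<in> Dom S" for u
    using cvs.subspace_neg[OF linear_opD(1)[OF S] that] linear_opD(3)[OF S that, of "-1"] by auto
  obtain c where c: "\<forall>y\<in>V. norm (resolvent S z y) \<le> c * norm y" using resolvent_setD(5)[OF z] by blast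
  show ?thesis
  proof (rule resolvent_setI(1)[where G="\<lambda>y. - resolvent S z y" and c=c])
    fix y assume y: "y \<in> V"
    show "- resolvent S z y \<in> Dom (uminus_op S) \<and>
         App (uminus_op S) (- resolvent S z y) - (- z) *\<^sub>C (- resolvent S z y) = y"
      using resolvent_setD(1,2)[OF z y] neg by (simp add: uminus_op_def)
    show "norm (- resolvent S z y) \<le> c * norm y" using c y by simp
  next
    fix u assume "u \<in> Dom (uminus_op S)"
    then have u: "u \<in> Dom S" by (simp add: uminus_op_def)
    have "App (uminus_op S) u - (- z) *\<^sub>C u = App S (- u) - z *\<^sub>C (- u)"
      using neg[OF u] by (simp add: uminus_op_def)
    then show "App (uminus_op S) u - (- z) *\<^sub>C u \<in> V \<and>
        - resolvent S z (App (uminus_op S) u - (- z) *\<^sub>C u) = u"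
      using resolvent_setD(3,4)[OF z neg(1)[OF u]] by simp
  qed
qed

text \<open>On each spectral subspace the sectorial bounds apply, on the second one to the negative of
  the operator and on the reflected axis; the boundedness of the projections transfers them to the
  whole space.\<close>

lemma sectorially_dichotomous_axis_resolvent:
  fixes A :: "('h::complex_hilbert, 'h) op"
  assumes "sectorially_dichotomous A"
  shows "\<exists>M K. axis_resolvent A (\<lambda>t. resolvent A (iax t)) M \<and>
    (\<forall>r>0. \<forall>x. norm (integral {-r..r} (\<lambda>t. resolvent A (iax t) x)) \<le> K * norm x)"
proof -
  obtain Vp Vm \<theta> where dich: "dichotomy A Vp Vm" and \<theta>: "0 \<le> \<theta>" "\<theta> < pi / 2"
    and secp: "sectorial Vp \<theta> (restrict_op A Vp)"
    and secm: "sectorial Vm \<theta> (uminus_op (restrict_op A Vm))"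
    using assms unfolding sectorially_dichotomous_def by blast
  have A: "linear_op A" and comp: "complementary Vp Vm"
    and spec: "spectrum Vp (restrict_op A Vp) \<subseteq> {z. Re z > 0}" "spectrum Vm (restrict_op A Vm) \<subseteq> {z. Re z < 0}"
    using dich by (auto simp: dichotomy_def)
  have axis: "iax t \<in> resolvent_set UNIV A" for t
    using dich by (auto simp: dichotomy_def subset_iff)
  have V: "csubspace Vp" "csubspace Vm" and all: "\<And>x. \<exists>v w. v \<in> Vp \<and> w \<in> Vm \<and> x = v + w"
    using comp unfolding complementary_def by blast+
  obtain cp where cp: "0 \<le> cp" "\<And>v w. v \<in> Vp \<Longrightarrow> w \<in> Vm \<Longrightarrow> norm v \<le> cp * norm (v + w)"
    using complementary_imp_bounded_projection[OF comp] by blast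
  obtain cm where cm0: "0 \<le> cm" "\<And>v w. v \<in> Vp \<Longrightarrow> w \<in> Vm \<Longrightarrow> norm w \<le> cm * norm (w + v)"
    using complementary_imp_bounded_projection[OF complementary_commute[OF comp]] by blast
  have cm: "0 \<le> cm" "\<And>v w. v \<in> Vp \<Longrightarrow> w \<in> Vm \<Longrightarrow> norm w \<le> cm * norm (v + w)"
    using cm0 by (simp_all add: add.commute)
  define Sp where "Sp = restrict_op A Vp"
  define Sm where "Sm = uminus_op (restrict_op A Vm)"
  have Sp: "linear_op Sp" "Dom Sp \<subseteq> Vp" and Sm: "linear_op Sm" "Dom Sm \<subseteq> Vm"
    using secp secm by (auto simp: sectorial_def Sp_def Sm_def)
  have linm: "linear_op (restrict_op A Vm)"
    using A V(2) unfolding linear_op_def restrict_op_def by (auto intro: cvs.subspace_inter)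
  have "0 \<in> resolvent_set Vm (restrict_op A Vm)" using spec by (auto simp: spectrum_def)
  then have 0: "0 \<in> resolvent_set Vp Sp" "0 \<in> resolvent_set Vm Sm"
    using spec resolvent_set_uminus_op[OF linm V(2), of 0] by (auto simp: spectrum_def Sp_def Sm_def)
  obtain Mp where Mp: "0 < Mp" "\<And>z. Re z \<le> 0 \<Longrightarrow> z \<in> resolvent_set Vp Sp"
      "\<And>z y. Re z \<le> 0 \<Longrightarrow> y \<in> Vp \<Longrightarrow> norm (resolvent Sp z y) \<le> Mp / (1 + cmod z) * norm y"
    using sectorial_half_plane[OF secp[folded Sp_def] \<theta>(2) V(1) 0(1)] by blast
  obtain Mm where Mm: "0 < Mm" "\<And>z. Re z \<le> 0 \<Longrightarrow> z \<in> resolvent_set Vm Sm"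
      "\<And>z y. Re z \<le> 0 \<Longrightarrow> y \<in> Vm \<Longrightarrow> norm (resolvent Sm z y) \<le> Mm / (1 + cmod z) * norm y"
    using sectorial_half_plane[OF secm[folded Sm_def] \<theta>(2) V(2) 0(2)] by blast
  let ?R = "\<lambda>t x. resolvent A (iax t) x"
  let ?Rp = "\<lambda>t v. resolvent Sp (iax t) v"
  let ?Rm = "\<lambda>t w. resolvent Sm (iax t) w"
  have split: "?R t (v + w) = ?Rp t v - ?Rm (- t) w" if v: "v \<in> Vp" and w: "w \<in> Vm" for t v w
  proof -
    let ?u = "?Rp t v" and ?u' = "?Rm (- t) w"
    have u: "?u \<in> Dom A" "App A ?u - iax t *\<^sub>C ?u = v"
      using resolvent_setD(1,2)[OF Mp(2) v, of "iax t"]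
      by (simp_all add: Sp_def restrict_op_def)
    have u': "?u' \<in> Dom A" "- App A ?u' + iax t *\<^sub>C ?u' = w"
      using resolvent_setD(1,2)[OF Mm(2) w, of "iax (- t)"]
      by (simp_all add: Sm_def restrict_op_def uminus_op_def)
    have "App A (?u - ?u') - iax t *\<^sub>C (?u - ?u') =
        (App A ?u - iax t *\<^sub>C ?u) + (- App A ?u' + iax t *\<^sub>C ?u')"
      using linear_opD(4)[OF A u(1) u'(1)] by (simp add: cvs.scale_right_diff_distrib)
    also have "\<dots> = v + w" unfolding u(2) u'(2) ..
    finally show ?thesis
      using resolvent_setD(4)[OF axis cvs.subspace_diff[OF linear_opD(1)[OF A] u(1) u'(1)]] by metis
  qed
  define M where "M = Mp * cp + Mm * cm + 1"
  have M: "0 < M" using Mp(1) Mm(1) cp(1) cm(1) by (simp add: M_def add_nonneg_pos)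
  have "norm (?R t x) \<le> M / (1 + \<bar>t\<bar>) * norm x" for t x
  proof -
    obtain v w where vw: "v \<in> Vp" "w \<in> Vm" "x = v + w" using all by blast
    have "norm (?R t x) \<le> norm (?Rp t v) + norm (?Rm (- t) w)"
      unfolding vw(3) split[OF vw(1,2)] by (rule norm_triangle_ineq4)
    also have "\<dots> \<le> Mp / (1 + \<bar>t\<bar>) * norm v + Mm / (1 + \<bar>t\<bar>) * norm w"
      using Mp(3)[OF _ vw(1), of "iax t"] Mm(3)[OF _ vw(2), of "iax (- t)"]
      by (intro add_mono) (simp_all add: norm_mult)
    also have "\<dots> \<le> Mp / (1 + \<bar>t\<bar>) * (cp * norm x) + Mm / (1 + \<bar>t\<bar>) * (cm * norm x)"
      unfolding vw(3) using Mp(1) Mm(1) vw by (intro add_mono mult_left_mono cp(2) cm(2)) auto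
    also have "\<dots> = (Mp * cp + Mm * cm) / (1 + \<bar>t\<bar>) * norm x"
      by (simp add: add_divide_distrib distrib_right)
    also have "\<dots> \<le> M / (1 + \<bar>t\<bar>) * norm x"
      by (intro mult_right_mono divide_right_mono) (auto simp: M_def)
    finally show ?thesis .
  qed
  then have "axis_resolvent A ?R M"
    using A M resolvent_setD(1,2,4)[OF axis] by unfold_locales auto
  moreover have "norm (integral {-r..r} (\<lambda>t. ?R t x)) \<le> (8 * Mp * cp + 8 * Mm * cm) * norm x" if r: "0 < r" for r x
  proof -
    obtain v w where vw: "v \<in> Vp" "w \<in> Vm" "x = v + w" using all by blast
    note p = sectorial_integral_bound[OF Sp V(1) Mp vw(1) r]
    note m = sectorial_integral_bound[OF Sm V(2) Mm vw(2) r]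
    have "continuous_on {-r..r} (\<lambda>t. ?Rm (- t) w)"
      by (rule continuous_on_compose2[OF m(1)[of UNIV], of _ "\<lambda>t. - t"]) (auto intro!: continuous_intros)
    then have "integral {-r..r} (\<lambda>t. ?R t x) = integral {-r..r} (\<lambda>t. ?Rp t v) - integral {-r..r} (\<lambda>t. ?Rm (- t) w)"
      unfolding vw(3) split[OF vw(1,2)]
      by (intro Henstock_Kurzweil_Integration.integral_diff integrable_continuous_real p(1))
    also have "integral {-r..r} (\<lambda>t. ?Rm (- t) w) = integral {-r..r} (\<lambda>t. ?Rm t w)"
      by (rule integral_symmetric_reflect)
    also have "norm (integral {-r..r} (\<lambda>t. ?Rp t v) - integral {-r..r} (\<lambda>t. ?Rm t w)) \<le> 8 * Mp * norm v + 8 * Mm * norm w"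
      by (intro order_trans[OF norm_triangle_ineq4] add_mono p(2) m(2))
    also have "\<dots> \<le> 8 * Mp * (cp * norm x) + 8 * Mm * (cm * norm x)"
      unfolding vw(3) using Mp(1) Mm(1) vw by (intro add_mono mult_left_mono cp(2) cm(2)) auto
    finally show ?thesis by (simp add: algebra_simps)
  qed
  ultimately show ?thesis by blast
qed

section \<open>Adjoints\<close>

lemma eq_if_cinner_eq_on_dense:
  fixes D :: "'a::complex_hilbert set"
  assumes D: "closure D = UNIV" and eq: "\<And>x. x \<in> D \<Longrightarrow> cinner x y = cinner x z"
  shows "y = z"
proof -
  have "cinner x (y - z) = 0" for x
  proof -
    obtain f where f: "\<And>n. f n \<in> D" "f \<longlonglongrightarrow> x"
      using D closure_sequential[of x D] by auto
    have "(\<lambda>n. cinner (f n) (y - z)) \<longlonglongrightarrow> cinner x (y - z)" by (intro tendsto_cinner f(2) tendsto_const)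
    moreover have "cinner (f n) (y - z) = 0" for n using eq[OF f(1)] by (simp add: cinner_diff_right)
    ultimately show ?thesis by (simp add: LIMSEQ_const_iff)
  qed
  then have "cinner (y - z) (y - z) = 0" .
  then show ?thesis by simp
qed

lemma adjoint_opI:
  assumes S: "densely_defined S" and eq: "\<And>x. x \<in> Dom S \<Longrightarrow> cinner (App S x) y = cinner x z"
  shows "y \<in> Dom (adjoint_op S)" and "App (adjoint_op S) y = z"
proof -
  show "y \<in> Dom (adjoint_op S)" using eq by (auto simp: adjoint_op_def)
  have "(THE z. \<forall>x\<in>Dom S. cinner (App S x) y = cinner x z) = z"
    using eq by (intro the_equality)
      (auto intro!: eq_if_cinner_eq_on_dense[OF S[unfolded densely_defined_def]])
  then show "App (adjoint_op S) y = z" by (simp add: adjoint_op_def)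
qed

lemma adjoint_opD:
  assumes S: "densely_defined S" and y: "y \<in> Dom (adjoint_op S)" and x: "x \<in> Dom S"
  shows "cinner (App S x) y = cinner x (App (adjoint_op S) y)"
proof -
  obtain z where z: "\<And>x. x \<in> Dom S \<Longrightarrow> cinner (App S x) y = cinner x z"
    using y by (auto simp: adjoint_op_def)
  from z[OF x] adjoint_opI(2)[OF S z] show ?thesis by simp
qed

lemma linear_adjoint_op:
  assumes S: "densely_defined S"
  shows "linear_op (adjoint_op S)"
proof -
  have add: "x + y \<in> Dom (adjoint_op S) \<and> App (adjoint_op S) (x + y) = App (adjoint_op S) x + App (adjoint_op S) y"
    if "x \<in> Dom (adjoint_op S)" "y \<in> Dom (adjoint_op S)" for x y
    using that adjoint_opI[OF S, of "x + y" "App (adjoint_op S) x + App (adjoint_op S) y"]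
    by (simp add: cinner_add_right adjoint_opD[OF S])
  have scale: "a *\<^sub>C x \<in> Dom (adjoint_op S) \<and> App (adjoint_op S) (a *\<^sub>C x) = a *\<^sub>C App (adjoint_op S) x"
    if "x \<in> Dom (adjoint_op S)" for a x
    using that adjoint_opI[OF S, of "a *\<^sub>C x" "a *\<^sub>C App (adjoint_op S) x"]
    by (simp add: cinner_scaleC_right adjoint_opD[OF S])
  have "0 \<in> Dom (adjoint_op S)" by (rule adjoint_opI(1)[OF S, of _ 0]) simp
  then have "csubspace (Dom (adjoint_op S))"
    by (intro cvs.subspaceI) (use add scale in auto)
  then show ?thesis unfolding linear_op_def using add scale by blast
qed

lemma linear_uminus_op: "linear_op S \<Longrightarrow> linear_op (uminus_op S)"
  unfolding linear_op_def uminus_op_def by simp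

locale axis_resolvent_hilbert = axis_resolvent S R M
  for S :: "('h::complex_hilbert, 'h) op" and R M +
  assumes dense_S: "densely_defined S"
begin

text \<open>The Hilbert space adjoint of the bounded operator \<^term>\<open>R t\<close>, given by the Riesz
  representation theorem; it is the resolvent of the adjoint of \<^term>\<open>S\<close> at \<open>- \<i> t\<close>.\<close>

definition adjR :: "real \<Rightarrow> 'h \<Rightarrow> 'h" where
  "adjR t w = (SOME z. \<forall>f. cinner (R t f) w = cinner f z)"

lemma cinner_R: "cinner (R t f) w = cinner f (adjR t w)"
proof -
  have "\<exists>z. \<forall>f. cinner (R t f) w = cinner f z"
  proof (rule riesz_representation)
    show "cmod (cinner (R t x) w) \<le> (M * norm w) * norm x" for x
    proof -
      have "cmod (cinner (R t x) w) \<le> norm (R t x) * norm w" by (rule cinner_cauchy_schwarz)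
      also have "\<dots> \<le> (M * norm x) * norm w" by (intro mult_right_mono norm_R_le) auto
      finally show ?thesis by (simp add: mult_ac)
    qed
  qed (simp_all add: R_add R_scaleC cinner_add_left cinner_scaleC_left)
  then have "\<forall>f. cinner (R t f) w = cinner f (adjR t w)" unfolding adjR_def by (rule someI_ex)
  then show ?thesis by blast
qed

lemma adjoint_adjR:
  shows "adjR t w \<in> Dom (adjoint_op S)"
    and "App (adjoint_op S) (adjR t w) = w - iax t *\<^sub>C adjR t w"
proof -
  have "cinner (App S x) (adjR t w) = cinner x (w - iax t *\<^sub>C adjR t w)"
    if x: "x \<in> Dom S" for x
  proof -
    have "R t (App S x) = x + iax t *\<^sub>C R t x"
      using R_S[OF x, of t] by (simp add: R_diff R_scaleC algebra_simps)
    then have "cinner (App S x) (adjR t w) = cinner x w + iax t * cinner x (adjR t w)"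
      by (simp add: cinner_add_left cinner_scaleC_left flip: cinner_R)
    then show ?thesis by (simp add: cinner_diff_right cinner_scaleC_right)
  qed
  note * = this
  show "adjR t w \<in> Dom (adjoint_op S)" by (rule adjoint_opI(1)[OF dense_S *])
  show "App (adjoint_op S) (adjR t w) = w - iax t *\<^sub>C adjR t w"
    by (rule adjoint_opI(2)[OF dense_S *])
qed

lemma adjR_adjoint:
  assumes v: "v \<in> Dom (adjoint_op S)"
  shows "adjR t (App (adjoint_op S) v + iax t *\<^sub>C v) = v"
proof -
  have "cinner f (adjR t (App (adjoint_op S) v + iax t *\<^sub>C v)) = cinner f v" for f
  proof -
    have "cinner f (adjR t (App (adjoint_op S) v + iax t *\<^sub>C v)) =
        cinner (App S (R t f)) v - iax t * cinner (R t f) v"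
      unfolding cinner_R[symmetric]
      by (simp add: cinner_add_right cinner_scaleC_right adjoint_opD[OF dense_S v R_Dom])
    also have "\<dots> = cinner (App S (R t f) - iax t *\<^sub>C R t f) v"
      by (simp add: cinner_diff_left cinner_scaleC_left)
    finally show ?thesis by (simp add: S_R)
  qed
  then show ?thesis by (intro eq_if_cinner_eq_on_dense[of UNIV]) auto
qed

lemma norm_adjR: "norm (adjR t w) \<le> M / (1 + \<bar>t\<bar>) * norm w"
proof (rule norm_le_if_cinner_le)
  fix y
  have "cmod (cinner (adjR t w) y) = cmod (cinner (R t y) w)"
    by (metis cinner_R cinner_commute complex_mod_cnj)
  also have "\<dots> \<le> norm (R t y) * norm w" by (rule cinner_cauchy_schwarz)
  also have "\<dots> \<le> (M / (1 + \<bar>t\<bar>) * norm y) * norm w" by (intro mult_right_mono norm_R) auto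
  finally show "cmod (cinner (adjR t w) y) \<le> M / (1 + \<bar>t\<bar>) * norm w * norm y" by (simp add: mult_ac)
qed (use M_pos in auto)

text \<open>A vector orthogonal to the domain of the adjoint is orthogonal to the range of
  \<^term>\<open>adjR 0\<close>, hence in the kernel of the injective operator \<^term>\<open>R 0\<close>.\<close>

lemma dense_adjoint: "densely_defined (adjoint_op S)"
  unfolding densely_defined_def
proof (rule dense_if_orthogonal_trivial)
  show "csubspace (Dom (adjoint_op S))" by (intro linear_opD(1) linear_adjoint_op dense_S)
  fix w assume w: "\<And>v. v \<in> Dom (adjoint_op S) \<Longrightarrow> cinner v w = 0"
  have "cinner (R 0 w) (R 0 w) = cnj (cinner (adjR 0 (R 0 w)) w)"
    unfolding cinner_R by (rule cinner_commute)
  then have "R 0 w = 0" using w[OF adjoint_adjR(1)] by simp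
  then show "w = 0" using S_R[of 0 w] by (simp add: linear_opD(5)[OF linear_S])
qed

lemma axis_resolvent_uminus_adjoint:
  "axis_resolvent (uminus_op (adjoint_op S)) (\<lambda>t w. - adjR t w) M"
proof
  have Dom: "Dom (uminus_op (adjoint_op S)) = Dom (adjoint_op S)"
    and App: "App (uminus_op (adjoint_op S)) v = - App (adjoint_op S) v" for v
    by (simp_all add: uminus_op_def)
  note lin = linear_adjoint_op[OF dense_S]
  have neg: "- v \<in> Dom (adjoint_op S)" "App (adjoint_op S) (- v) = - App (adjoint_op S) v"
    if "v \<in> Dom (adjoint_op S)" for v
    using cvs.subspace_neg[OF linear_opD(1)[OF lin] that] linear_opD(3)[OF lin that, of "-1"] by auto
  show "linear_op (uminus_op (adjoint_op S))" by (intro linear_uminus_op lin)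
  show "0 < M" by (rule M_pos)
  fix t x
  show "- adjR t x \<in> Dom (uminus_op (adjoint_op S))"
    by (simp add: Dom neg adjoint_adjR)
  show "App (uminus_op (adjoint_op S)) (- adjR t x) - iax t *\<^sub>C (- adjR t x) = x"
    by (simp add: App neg adjoint_adjR)
  show "norm (- adjR t x) \<le> M / (1 + \<bar>t\<bar>) * norm x"
    using norm_adjR[of t x] by simp
next
  fix u t assume "u \<in> Dom (uminus_op (adjoint_op S))"
  then have u: "u \<in> Dom (adjoint_op S)" by (simp add: uminus_op_def)
  have lin: "linear_op (adjoint_op S)" by (rule linear_adjoint_op[OF dense_S])
  have u': "- u \<in> Dom (adjoint_op S)" "App (adjoint_op S) (- u) = - App (adjoint_op S) u"
    using cvs.subspace_neg[OF linear_opD(1)[OF lin] u] linear_opD(3)[OF lin u, of "-1"] by auto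
  show "- adjR t (App (uminus_op (adjoint_op S)) u - iax t *\<^sub>C u) = u"
    using adjR_adjoint[OF u'(1), of t] u'(2) by (simp add: uminus_op_def)
qed

text \<open>Convergence of the integrals does not pass to adjoints in the strong sense, but a uniform
  bound does.\<close>

lemma adjR_integral_bound:
  assumes K: "\<And>x. norm (integral {-r..r} (\<lambda>t. R t x)) \<le> K * norm x" and K0: "0 \<le> K"
  shows "norm (integral {-r..r} (\<lambda>t. adjR t w)) \<le> K * norm w"
proof (rule norm_le_if_cinner_le)
  interpret adj: axis_resolvent "uminus_op (adjoint_op S)" "\<lambda>t w. - adjR t w" M
    by (rule axis_resolvent_uminus_adjoint)
  fix y
  have int: "(\<lambda>t. adjR t w) integrable_on {-r..r}"
    using integrable_neg[OF adj.integrable_R[of w "-r" r]] by simp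
  have "cinner y (integral {-r..r} (\<lambda>t. adjR t w)) = integral {-r..r} ((\<lambda>x. cinner y x) \<circ> (\<lambda>t. adjR t w))"
    by (intro integral_linear[symmetric] int bounded_bilinear.bounded_linear_right[OF bounded_bilinear_cinner])
  also have "\<dots> = integral {-r..r} ((\<lambda>x. cinner x w) \<circ> (\<lambda>t. R t y))"
    by (simp add: o_def cinner_R)
  also have "\<dots> = cinner (integral {-r..r} (\<lambda>t. R t y)) w"
    by (intro integral_linear integrable_R bounded_linear_cinner_left)
  finally have "cmod (cinner (integral {-r..r} (\<lambda>t. adjR t w)) y) = cmod (cinner (integral {-r..r} (\<lambda>t. R t y)) w)"
    by (metis cinner_commute complex_mod_cnj)
  also have "\<dots> \<le> norm (integral {-r..r} (\<lambda>t. R t y)) * norm w" by (rule cinner_cauchy_schwarz)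
  also have "\<dots> \<le> (K * norm y) * norm w" by (intro mult_right_mono K) auto
  finally show "cmod (cinner (integral {-r..r} (\<lambda>t. adjR t w)) y) \<le> K * norm w * norm y" by (simp add: mult_ac)
qed (use K0 in auto)

end

section \<open>Spectral projections from the principal value integral\<close>

lemma has_field_derivative_if_quadratic_error:
  fixes f :: "complex \<Rightarrow> complex"
  assumes \<delta>: "0 < \<delta>"
    and le: "\<And>z. cmod (z - w) < \<delta> \<Longrightarrow> cmod (f z - f w - (z - w) * d) \<le> C * (cmod (z - w))\<^sup>2"
  shows "(f has_field_derivative d) (at w)"
  unfolding has_field_derivative_iff
proof (rule LIM_zero_cancel, rule Lim_null_comparison)
  have *: "cmod ((f z - f w) / (z - w) - d) \<le> C * cmod (z - w)" if z: "z \<noteq> w" "cmod (z - w) < \<delta>" for z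
  proof -
    have "(f z - f w) / (z - w) - d = (f z - f w - (z - w) * d) / (z - w)"
      using z by (simp add: divide_simps)
    then have "cmod ((f z - f w) / (z - w) - d) = cmod (f z - f w - (z - w) * d) / cmod (z - w)"
      by (simp add: norm_divide)
    also have "\<dots> \<le> C * (cmod (z - w))\<^sup>2 / cmod (z - w)"
      by (intro divide_right_mono le z) simp
    finally show ?thesis using z by (simp add: power2_eq_square)
  qed
  show "\<forall>\<^sub>F z in at w. cmod ((f z - f w) / (z - w) - d) \<le> C * cmod (z - w)"
    unfolding eventually_at by (intro exI[of _ \<delta>]) (use \<delta> * in \<open>auto simp: dist_norm\<close>)
  have "((\<lambda>z. C * cmod (z - w)) \<longlongrightarrow> C * cmod (w - w)) (at w)" by (intro tendsto_intros)
  then show "((\<lambda>z. C * cmod (z - w)) \<longlongrightarrow> 0) (at w)" by simp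
qed

abbreviation (input) axis_kernel :: "complex \<Rightarrow> real \<Rightarrow> complex" where
  "axis_kernel z t \<equiv> 1 / (iax t - z)"

lemma axis_kernel_eq:
  fixes z :: complex
  defines "a \<equiv> - Re z" and "y \<equiv> Im z"
  assumes "Re z \<noteq> 0"
  shows "axis_kernel z t =
    complex_of_real (a / (a\<^sup>2 + (t - y)\<^sup>2)) - \<i> * complex_of_real ((t - y) / (a\<^sup>2 + (t - y)\<^sup>2))"
proof -
  define N where "N = a\<^sup>2 + (t - y)\<^sup>2"
  have N: "N \<noteq> 0" using assms by (simp add: N_def sum_power2_eq_zero_iff)
  let ?c = "complex_of_real (a / N) - \<i> * complex_of_real ((t - y) / N)"
  have w: "iax t - z = complex_of_real a + \<i> * complex_of_real (t - y)"
    by (simp add: a_def y_def complex_eq_iff)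
  have "a * (a / N) + (t - y) * ((t - y) / N) = (a * a + (t - y) * (t - y)) / N"
    by (simp add: add_divide_distrib)
  also have "a * a + (t - y) * (t - y) = N" by (simp add: N_def power2_eq_square)
  finally have "Re ((iax t - z) * ?c) = N / N" unfolding w by simp
  moreover have "Im ((iax t - z) * ?c) = 0" unfolding w by simp
  ultimately have "(iax t - z) * ?c = 1" using N by (simp add: complex_eq_iff)
  from inverse_unique[OF this] show ?thesis unfolding N_def by (simp only: inverse_eq_divide)
qed

lemma axis_kernel_nz: "Re z \<noteq> 0 \<Longrightarrow> iax t - z \<noteq> 0"
  by (auto simp: complex_eq_iff)

lemma continuous_axis_kernel: "Re z \<noteq> 0 \<Longrightarrow> continuous_on A (axis_kernel z)"
  by (intro continuous_intros) (auto simp: axis_kernel_nz)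

lemma norm_axis_kernel:
  assumes "0 < \<delta>" "\<delta> \<le> \<bar>Re z\<bar>"
  shows "cmod (axis_kernel z t) \<le> 1 / sqrt (\<delta>\<^sup>2 + (t - Im z)\<^sup>2)"
    and "cmod (axis_kernel z t) \<le> 1 / \<delta>"
proof -
  have "\<delta>\<^sup>2 \<le> (Re z)\<^sup>2" using assms abs_le_square_iff[of \<delta> "Re z"] by simp
  then have le: "sqrt (\<delta>\<^sup>2 + (t - Im z)\<^sup>2) \<le> cmod (iax t - z)"
    by (simp add: cmod_def)
  have pos: "0 < sqrt (\<delta>\<^sup>2 + (t - Im z)\<^sup>2)" using assms by (simp add: add_pos_nonneg)
  show "cmod (axis_kernel z t) \<le> 1 / sqrt (\<delta>\<^sup>2 + (t - Im z)\<^sup>2)"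
    using le pos by (simp add: norm_divide frac_le)
  have "\<delta> \<le> sqrt (\<delta>\<^sup>2 + (t - Im z)\<^sup>2)" by (rule real_le_rsqrt) simp
  then have "\<delta> \<le> cmod (iax t - z)" using le by linarith
  then show "cmod (axis_kernel z t) \<le> 1 / \<delta>"
    using assms by (simp add: norm_divide frac_le)
qed

lemma DERIV_arctan_affine:
  fixes a y t :: real
  assumes a: "a \<noteq> 0"
  shows "((\<lambda>t. arctan ((t - y) / a)) has_real_derivative a / (a\<^sup>2 + (t - y)\<^sup>2)) (at t)"
proof -
  define n where "n = a\<^sup>2 + (t - y)\<^sup>2"
  have d: "((\<lambda>t. (t - y) / a) has_real_derivative (1 - 0) / a) (at t)"
    by (intro DERIV_cdivide DERIV_diff DERIV_ident DERIV_const)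
  have "1 + ((t - y) / a)\<^sup>2 = n / a\<^sup>2"
    using a by (simp add: n_def power_divide add_divide_distrib)
  then have "inverse (1 + ((t - y) / a)\<^sup>2) * ((1 - 0) / a) = a\<^sup>2 / n * (1 / a)" by simp
  also have "\<dots> = a / n" using a by (simp add: power2_eq_square)
  finally show ?thesis using DERIV_chain2[OF DERIV_arctan d] by (simp add: n_def)
qed

lemma pv_axis_kernel:
  assumes z: "Re z \<noteq> 0"
  shows "pv_integral (axis_kernel z) (complex_of_real (- sgn (Re z) * pi))"
proof -
  define a where "a = - Re z"
  define y where "y = Im z"
  define A where "A t = arctan ((t - y) / a)" for t
  define L where "L t = ln (a\<^sup>2 + (t - y)\<^sup>2) / 2" for t
  have a: "a \<noteq> 0" using z by (simp add: a_def)
  have pos: "0 < a\<^sup>2 + (t - y)\<^sup>2" for t using a by (simp add: add_pos_nonneg)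
  have dA: "(A has_real_derivative a / (a\<^sup>2 + (t - y)\<^sup>2)) (at t)" for t
    unfolding A_def by (rule DERIV_arctan_affine[OF a])
  have dL: "(L has_real_derivative (t - y) / (a\<^sup>2 + (t - y)\<^sup>2)) (at t)" for t
  proof -
    have "((\<lambda>t. a\<^sup>2 + (t - y)\<^sup>2) has_real_derivative 2 * (t - y)) (at t)"
      by (rule derivative_eq_intros refl)+ simp
    then have "((\<lambda>t. ln (a\<^sup>2 + (t - y)\<^sup>2)) has_real_derivative inverse (a\<^sup>2 + (t - y)\<^sup>2) * (2 * (t - y))) (at t)"
      by (rule DERIV_chain2[rotated]) (rule DERIV_ln[OF pos])
    then have "(L has_real_derivative inverse (a\<^sup>2 + (t - y)\<^sup>2) * (2 * (t - y)) / 2) (at t)"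
      unfolding L_def by (rule DERIV_cdivide)
    moreover have "inverse n * (2 * s) / 2 = s / n" for n s :: real by (simp add: inverse_eq_divide)
    ultimately show ?thesis by (simp only:)
  qed
  define F where "F t = complex_of_real (A t) - \<i> * complex_of_real (L t)" for t
  have dF: "(F has_vector_derivative axis_kernel z t) (at t)" for t
    using has_vector_derivative_diff[OF has_vector_derivative_of_real[OF dA]
        has_vector_derivative_mult_right[OF has_vector_derivative_of_real[OF dL], of \<i>], of t]
    unfolding F_def axis_kernel_eq[OF z] a_def y_def .
  have int: "integral {-r..r} (axis_kernel z) =
      complex_of_real (A r - A (-r)) - \<i> * complex_of_real (L r - L (-r))" if "0 \<le> r" for r
  proof -
    have "((axis_kernel z) has_integral (F r - F (-r))) {-r..r}"
      using that by (intro fundamental_theorem_of_calculus has_vector_derivative_at_within[OF dF]) auto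
    then show ?thesis by (simp add: integral_unique F_def algebra_simps)
  qed
  have limA: "((\<lambda>r. A r - A (-r)) \<longlongrightarrow> - sgn (Re z) * pi) at_top"
  proof (cases "0 < a")
    case True
    then have "((\<lambda>r. arctan ((r - y) / a) - arctan ((- r - y) / a)) \<longlongrightarrow> pi) at_top" by real_asymp
    then show ?thesis using True by (simp add: A_def a_def)
  next
    case False
    with a have "a < 0" by simp
    then have "((\<lambda>r. arctan ((r - y) / a) - arctan ((- r - y) / a)) \<longlongrightarrow> - pi) at_top" by real_asymp
    then show ?thesis using \<open>a < 0\<close> by (simp add: A_def a_def)
  qed
  have limL: "((\<lambda>r. L r - L (-r)) \<longlongrightarrow> 0) at_top"
  proof -
    have "0 < a\<^sup>2" using a by simp
    then have "((\<lambda>r. ln (a\<^sup>2 + (r - y)\<^sup>2) / 2 - ln (a\<^sup>2 + (- r - y)\<^sup>2) / 2) \<longlongrightarrow> 0) at_top" by real_asymp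
    then show ?thesis by (simp add: L_def)
  qed
  have "((\<lambda>r. complex_of_real (A r - A (-r)) - \<i> * complex_of_real (L r - L (-r))) \<longlongrightarrow>
      complex_of_real (- sgn (Re z) * pi) - iax 0) at_top"
    by (intro tendsto_intros limA limL)
  moreover have "\<forall>\<^sub>F r in at_top. complex_of_real (A r - A (-r)) - \<i> * complex_of_real (L r - L (-r)) =
      integral {-r..r} (axis_kernel z)"
    using eventually_ge_at_top[of 0] by eventually_elim (simp add: int)
  ultimately show ?thesis by (simp add: Lim_transform_eventually)
qed

text \<open>The uniform bound on the truncated integrals is the remaining condition for their convergence
  on the whole space.\<close>

locale axis_dichotomy = axis_resolvent_hilbert S R M
  for S :: "('h::complex_hilbert, 'h) op" and R M +
  fixes K :: real
  assumes K_bound: "0 < r \<Longrightarrow> norm (integral {-r..r} (\<lambda>t. R t x)) \<le> K * norm x"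
    and K_nonneg: "0 \<le> K"
begin

text \<open>On the domain, \<^term>\<open>R t x\<close> differs from the odd function \<open>\<i> t / (1 + t\<^sup>2) x\<close>,
  whose integral over a symmetric interval vanishes, by an absolutely integrable function.\<close>

lemma pv_convergent_Dom:
  assumes x: "x \<in> Dom S"
  shows "\<exists>I. pv_integral (\<lambda>t. R t x) I"
proof -
  define o' where "o' t = (\<i> * complex_of_real (t / (1 + t\<^sup>2))) *\<^sub>C x" for t
  define f where "f t = R t x - o' t" for t
  define C where "C = M * norm x + M * norm (App S x)"
  have pos: "0 < 1 + t\<^sup>2" for t :: real by (simp add: add_pos_nonneg)
  have cont_o: "continuous_on A o'" for A
    unfolding o'_def using pos by (intro continuous_intros) (auto simp: less_imp_neq[OF pos, symmetric])
  have contf: "continuous_on UNIV f" unfolding f_def by (intro continuous_intros continuous_R cont_o)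
  have fle: "norm (f t) \<le> C / (1 + t\<^sup>2)" for t
  proof -
    let ?c = "iax t"
    have RS: "R t (App S x) = x + ?c *\<^sub>C R t x"
      using R_S[OF x, of t] by (simp add: R_diff R_scaleC algebra_simps)
    have c2: "?c * ?c = - complex_of_real (t\<^sup>2)" by (simp add: power2_eq_square complex_eq_iff)
    have "complex_of_real (1 + t\<^sup>2) *\<^sub>C f t = R t x - (?c * ?c) *\<^sub>C R t x - ?c *\<^sub>C x"
    proof -
      have "complex_of_real (1 + t\<^sup>2) * (\<i> * complex_of_real (t / (1 + t\<^sup>2))) = ?c"
        using less_imp_neq[OF pos[of t]] by (simp flip: of_real_mult of_real_add of_real_power)
      then have "complex_of_real (1 + t\<^sup>2) *\<^sub>C o' t = ?c *\<^sub>C x" unfolding o'_def scaleC_scaleC by simp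
      then show ?thesis unfolding f_def c2
        by (simp add: cvs.scale_right_diff_distrib scaleC_add_left)
    qed
    also have "\<dots> = R t x - ?c *\<^sub>C R t (App S x)"
      unfolding RS by (simp add: scaleC_add_right scaleC_scaleC)
    finally have "(1 + t\<^sup>2) * norm (f t) = norm (R t x - ?c *\<^sub>C R t (App S x))"
      using pos[of t] by (metis norm_scaleC norm_of_real abs_of_pos)
    also have "\<dots> \<le> norm (R t x) + \<bar>t\<bar> * norm (R t (App S x))"
      using norm_triangle_ineq4[of "R t x" "?c *\<^sub>C R t (App S x)"] by (simp add: norm_scaleC norm_mult)
    also have "\<dots> \<le> M * norm x + \<bar>t\<bar> * (M / (1 + \<bar>t\<bar>) * norm (App S x))"
      by (intro add_mono mult_left_mono norm_R_le norm_R) auto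
    also have "\<bar>t\<bar> * (M / (1 + \<bar>t\<bar>) * norm (App S x)) = (\<bar>t\<bar> / (1 + \<bar>t\<bar>)) * (M * norm (App S x))" by simp
    also have "\<dots> \<le> 1 * (M * norm (App S x))" using M_pos by (intro mult_right_mono) auto
    finally have "(1 + t\<^sup>2) * norm (f t) \<le> C" by (simp add: C_def)
    then show ?thesis using pos[of t] by (simp add: field_simps)
  qed
  have C0: "0 \<le> C" using M_pos by (simp add: C_def)
  have "((\<lambda>t. C * arctan t) has_real_derivative C / (1 + t\<^sup>2)) (at t)" for t
    by (auto intro!: derivative_eq_intros simp: inverse_eq_divide)
  moreover have "\<bar>C * arctan t\<bar> \<le> C * (pi / 2)" for t
  proof -
    have "\<bar>arctan t\<bar> \<le> pi / 2" using arctan_bounded[of t] by linarith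
    from mult_left_mono[OF this C0] C0 show ?thesis by (simp add: abs_mult)
  qed
  ultimately obtain I where I: "pv_integral f I"
    using integral_symmetric_convergent[OF contf fle] by blast
  have "integral {-r..r} (\<lambda>t. R t x) = integral {-r..r} f" for r
  proof -
    have "integral {-r..r} (\<lambda>t. f t + o' t) = integral {-r..r} f + integral {-r..r} o'"
      by (intro Henstock_Kurzweil_Integration.integral_add integrable_continuous_real cont_o
          continuous_on_subset[OF contf]) auto
    moreover have "integral {-r..r} o' = 0" by (rule integral_symmetric_odd) (simp add: o'_def)
    ultimately show ?thesis by (simp add: f_def)
  qed
  with I show ?thesis by auto
qed

text \<open>Uniformly bounded operators that converge on a dense set converge everywhere.\<close>

lemma pv_convergent: "\<exists>I. pv_integral (\<lambda>t. R t x) I"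
proof -
  let ?F = "\<lambda>r x. integral {-r..r} (\<lambda>t. R t x)"
  have Fdiff: "?F r x - ?F r y = ?F r (x - y)" for r x y
    unfolding R_diff by (intro Henstock_Kurzweil_Integration.integral_diff[symmetric] integrable_R)
  obtain u where u: "\<And>n. u n \<in> Dom S" "u \<longlonglongrightarrow> x"
    using dense_S closure_sequential[of x "Dom S"] by (auto simp: densely_defined_def)
  obtain J where J: "\<And>n. ((\<lambda>r. ?F r (u n)) \<longlongrightarrow> J n) at_top" using pv_convergent_Dom[OF u(1)] by metis
  have Jlip: "norm (J m - J n) \<le> K * norm (u m - u n)" for m n
  proof (rule tendsto_upperbound)
    show "((\<lambda>r. norm (?F r (u m) - ?F r (u n))) \<longlongrightarrow> norm (J m - J n)) at_top" by (intro tendsto_intros J)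
    show "\<forall>\<^sub>F r in at_top. norm (?F r (u m) - ?F r (u n)) \<le> K * norm (u m - u n)"
      using eventually_gt_at_top[of 0] by eventually_elim (simp only: Fdiff K_bound)
  qed simp
  have "Cauchy J"
  proof (rule CauchyI)
    fix e :: real assume e: "0 < e"
    have "Cauchy u" using u(2) by (rule LIMSEQ_imp_Cauchy)
    then obtain N where N: "\<And>m n. N \<le> m \<Longrightarrow> N \<le> n \<Longrightarrow> norm (u m - u n) < e / (K + 1)"
      using CauchyD[of u "e / (K + 1)"] e K_nonneg by auto
    have "norm (J m - J n) < e" if "N \<le> m" "N \<le> n" for m n
    proof -
      have "norm (J m - J n) \<le> K * norm (u m - u n)" by (rule Jlip)
      also have "\<dots> \<le> K * (e / (K + 1))" using N[OF that] K_nonneg by (intro mult_left_mono) auto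
      also have "\<dots> < e" using e K_nonneg by (simp add: field_simps)
      finally show ?thesis .
    qed
    then show "\<exists>N. \<forall>m\<ge>N. \<forall>n\<ge>N. norm (J m - J n) < e" by blast
  qed
  then obtain I where I: "J \<longlonglongrightarrow> I" using Cauchy_convergent convergent_def by blast
  have "((\<lambda>r. ?F r x) \<longlongrightarrow> I) at_top"
  proof (rule tendstoI)
    fix e :: real assume e: "0 < e"
    have "(\<lambda>n. K * norm (x - u n) + norm (J n - I)) \<longlonglongrightarrow> K * norm (x - x) + norm (I - I)"
      by (intro tendsto_intros u(2) I)
    then have "\<forall>\<^sub>F n in sequentially. K * norm (x - u n) + norm (J n - I) < e / 2"
      using e by (intro order_tendstoD(2)) auto
    then obtain n where n: "K * norm (x - u n) + norm (J n - I) < e / 2"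
      by (auto simp: eventually_sequentially)
    have "\<forall>\<^sub>F r in at_top. dist (?F r (u n)) (J n) < e / 2" using tendstoD[OF J, of "e / 2" n] e by simp
    then show "\<forall>\<^sub>F r in at_top. dist (?F r x) I < e"
      using eventually_gt_at_top[of 0]
    proof eventually_elim
      case (elim r)
      have "?F r x - I = ?F r (x - u n) + (?F r (u n) - J n) + (J n - I)" unfolding Fdiff[symmetric] by simp
      also have "norm \<dots> \<le> norm (?F r (x - u n)) + norm (?F r (u n) - J n) + norm (J n - I)"
        by (intro order_trans[OF norm_triangle_ineq] add_right_mono norm_triangle_ineq)
      also have "\<dots> < e" using n elim K_bound[of r "x - u n"] by (simp add: dist_norm)
      finally show ?case by (simp add: dist_norm)
    qed
  qed
  then show ?thesis by blast
qed

text \<open>The principal value of \<open>(1 / \<pi> \<i>) \<integral> (S - z)\<^sup>-\<^sup>1 x dz\<close>; the factor \<open>\<i>\<close> is cancelled by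
  \<open>dz = \<i> dt\<close>.\<close>

definition Q :: "'h \<Rightarrow> 'h" where
  "Q x = (1 / pi) *\<^sub>R (THE I. pv_integral (\<lambda>t. R t x) I)"

lemma Q_lim: "pv_integral (\<lambda>t. R t x) (pi *\<^sub>R Q x)"
proof -
  obtain I where I: "pv_integral (\<lambda>t. R t x) I" using pv_convergent by blast
  then have "(THE I. pv_integral (\<lambda>t. R t x) I) = I"
    by (intro the_equality) (auto dest: tendsto_unique[OF trivial_limit_at_top_linorder])
  with I show ?thesis by (simp add: Q_def)
qed

lemma Q_eqI: "pv_integral (\<lambda>t. R t x) (pi *\<^sub>R y) \<Longrightarrow> Q x = y"
  using tendsto_unique[OF trivial_limit_at_top_linorder Q_lim] by fastforce

lemma Q_add: "Q (x + y) = Q x + Q y"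
proof (rule Q_eqI)
  have "((\<lambda>r. integral {-r..r} (\<lambda>t. R t x) + integral {-r..r} (\<lambda>t. R t y)) \<longlongrightarrow> pi *\<^sub>R Q x + pi *\<^sub>R Q y) at_top"
    by (intro tendsto_add Q_lim)
  then show "pv_integral (\<lambda>t. R t (x + y)) (pi *\<^sub>R (Q x + Q y))"
    by (simp add: R_add Henstock_Kurzweil_Integration.integral_add integrable_R scaleR_add_right)
qed

lemma Q_commute:
  assumes B: "bounded_linear B" and comm: "\<And>t x. B (R t x) = R t (B x)"
  shows "B (Q x) = Q (B x)"
proof -
  have "((\<lambda>r. B (integral {-r..r} (\<lambda>t. R t x))) \<longlongrightarrow> B (pi *\<^sub>R Q x)) at_top"
    by (intro bounded_linear.tendsto[OF B] Q_lim)
  moreover have "B (integral {-r..r} (\<lambda>t. R t x)) = integral {-r..r} (\<lambda>t. R t (B x))" for r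
    using integral_linear[OF integrable_R[where x=x and a="-r" and b=r] B] by (simp add: o_def comm)
  ultimately have "pv_integral (\<lambda>t. R t (B x)) (pi *\<^sub>R B (Q x))"
    by (simp add: linear_simps(5)[OF B])
  then show ?thesis by (rule Q_eqI[symmetric])
qed

lemma Q_scaleC: "Q (c *\<^sub>C x) = c *\<^sub>C Q x"
  by (rule Q_commute[symmetric]) (simp_all add: bounded_linear_scaleC R_scaleC)

lemma norm_Q: "norm (Q x) \<le> K / pi * norm x"
proof -
  have "norm (pi *\<^sub>R Q x) \<le> K * norm x"
  proof (rule tendsto_upperbound)
    show "((\<lambda>r. norm (integral {-r..r} (\<lambda>t. R t x))) \<longlongrightarrow> norm (pi *\<^sub>R Q x)) at_top"
      by (intro tendsto_norm Q_lim)
    show "\<forall>\<^sub>F r in at_top. norm (integral {-r..r} (\<lambda>t. R t x)) \<le> K * norm x"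
      using eventually_gt_at_top[of 0] by eventually_elim (rule K_bound)
  qed simp
  then show ?thesis by (simp add: field_simps)
qed

lemma bounded_linear_Q: "bounded_linear Q"
  by (rule bounded_linear_intro[where K="K / pi"])
     (use norm_Q in \<open>simp_all add: Q_add scaleR_scaleC Q_scaleC mult.commute\<close>)

lemma Q_R: "Q (R t x) = R t (Q x)"
  by (rule Q_commute[symmetric]) (simp_all add: bounded_linear_R R_commute)

lemma Q_Dom:
  assumes x: "x \<in> Dom S"
  shows "Q x \<in> Dom S" and "App S (Q x) = Q (App S x)"
proof -
  have "x = R 0 (App S x)" using R_S[OF x, of 0] by simp
  then have "Q x = R 0 (Q (App S x))" by (metis Q_R)
  then show "Q x \<in> Dom S" and "App S (Q x) = Q (App S x)" using R_Dom S_R[of 0] by simp_all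
qed

text \<open>The kernel and the resolvent are both square integrable along the axis, so the
  arithmetic-geometric mean inequality yields a majorant with an elementary primitive. Its integral depends on
  \<^term>\<open>z\<close> only through the distance to the axis. The bounded factor \<^term>\<open>\<phi>\<close> covers
  the difference quotients with respect to \<^term>\<open>z\<close> as well.\<close>

lemma kernel_integral_convergent:
  assumes cont: "continuous_on UNIV \<phi>" and b: "\<And>t. cmod (\<phi> t) \<le> b" and \<delta>: "0 < \<delta>" "\<delta> \<le> \<bar>Re z\<bar>"
  shows "\<exists>I. pv_integral (\<lambda>t. (\<phi> t * axis_kernel z t) *\<^sub>C R t x) I \<and>
    norm I \<le> b * M * (pi / 2) * (1 + 1 / \<delta>) * norm x"
proof -
  define C where "C = b * M * norm x / 2"
  have b0: "0 \<le> b" using b[of 0] norm_ge_zero by (metis order_trans)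
  have C0: "0 \<le> C" using b0 M_pos by (simp add: C_def)
  have z: "Re z \<noteq> 0" using \<delta> by auto
  define g where "g t = C * (1 / (\<delta>\<^sup>2 + (t - Im z)\<^sup>2) + 1 / (1 + t\<^sup>2))" for t
  define G where "G t = C * (arctan ((t - Im z) / \<delta>) / \<delta> + arctan t)" for t
  have "continuous_on UNIV (\<lambda>t. (\<phi> t * axis_kernel z t) *\<^sub>C R t x)"
    by (intro continuous_intros cont continuous_axis_kernel[OF z] continuous_R) (use axis_kernel_nz[OF z] in auto)
  moreover have "norm ((\<phi> t * axis_kernel z t) *\<^sub>C R t x) \<le> g t" for t
  proof -
    define p where "p = 1 / sqrt (\<delta>\<^sup>2 + (t - Im z)\<^sup>2)"
    define q where "q = 1 / (1 + \<bar>t\<bar>)"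
    have p0: "0 \<le> p" and q0: "0 \<le> q" by (simp_all add: p_def q_def)
    have p2: "p\<^sup>2 = 1 / (\<delta>\<^sup>2 + (t - Im z)\<^sup>2)" by (simp add: p_def power_divide)
    have "1 + t\<^sup>2 \<le> (1 + \<bar>t\<bar>)\<^sup>2" by (simp add: power2_sum)
    then have q2: "q\<^sup>2 \<le> 1 / (1 + t\<^sup>2)" by (simp add: q_def power_divide frac_le add_pos_nonneg)
    have "norm ((\<phi> t * axis_kernel z t) *\<^sub>C R t x) = cmod (\<phi> t) * cmod (axis_kernel z t) * norm (R t x)"
      by (simp only: norm_scaleC norm_mult)
    also have "\<dots> \<le> b * p * (M * q * norm x)"
      using norm_R[of t x] norm_axis_kernel(1)[OF \<delta>, of t] p0 b0
      by (intro mult_mono b) (auto simp: p_def q_def)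
    also have "\<dots> = C * (2 * p * q)" by (simp add: C_def)
    also have "\<dots> \<le> C * (p\<^sup>2 + q\<^sup>2)"
      using C0 sum_squares_bound[of p q] by (intro mult_left_mono) auto
    also have "\<dots> \<le> g t" unfolding g_def p2 using C0 q2 by (intro mult_left_mono) auto
    finally show ?thesis .
  qed
  moreover have "(G has_real_derivative g t) (at t)" for t
  proof -
    have "((\<lambda>t. arctan ((t - Im z) / \<delta>)) has_real_derivative \<delta> / (\<delta>\<^sup>2 + (t - Im z)\<^sup>2)) (at t)"
      using \<delta> by (intro DERIV_arctan_affine) auto
    then have "(G has_real_derivative C * (\<delta> / (\<delta>\<^sup>2 + (t - Im z)\<^sup>2) / \<delta> + inverse (1 + t\<^sup>2))) (at t)"
      unfolding G_def by (intro DERIV_cmult DERIV_add DERIV_cdivide DERIV_arctan)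
    then show ?thesis using \<delta> by (simp add: g_def inverse_eq_divide)
  qed
  moreover have "\<bar>G t\<bar> \<le> C * ((pi / 2) * (1 + 1 / \<delta>))" for t
  proof -
    have at: "\<bar>arctan u\<bar> \<le> pi / 2" for u using arctan_bounded[of u] by linarith
    have "\<bar>arctan ((t - Im z) / \<delta>) / \<delta> + arctan t\<bar> \<le> \<bar>arctan ((t - Im z) / \<delta>)\<bar> / \<delta> + \<bar>arctan t\<bar>"
      using \<delta> abs_triangle_ineq[of "arctan ((t - Im z) / \<delta>) / \<delta>" "arctan t"] by (simp add: abs_divide)
    also have "\<dots> \<le> (pi / 2) / \<delta> + pi / 2"
      using \<delta> by (intro add_mono divide_right_mono at) auto
    also have "\<dots> = (pi / 2) * (1 + 1 / \<delta>)" by (simp add: distrib_left)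
    finally have le: "\<bar>arctan ((t - Im z) / \<delta>) / \<delta> + arctan t\<bar> \<le> (pi / 2) * (1 + 1 / \<delta>)" .
    from mult_left_mono[OF le C0] C0 show ?thesis by (simp add: G_def abs_mult)
  qed
  ultimately obtain I where "pv_integral (\<lambda>t. (\<phi> t * axis_kernel z t) *\<^sub>C R t x) I"
      and nI: "norm I \<le> 2 * (C * ((pi / 2) * (1 + 1 / \<delta>)))"
    using integral_symmetric_convergent by blast
  moreover have "2 * (C * ((pi / 2) * X)) = b * M * (pi / 2) * X * norm x" for X by (simp add: C_def)
  from nI[unfolded this] have "norm I \<le> b * M * (pi / 2) * (1 + 1 / \<delta>) * norm x" .
  ultimately show ?thesis by blast
qed

text \<open>The Cauchy type integral \<open>(1 / 2 \<pi> \<i>) \<integral> (S - w)\<^sup>-\<^sup>1 x / (w - z) dw\<close> along the imaginary axis. For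
  \<open>S = \<lambda>\<close> a scalar with \<open>Re \<lambda> > 0\<close> it equals \<open>1 / (\<lambda> - z)\<close> if \<open>Re z < 0\<close> and \<open>0\<close> if \<open>Re z > 0\<close>: it
  is the resolvent cut down to one spectral subspace.\<close>

definition \<Psi> :: "complex \<Rightarrow> 'h \<Rightarrow> 'h" where
  "\<Psi> z x = (1 / (2 * pi)) *\<^sub>R
     (THE I. pv_integral (\<lambda>t. axis_kernel z t *\<^sub>C R t x) I)"

lemma \<Psi>_lim:
  assumes \<delta>: "0 < \<delta>" "\<delta> \<le> \<bar>Re z\<bar>"
  shows "pv_integral (\<lambda>t. axis_kernel z t *\<^sub>C R t x) ((2 * pi) *\<^sub>R \<Psi> z x)"
    and "norm (\<Psi> z x) \<le> M * (1 + 1 / \<delta>) * norm x"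
proof -
  let ?L = "\<lambda>I. pv_integral (\<lambda>t. axis_kernel z t *\<^sub>C R t x) I"
  obtain I where I: "?L I" "norm I \<le> 1 * M * (pi / 2) * (1 + 1 / \<delta>) * norm x"
    using kernel_integral_convergent[of "\<lambda>t. 1" 1 \<delta> z x] \<delta> by auto
  then have "(THE I. ?L I) = I"
    by (intro the_equality) (auto dest: tendsto_unique[OF trivial_limit_at_top_linorder])
  then have I': "I = (2 * pi) *\<^sub>R \<Psi> z x" by (simp add: \<Psi>_def)
  with I show "?L ((2 * pi) *\<^sub>R \<Psi> z x)" by simp
  define B where "B = M * (1 + 1 / \<delta>) * norm x"
  have "0 \<le> B" using M_pos \<delta> by (simp add: B_def)
  moreover have "pi * (2 * norm (\<Psi> z x)) \<le> pi * (B / 2)" using I(2) unfolding I' B_def by (simp add: mult_ac)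
  then have "2 * norm (\<Psi> z x) \<le> B / 2" by simp
  ultimately have "norm (\<Psi> z x) \<le> B" by linarith
  then show "norm (\<Psi> z x) \<le> M * (1 + 1 / \<delta>) * norm x" by (simp add: B_def)
qed

lemma integrable_kernel_R:
  "Re z \<noteq> 0 \<Longrightarrow> (\<lambda>t. axis_kernel z t *\<^sub>C R t x) integrable_on {a..b}"
  using axis_kernel_nz by (intro integrable_continuous_real continuous_on_scaleC continuous_axis_kernel continuous_R)

lemma \<Psi>_commute:
  assumes B: "bounded_linear B" and BC: "\<And>c x. B (c *\<^sub>C x) = c *\<^sub>C B x"
    and comm: "\<And>t x. B (R t x) = R t (B x)" and z: "Re z \<noteq> 0"
  shows "B (\<Psi> z x) = \<Psi> z (B x)"
proof -
  let ?k = "\<lambda>t x. axis_kernel z t *\<^sub>C R t x"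
  have lim: "pv_integral (\<lambda>t. ?k t x) ((2 * pi) *\<^sub>R \<Psi> z x)" for x
    using z by (intro \<Psi>_lim(1)[of "\<bar>Re z\<bar>"]) auto
  have "((\<lambda>r. B (integral {-r..r} (\<lambda>t. ?k t x))) \<longlongrightarrow> B ((2 * pi) *\<^sub>R \<Psi> z x)) at_top"
    by (intro bounded_linear.tendsto[OF B] lim)
  moreover have "B (integral {-r..r} (\<lambda>t. ?k t x)) = integral {-r..r} (\<lambda>t. ?k t (B x))" for r
    using integral_linear[OF integrable_kernel_R[OF z, where x=x and a="-r" and b=r] B] by (simp add: o_def comm BC)
  ultimately have "pv_integral (\<lambda>t. ?k t (B x)) ((2 * pi) *\<^sub>R B (\<Psi> z x))"
    by (simp add: linear_simps(5)[OF B])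
  then have "(2 * pi) *\<^sub>R B (\<Psi> z x) = (2 * pi) *\<^sub>R \<Psi> z (B x)"
    using lim tendsto_unique[OF trivial_limit_at_top_linorder] by blast
  then show ?thesis by simp
qed

lemma Q_\<Psi>: "Re z \<noteq> 0 \<Longrightarrow> Q (\<Psi> z x) = \<Psi> z (Q x)"
  by (intro \<Psi>_commute bounded_linear_Q Q_scaleC Q_R)

text \<open>Since \<open>(S - z) R t x = x + (\<i> t - z) R t x\<close>, the integrand of \<open>(S - z) \<Psi> z x\<close>
  is the sum of the scalar kernel, whose principal value is \<open>\<plusminus>\<pi>\<close>, and of the resolvent
  itself. The operator is pulled out of the integral in the form of the bounded operator
  \<open>R 0\<close>, its inverse.\<close>

lemma \<Psi>_solves:
  assumes z: "Re z \<noteq> 0"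
  shows "\<Psi> z x \<in> Dom S"
    and "App S (\<Psi> z x) - z *\<^sub>C \<Psi> z x = (1/2) *\<^sub>R (Q x - sgn (Re z) *\<^sub>R x)"
proof -
  let ?k = "axis_kernel z"
  have lim: "pv_integral (\<lambda>t. ?k t *\<^sub>C R t x) ((2 * pi) *\<^sub>R \<Psi> z x)"
    using z by (intro \<Psi>_lim(1)[of "\<bar>Re z\<bar>"]) auto
  have blx: "bounded_linear (\<lambda>c. c *\<^sub>C x)"
    by (rule bounded_bilinear.bounded_linear_left[OF bounded_bilinear_scaleC])
  have ik: "?k integrable_on {-r..r}" for r
    by (intro integrable_continuous_real continuous_axis_kernel z)
  have ikx: "(\<lambda>t. ?k t *\<^sub>C x) integrable_on {-r..r}" for r
    using integrable_linear[OF ik blx, of r] by (simp add: o_def)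
  have izk: "(\<lambda>t. z *\<^sub>C (?k t *\<^sub>C R t x)) integrable_on {-r..r}" for r
    using integrable_linear[OF integrable_kernel_R[OF z, where x=x and a="-r" and b=r] bounded_linear_scaleC[of z]] by (simp add: o_def)
  have eq: "integral {-r..r} (\<lambda>t. ?k t *\<^sub>C R t x) =
      R 0 ((integral {-r..r} ?k) *\<^sub>C x + integral {-r..r} (\<lambda>t. R t x) + z *\<^sub>C integral {-r..r} (\<lambda>t. ?k t *\<^sub>C R t x))" for r
  proof -
    have pt: "?k t *\<^sub>C R t x = R 0 (?k t *\<^sub>C x + R t x + z *\<^sub>C (?k t *\<^sub>C R t x))" for t
    proof -
      have "R t x = R 0 x + iax t *\<^sub>C R 0 (R t x)"
        using resolvent_identity[of t x 0] R_commute[of t 0 x] by (simp add: algebra_simps)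
      then have "R t x = R 0 (x + iax t *\<^sub>C R t x)" by (simp add: R_add R_scaleC)
      then have "?k t *\<^sub>C R t x = R 0 (?k t *\<^sub>C x + (?k t * (iax t)) *\<^sub>C R t x)"
        by (metis R_scaleC scaleC_add_right scaleC_scaleC)
      also have "?k t * (iax t) = 1 + z * ?k t"
        using axis_kernel_nz[OF z, of t] by (simp add: field_simps)
      finally have "?k t *\<^sub>C R t x = R 0 (?k t *\<^sub>C x + (1 + z * ?k t) *\<^sub>C R t x)" .
      moreover have "(1 + z * ?k t) *\<^sub>C R t x = R t x + z *\<^sub>C (?k t *\<^sub>C R t x)"
        by (simp add: scaleC_add_left scaleC_scaleC)
      ultimately show ?thesis by (simp only: add.assoc)
    qed
    have "integral {-r..r} (\<lambda>t. ?k t *\<^sub>C R t x) =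
        integral {-r..r} (R 0 \<circ> (\<lambda>t. ?k t *\<^sub>C x + R t x + z *\<^sub>C (?k t *\<^sub>C R t x)))"
      unfolding o_def by (subst pt) (rule refl)
    also have "\<dots> = R 0 (integral {-r..r} (\<lambda>t. ?k t *\<^sub>C x + R t x + z *\<^sub>C (?k t *\<^sub>C R t x)))"
      by (rule integral_linear[OF integrable_add[OF integrable_add[OF ikx integrable_R] izk] bounded_linear_R])
    also have "integral {-r..r} (\<lambda>t. ?k t *\<^sub>C x + R t x + z *\<^sub>C (?k t *\<^sub>C R t x)) =
        integral {-r..r} (\<lambda>t. ?k t *\<^sub>C x) + integral {-r..r} (\<lambda>t. R t x) + integral {-r..r} (\<lambda>t. z *\<^sub>C (?k t *\<^sub>C R t x))"
      unfolding Henstock_Kurzweil_Integration.integral_add[OF integrable_add[OF ikx integrable_R] izk]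
        Henstock_Kurzweil_Integration.integral_add[OF ikx integrable_R] ..
    also have "integral {-r..r} (\<lambda>t. ?k t *\<^sub>C x) = (integral {-r..r} ?k) *\<^sub>C x"
      using integral_linear[OF ik blx, of r] by (simp add: o_def)
    also have "integral {-r..r} (\<lambda>t. z *\<^sub>C (?k t *\<^sub>C R t x)) = z *\<^sub>C integral {-r..r} (\<lambda>t. ?k t *\<^sub>C R t x)"
      using integral_linear[OF integrable_kernel_R[OF z, where x=x and a="-r" and b=r] bounded_linear_scaleC[of z]] by (simp add: o_def)
    finally show ?thesis .
  qed
  have "pv_integral (\<lambda>t. ?k t *\<^sub>C R t x) (R 0 (complex_of_real (- sgn (Re z) * pi) *\<^sub>C x + pi *\<^sub>R Q x + z *\<^sub>C ((2 * pi) *\<^sub>R \<Psi> z x)))"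
    by (subst eq) (intro bounded_linear.tendsto[OF bounded_linear_R] tendsto_add tendsto_scaleC
        tendsto_const pv_axis_kernel[OF z] Q_lim lim)
  from tendsto_unique[OF trivial_limit_at_top_linorder lim this]
  have "(2 * pi) *\<^sub>R \<Psi> z x = R 0 ((2 * pi) *\<^sub>R ((1/2) *\<^sub>R (Q x - sgn (Re z) *\<^sub>R x) + z *\<^sub>C \<Psi> z x))"
    by (simp add: scaleR_scaleC scaleC_scaleC cvs.scale_right_diff_distrib scaleC_add_right algebra_simps)
  then have R0: "\<Psi> z x = R 0 ((1/2) *\<^sub>R (Q x - sgn (Re z) *\<^sub>R x) + z *\<^sub>C \<Psi> z x)"
    by (simp add: linear_simps(5)[OF bounded_linear_R])
  then show "\<Psi> z x \<in> Dom S" using R_Dom by metis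
  have "App S (\<Psi> z x) = (1/2) *\<^sub>R (Q x - sgn (Re z) *\<^sub>R x) + z *\<^sub>C \<Psi> z x"
    using S_R[of 0 "(1/2) *\<^sub>R (Q x - sgn (Re z) *\<^sub>R x) + z *\<^sub>C \<Psi> z x"] unfolding R0[symmetric] by simp
  then show "App S (\<Psi> z x) - z *\<^sub>C \<Psi> z x = (1/2) *\<^sub>R (Q x - sgn (Re z) *\<^sub>R x)" by simp
qed

end

lemma half_sum_half_diff:
  fixes x y :: "'a::real_vector"
  shows "(1/2) *\<^sub>R (x + y) + (1/2) *\<^sub>R (x - y) = x" and "(1/2) *\<^sub>R (x + y) - (1/2) *\<^sub>R (x - y) = y"
  by (simp_all flip: scaleR_add_right scaleR_diff_right)

context axis_dichotomy
begin

text \<open>The kernel \<open>k\<^sub>z = 1 / (\<i> t - z)\<close> satisfies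
  \<open>k\<^sub>z = k\<^sub>w + (z - w) k\<^sub>w\<^sup>2 + (z - w)\<^sup>2 k\<^sub>w\<^sup>2 k\<^sub>z\<close>; integrated against the resolvent, the last term is the
  quadratic error of the derivative.\<close>

lemma \<Psi>_has_field_derivative:
  assumes w: "Re w \<noteq> 0"
  shows "\<exists>d. ((\<lambda>z. cinner (\<Psi> z x) y) has_field_derivative d) (at w)"
proof -
  define k where "k z t = axis_kernel z t" for z t
  define \<delta> where "\<delta> = \<bar>Re w\<bar> / 2"
  have \<delta>: "0 < \<delta>" "\<delta> \<le> \<bar>Re w\<bar>" using w by (simp_all add: \<delta>_def)
  have near: "\<delta> \<le> \<bar>Re z\<bar>" if "cmod (z - w) < \<delta>" for z
    using abs_Re_le_cmod[of "z - w"] that by (simp add: \<delta>_def)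
  have kw: "cmod (k w t) \<le> 1 / \<delta>" for t unfolding k_def by (rule norm_axis_kernel(2)[OF \<delta>])
  have contk: "continuous_on UNIV (k w)" unfolding k_def by (rule continuous_axis_kernel[OF w])
  define b where "b = (1 / \<delta>) * (1 / \<delta>)"
  have kw2: "cmod (k w t * k w t) \<le> b" for t
    using mult_mono[OF kw kw, of t t] \<delta> by (simp add: norm_mult b_def)
  obtain D where D: "pv_integral (\<lambda>t. (k w t * k w t) *\<^sub>C R t x) D"
    using kernel_integral_convergent[OF contk kw \<delta>] unfolding k_def by blast
  define B where "B = b * M * (pi / 2) * (1 + 1 / \<delta>) * norm x"
  define d where "d = cinner ((1 / (2 * pi)) *\<^sub>R D) y"
  have "((\<lambda>z. cinner (\<Psi> z x) y) has_field_derivative d) (at w)"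
  proof (rule has_field_derivative_if_quadratic_error[OF \<delta>(1)])
    fix z assume z: "cmod (z - w) < \<delta>"
    have z\<delta>: "\<delta> \<le> \<bar>Re z\<bar>" by (rule near[OF z])
    then have z0: "Re z \<noteq> 0" using \<delta> by auto
    obtain I where I: "pv_integral (\<lambda>t. (k w t * k w t * k z t) *\<^sub>C R t x) I"
      and nI: "norm I \<le> B"
      using kernel_integral_convergent[OF continuous_on_mult[OF contk contk] kw2 \<delta>(1) z\<delta>] unfolding k_def B_def by blast
    have contz: "continuous_on UNIV (k z)" unfolding k_def by (rule continuous_axis_kernel[OF z0])
    have int: "(\<lambda>t. c *\<^sub>C (f t *\<^sub>C R t x)) integrable_on {-r..r}" if "continuous_on UNIV f" for f c r
      by (intro integrable_continuous_real continuous_on_scaleC continuous_on_const continuous_R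
          continuous_on_subset[OF that]) auto
    have lin: "integral {-r..r} (\<lambda>t. c *\<^sub>C (f t *\<^sub>C R t x)) = c *\<^sub>C integral {-r..r} (\<lambda>t. f t *\<^sub>C R t x)"
      if "continuous_on UNIV f" for f c r
      using integral_linear[OF int[OF that, of 1] bounded_linear_scaleC[of c]] by (simp add: o_def)
    have kern: "k z t = k w t + (z - w) * (k w t * k w t) + (z - w)\<^sup>2 * (k w t * k w t * k z t)" for t
    proof -
      have p: "(iax t - z) * k z t = 1" "(iax t - w) * k w t = 1"
        unfolding k_def using axis_kernel_nz[OF z0, of t] axis_kernel_nz[OF w, of t] by simp_all
      have step: "k z t - k w t = (z - w) * (k w t * k z t)"
      proof -
        have "(z - w) * (k w t * k z t) = ((iax t - w) * k w t) * k z t - ((iax t - z) * k z t) * k w t"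
          by (simp add: algebra_simps)
        then show ?thesis unfolding p by simp
      qed
      have "(z - w) * (k w t * k z t) - (z - w) * (k w t * k w t) = (z - w) * k w t * (k z t - k w t)"
        by (simp add: algebra_simps)
      also have "\<dots> = (z - w)\<^sup>2 * (k w t * k w t * k z t)" unfolding step by (simp add: power2_eq_square)
      finally have s2: "(z - w) * (k w t * k z t) = (z - w) * (k w t * k w t) + (z - w)\<^sup>2 * (k w t * k w t * k z t)"
        by (simp only: diff_eq_eq add.commute)
      have s1: "k z t = k w t + (z - w) * (k w t * k z t)" using step by (simp only: diff_eq_eq add.commute)
      show ?thesis by (subst s1, subst s2) (simp only: add.assoc)
    qed
    have c2: "continuous_on UNIV (\<lambda>t. k w t * k w t)" and c3: "continuous_on UNIV (\<lambda>t. k w t * k w t * k z t)"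
      by (intro continuous_on_mult contk contz)+
    have eq: "integral {-r..r} (\<lambda>t. k z t *\<^sub>C R t x) =
        integral {-r..r} (\<lambda>t. k w t *\<^sub>C R t x) + (z - w) *\<^sub>C integral {-r..r} (\<lambda>t. (k w t * k w t) *\<^sub>C R t x) +
        (z - w)\<^sup>2 *\<^sub>C integral {-r..r} (\<lambda>t. (k w t * k w t * k z t) *\<^sub>C R t x)" for r
    proof -
      have "k z t *\<^sub>C R t x = 1 *\<^sub>C (k w t *\<^sub>C R t x) + (z - w) *\<^sub>C ((k w t * k w t) *\<^sub>C R t x) +
          (z - w)\<^sup>2 *\<^sub>C ((k w t * k w t * k z t) *\<^sub>C R t x)" for t
        by (subst kern) (simp add: scaleC_add_left scaleC_scaleC)
      then have "integral {-r..r} (\<lambda>t. k z t *\<^sub>C R t x) =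
          integral {-r..r} (\<lambda>t. 1 *\<^sub>C (k w t *\<^sub>C R t x) + (z - w) *\<^sub>C ((k w t * k w t) *\<^sub>C R t x) +
          (z - w)\<^sup>2 *\<^sub>C ((k w t * k w t * k z t) *\<^sub>C R t x))" by presburger
      also have "\<dots> = integral {-r..r} (\<lambda>t. 1 *\<^sub>C (k w t *\<^sub>C R t x)) + integral {-r..r} (\<lambda>t. (z - w) *\<^sub>C ((k w t * k w t) *\<^sub>C R t x)) +
          integral {-r..r} (\<lambda>t. (z - w)\<^sup>2 *\<^sub>C ((k w t * k w t * k z t) *\<^sub>C R t x))"
        unfolding Henstock_Kurzweil_Integration.integral_add[OF integrable_add[OF int[OF contk] int[OF c2]] int[OF c3]]
          Henstock_Kurzweil_Integration.integral_add[OF int[OF contk] int[OF c2]] ..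
      finally show ?thesis unfolding lin[OF contk] lin[OF c2] lin[OF c3] by simp
    qed
    have limz: "pv_integral (\<lambda>t. k z t *\<^sub>C R t x) ((2 * pi) *\<^sub>R \<Psi> z x)"
      unfolding k_def by (rule \<Psi>_lim(1)[OF \<delta>(1) z\<delta>])
    have limw: "pv_integral (\<lambda>t. k w t *\<^sub>C R t x) ((2 * pi) *\<^sub>R \<Psi> w x)"
      unfolding k_def by (rule \<Psi>_lim(1)[OF \<delta>])
    have "pv_integral (\<lambda>t. k z t *\<^sub>C R t x) ((2 * pi) *\<^sub>R \<Psi> w x + (z - w) *\<^sub>C D + (z - w)\<^sup>2 *\<^sub>C I)"
      unfolding eq by (intro tendsto_add tendsto_scaleC tendsto_const limw D I)
    from tendsto_unique[OF trivial_limit_at_top_linorder limz this]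
    have main: "(2 * pi) *\<^sub>R \<Psi> z x = (2 * pi) *\<^sub>R \<Psi> w x + (z - w) *\<^sub>C D + (z - w)\<^sup>2 *\<^sub>C I" .
    define c where "c = complex_of_real (1 / (2 * pi))"
    have \<Psi>c: "\<Psi> v x = c *\<^sub>C ((2 * pi) *\<^sub>R \<Psi> v x)" for v by (simp add: c_def scaleR_scaleC scaleC_scaleC)
    have "\<Psi> z x = \<Psi> w x + (z - w) *\<^sub>C (c *\<^sub>C D) + ((z - w)\<^sup>2 * c) *\<^sub>C I"
      by (subst \<Psi>c[of z], subst main, subst (2) \<Psi>c[of w]) (simp add: scaleC_add_right scaleC_scaleC mult.commute)
    then have "cinner (\<Psi> z x) y - cinner (\<Psi> w x) y - (z - w) * cinner (c *\<^sub>C D) y = (z - w)\<^sup>2 * c * cinner I y"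
      by (simp add: cinner_add_left cinner_scaleC_left)
    moreover have "d = cinner (c *\<^sub>C D) y" by (simp add: d_def c_def scaleR_scaleC)
    ultimately have "cmod (cinner (\<Psi> z x) y - cinner (\<Psi> w x) y - (z - w) * d) = (cmod (z - w))\<^sup>2 * cmod c * cmod (cinner I y)"
      by (simp add: norm_mult norm_power)
    also have "\<dots> \<le> (cmod (z - w))\<^sup>2 * cmod c * (B * norm y)"
      using nI by (intro mult_left_mono order_trans[OF cinner_cauchy_schwarz] mult_right_mono) auto
    finally show "cmod (cinner (\<Psi> z x) y - cinner (\<Psi> w x) y - (z - w) * d) \<le> (cmod c * (B * norm y)) * (cmod (z - w))\<^sup>2"
      by (simp add: mult_ac)
  qed
  then show ?thesis by blast
qed

lemma resolvent_has_field_derivative: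
  assumes w: "\<bar>Re w\<bar> * M < 1"
  shows "\<exists>d. ((\<lambda>z. cinner (resolvent S z x) y) has_field_derivative d) (at w)"
proof -
  define q where "q = (1 + \<bar>Re w\<bar> * M) / 2"
  define \<delta> where "\<delta> = (1 - \<bar>Re w\<bar> * M) / (2 * M)"
  define b where "b = M / (1 - q)"
  have "(1 + m) / 2 < 1 \<and> m \<le> (1 + m) / 2" if "m < 1" for m :: real using that by simp
  from this[OF w] have q: "q < 1" "\<bar>Re w\<bar> * M \<le> q" by (simp_all only: q_def)
  have \<delta>: "0 < \<delta>" using w M_pos by (simp add: \<delta>_def)
  have b: "0 < b" using q M_pos by (simp add: b_def)
  have near: "\<bar>Re z\<bar> * M \<le> q" if "cmod (z - w) < \<delta>" for z
  proof -
    have "\<bar>Re z\<bar> \<le> \<bar>Re w\<bar> + \<delta>" using abs_Re_le_cmod[of "z - w"] that by simp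
    then have "\<bar>Re z\<bar> * M \<le> (\<bar>Re w\<bar> + \<delta>) * M" using M_pos by (intro mult_right_mono) auto
    also have "\<dots> = q" using M_pos by (simp add: \<delta>_def q_def field_simps)
    finally show ?thesis .
  qed
  have rb: "z \<in> resolvent_set UNIV S" "norm (resolvent S z f) \<le> b * norm f" if "\<bar>Re z\<bar> * M \<le> q" for z f
  proof -
    have z: "\<bar>Re z\<bar> * M < 1" using that q by simp
    show "z \<in> resolvent_set UNIV S" by (rule resolvent_strip(1)[OF z])
    have "M / (1 - \<bar>Re z\<bar> * M) \<le> b" unfolding b_def using that q M_pos z by (intro divide_left_mono) auto
    then show "norm (resolvent S z f) \<le> b * norm f"
      using resolvent_strip(2)[OF z, of f] mult_right_mono[of _ b "norm f"] by fastforce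
  qed
  define u where "u = resolvent S w x"
  define v where "v = resolvent S w u"
  have "((\<lambda>z. cinner (resolvent S z x) y) has_field_derivative cinner v y) (at w)"
  proof (rule has_field_derivative_if_quadratic_error[OF \<delta>])
    fix z assume z: "cmod (z - w) < \<delta>"
    note idy = resolvent_identity_on[OF linear_S subset_UNIV cvs.subspace_UNIV rb(1)[OF near[OF z]] rb(1)[OF q(2)] UNIV_I]
    have "resolvent S z x - u = (z - w) *\<^sub>C resolvent S z u" unfolding u_def by (rule idy)
    then have a: "resolvent S z x = u + (z - w) *\<^sub>C resolvent S z u" by (simp only: diff_eq_eq add.commute)
    have "resolvent S z u - v = (z - w) *\<^sub>C resolvent S z v" unfolding v_def by (rule idy)
    then have b: "resolvent S z u = v + (z - w) *\<^sub>C resolvent S z v" by (simp only: diff_eq_eq add.commute)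
    have c: "resolvent S z x = u + (z - w) *\<^sub>C (v + (z - w) *\<^sub>C resolvent S z v)"
      by (simp only: a b)
    have "cinner (resolvent S z x) y - cinner (resolvent S w x) y - (z - w) * cinner v y = (z - w)\<^sup>2 * cinner (resolvent S z v) y"
      unfolding u_def[symmetric] c cinner_add_left cinner_scaleC_left by (simp add: power2_eq_square algebra_simps)
    then have "cmod (cinner (resolvent S z x) y - cinner (resolvent S w x) y - (z - w) * cinner v y) =
        (cmod (z - w))\<^sup>2 * cmod (cinner (resolvent S z v) y)"
      by (simp add: norm_mult norm_power)
    also have "\<dots> \<le> (cmod (z - w))\<^sup>2 * ((b * norm v) * norm y)"
      by (intro mult_left_mono order_trans[OF cinner_cauchy_schwarz] mult_right_mono rb(2) near z) auto
    finally show "cmod (cinner (resolvent S z x) y - cinner (resolvent S w x) y - (z - w) * cinner v y) \<le>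
        ((b * norm v) * norm y) * (cmod (z - w))\<^sup>2"
      by (simp add: mult_ac)
  qed
  then show ?thesis by blast
qed

text \<open>With \<open>P\<^sub>\<plusminus> = (1 \<plusminus> Q) / 2\<close> and \<open>N = P\<^sub>+ P\<^sub>-\<close>, the equation \<open>(S - z) u = N x\<close> has a solution
  for every \<^term>\<open>z\<close>: \<open>\<Psi> z (P\<^sub>- x)\<close> in the left and \<open>- \<Psi> z (P\<^sub>+ x)\<close> in the right
  half-plane, and the resolvent at \<open>N x\<close> in a strip around the imaginary axis. These solutions
  agree where they overlap and are bounded, so they form a constant by Liouville's theorem, which
  is \<open>0\<close> because of the decay along the axis. Hence \<open>N = 0\<close>.\<close>

lemma Q_involution: "Q (Q x) = x"
proof -
  have Qs: "Q (u - v) = Q u - Q v" "Q (c *\<^sub>R u) = c *\<^sub>R Q u" for u v c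
    using linear_simps(2,5)[OF bounded_linear_Q] by auto
  define n where "n = (1/4) *\<^sub>R (x - Q (Q x))"
  define a where "a = (1/2) *\<^sub>R (x - Q x)"
  define b where "b = (1/2) *\<^sub>R (x + Q x)"
  have left: "\<Psi> z a \<in> Dom S" "App S (\<Psi> z a) - z *\<^sub>C \<Psi> z a = n" if "Re z < 0" for z
  proof -
    have "Q a + a = (1/2) *\<^sub>R (x - Q (Q x))"
      by (simp add: a_def Qs scaleR_add_right[symmetric])
    then show "App S (\<Psi> z a) - z *\<^sub>C \<Psi> z a = n"
      using \<Psi>_solves(2)[of z a] that by (simp add: n_def)
    show "\<Psi> z a \<in> Dom S" using \<Psi>_solves(1)[of z a] that by simp
  qed
  have right: "- \<Psi> z b \<in> Dom S" "App S (- \<Psi> z b) - z *\<^sub>C (- \<Psi> z b) = n" if "Re z > 0" for z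
  proof -
    have D: "\<Psi> z b \<in> Dom S" using \<Psi>_solves(1)[of z b] that by simp
    have "Q b - b = - ((1/2) *\<^sub>R (x - Q (Q x)))"
      by (simp add: b_def Qs Q_add scaleR_add_right scaleR_diff_right)
    then have "App S (\<Psi> z b) - z *\<^sub>C \<Psi> z b = - n"
      using \<Psi>_solves(2)[of z b] that by (simp add: n_def)
    moreover have "App S (- \<Psi> z b) = - App S (\<Psi> z b)" using linear_opD(3)[OF linear_S D, of "-1"] by simp
    ultimately show "App S (- \<Psi> z b) - z *\<^sub>C (- \<Psi> z b) = n" by (simp add: algebra_simps)
    show "- \<Psi> z b \<in> Dom S" by (rule cvs.subspace_neg[OF subspace_Dom D])
  qed
  define E where "E z = (if \<bar>Re z\<bar> * M < 1 then resolvent S z n else if Re z < 0 then \<Psi> z a else - \<Psi> z b)" for z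
  have E_left: "E z = \<Psi> z a" if "Re z < 0" for z
    using resolvent_setD(4)[OF resolvent_strip(1) left(1)[OF that], of z] left(2)[OF that] that by (auto simp: E_def)
  have E_right: "E z = - \<Psi> z b" if "Re z > 0" for z
    using resolvent_setD(4)[OF resolvent_strip(1) right(1)[OF that], of z] right(2)[OF that] that by (auto simp: E_def)
  have "cinner (R 0 n) y = 0" for y
  proof -
    define e where "e z = cinner (E z) y" for z
    have left_hol: "e holomorphic_on {z. Re z < 0}"
    proof (rule holomorphic_transform)
      show "(\<lambda>z. cinner (\<Psi> z a) y) holomorphic_on {z. Re z < 0}"
        using \<Psi>_has_field_derivative by (subst holomorphic_on_open) (auto simp: open_halfspace_Re_lt)
    qed (simp add: e_def E_left)
    have right_hol: "e holomorphic_on {z. Re z > 0}"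
    proof (rule holomorphic_transform)
      have "(\<lambda>z. cinner (\<Psi> z b) y) holomorphic_on {z. Re z > 0}"
        using \<Psi>_has_field_derivative by (subst holomorphic_on_open) (auto simp: open_halfspace_Re_gt)
      then show "(\<lambda>z. - cinner (\<Psi> z b) y) holomorphic_on {z. Re z > 0}" by (rule holomorphic_on_minus)
    qed (simp add: e_def E_right cinner_minus_left)
    have open_strip: "open {z. \<bar>Re z\<bar> * M < 1}"
      by (intro open_Collect_less continuous_intros)
    have strip_hol: "e holomorphic_on {z. \<bar>Re z\<bar> * M < 1}"
    proof (rule holomorphic_transform)
      show "(\<lambda>z. cinner (resolvent S z n) y) holomorphic_on {z. \<bar>Re z\<bar> * M < 1}"
        using resolvent_has_field_derivative open_strip by (subst holomorphic_on_open) auto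
    qed (simp add: e_def E_def)
    have "e holomorphic_on ({z. Re z < 0} \<union> {z. Re z > 0} \<union> {z. \<bar>Re z\<bar> * M < 1})"
      by (intro holomorphic_on_Un left_hol right_hol strip_hol open_Un open_strip open_halfspace_Re_lt open_halfspace_Re_gt)
    moreover have "{z. Re z < 0} \<union> {z. Re z > 0} \<union> {z. \<bar>Re z\<bar> * M < 1} = UNIV"
    proof -
      have "z \<in> {z. Re z < 0} \<union> {z. Re z > 0} \<union> {z. \<bar>Re z\<bar> * M < 1}" for z
        by (rule linorder_cases[of "Re z" 0]) auto
      then show ?thesis by (rule UNIV_eq_I[symmetric])
    qed
    ultimately have hol: "e holomorphic_on UNIV" by simp
    \<comment> \<open>half the width of the strip, so that both bounds below are uniform\<close>
    define \<delta> where "\<delta> = 1 / (2 * M)"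
    have \<delta>: "0 < \<delta>" using M_pos by (simp add: \<delta>_def)
    define B where "B = 2 * M * norm n + M * (1 + 1 / \<delta>) * norm a + M * (1 + 1 / \<delta>) * norm b"
    have "norm (E z) \<le> B" for z
    proof (cases "\<delta> \<le> \<bar>Re z\<bar>")
      case True
      consider "Re z < 0" | "Re z > 0" using True \<delta> by fastforce
      then have "norm (E z) \<le> M * (1 + 1 / \<delta>) * norm a + M * (1 + 1 / \<delta>) * norm b"
      proof cases
        case 1
        have "0 \<le> M * (1 + 1 / \<delta>) * norm b" using M_pos \<delta> by simp
        then show ?thesis using \<Psi>_lim(2)[OF \<delta> True, of a] unfolding E_left[OF 1] by linarith
      next
        case 2
        have "0 \<le> M * (1 + 1 / \<delta>) * norm a" using M_pos \<delta> by simp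
        then show ?thesis using \<Psi>_lim(2)[OF \<delta> True, of b] unfolding E_right[OF 2] norm_minus_cancel by linarith
      qed
      moreover have "0 \<le> 2 * M * norm n" using M_pos by simp
      ultimately show ?thesis unfolding B_def by linarith
    next
      case False
      then have half: "\<bar>Re z\<bar> * M < 1 / 2" using M_pos by (simp add: \<delta>_def field_simps)
      then have "M / (1 - \<bar>Re z\<bar> * M) \<le> M / (1 / 2)" using M_pos by (intro divide_left_mono) auto
      then have "M / (1 - \<bar>Re z\<bar> * M) * norm n \<le> 2 * M * norm n" by (intro mult_right_mono) auto
      moreover have "norm (E z) \<le> M / (1 - \<bar>Re z\<bar> * M) * norm n"
        using resolvent_strip(2)[of z n] half by (simp add: E_def)
      moreover have "0 \<le> M * (1 + 1 / \<delta>) * norm a" "0 \<le> M * (1 + 1 / \<delta>) * norm b" using M_pos \<delta> by simp_all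
      ultimately show ?thesis unfolding B_def by linarith
    qed
    then have "cmod (e z) \<le> B * norm y" for z
      unfolding e_def using order_trans[OF cinner_cauchy_schwarz mult_right_mono] by (metis norm_ge_zero)
    then have "bounded (range e)" by (auto simp: bounded_iff)
    with hol obtain c where c: "\<And>z. e z = c" using Liouville_theorem by (auto simp: constant_on_def)
    have axis: "E (iax t) = R t n" for t by (simp add: E_def resolvent_R)
    define k where "k = M * norm n * norm y"
    have k0: "0 \<le> k" using M_pos by (simp add: k_def)
    have decay: "cmod c * (1 + t) \<le> k" if "0 \<le> t" for t :: real
    proof -
      have "cmod c = cmod (cinner (R t n) y)" using c[of "iax t"] by (simp add: e_def axis)
      also have "\<dots> \<le> norm (R t n) * norm y" by (rule cinner_cauchy_schwarz)
      also have "\<dots> \<le> (M / (1 + t) * norm n) * norm y" using norm_R[of t n] that by (intro mult_right_mono) auto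
      finally show ?thesis using that by (simp add: k_def field_simps)
    qed
    have "c = 0"
    proof (rule ccontr)
      assume "c \<noteq> 0"
      then have "cmod c * (1 + k / cmod c) = cmod c + k" by (simp add: distrib_left)
      with decay[of "k / cmod c"] k0 \<open>c \<noteq> 0\<close> show False by simp
    qed
    then show ?thesis using c[of "iax 0"] axis[of 0] by (simp add: e_def)
  qed
  then have "R 0 n = 0" using cinner_eq_zero_iff by blast
  then have "n = 0" using S_R[of 0 n] by (simp add: linear_opD(5)[OF linear_S])
  then show ?thesis by (simp add: n_def)
qed

definition V :: "real \<Rightarrow> 'h set" where
  "V s = {x. Q x = s *\<^sub>R x}"

lemma csubspace_V: "csubspace (V s)"
  by (rule cvs.subspaceI)
     (auto simp: V_def Q_add Q_scaleC scaleR_scaleC scaleC_add_right scaleC_scaleC mult.commute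
        linear_simps(3)[OF bounded_linear_Q])

lemma closed_V: "closed (V s)"
  unfolding V_def by (intro closed_Collect_eq continuous_intros linear_continuous_on bounded_linear_Q)

lemma proj_in_V: "(1/2) *\<^sub>R (x + Q x) \<in> V 1" "(1/2) *\<^sub>R (x - Q x) \<in> V (-1)"
  unfolding V_def
  by (simp_all add: linear_simps(1,2,5)[OF bounded_linear_Q] Q_involution scaleR_add_right scaleR_diff_right)

lemma complementary_V: "complementary (V 1) (V (-1))"
proof -
  have "x = 0" if "x \<in> V 1 \<inter> V (-1)" for x
  proof -
    have "x \<in> V 1" "x \<in> V (-1)" using that by blast+
    then have "1 *\<^sub>R x = (-1) *\<^sub>R x" unfolding V_def mem_Collect_eq by (rule trans[OF sym])
    then have "x = - x" by (simp only: scaleR_one scaleR_minus1_left)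
    then have "x + x = 0" by (simp only: eq_neg_iff_add_eq_0)
    then have "2 *\<^sub>R x = 0" by (simp only: scaleR_2)
    then show ?thesis by simp
  qed
  moreover have "0 \<in> V 1 \<inter> V (-1)" using cvs.subspace_0[OF csubspace_V] by blast
  ultimately have "V 1 \<inter> V (-1) = {0}" by blast
  moreover have "{v + w |v w. v \<in> V 1 \<and> w \<in> V (-1)} = UNIV"
  proof (rule UNIV_eq_I[symmetric])
    fix x
    show "x \<in> {v + w |v w. v \<in> V 1 \<and> w \<in> V (-1)}"
      using half_sum_half_diff(1)[of x "Q x", symmetric] proj_in_V[of x]
      unfolding mem_Collect_eq by (intro exI[of _ "(1/2) *\<^sub>R (x + Q x)"] exI[of _ "(1/2) *\<^sub>R (x - Q x)"] conjI)
  qed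
  ultimately show ?thesis unfolding complementary_def by (intro conjI csubspace_V closed_V)
qed

lemma proj_along_V:
  "proj_along (V 1) (V (-1)) x = (1/2) *\<^sub>R (x + Q x)" "proj_along (V (-1)) (V 1) x = (1/2) *\<^sub>R (x - Q x)"
proof -
  have d: "x - (1/2) *\<^sub>R (x + Q x) = (1/2) *\<^sub>R (x - Q x)" "x - (1/2) *\<^sub>R (x - Q x) = (1/2) *\<^sub>R (x + Q x)"
    using half_sum_half_diff(1)[of x "Q x"] by (simp_all only: diff_eq_eq add.commute)
  have Qd: "Q (x - v) = Q x - Q v" for v by (rule linear_simps(2)[OF bounded_linear_Q])
  show "proj_along (V 1) (V (-1)) x = (1/2) *\<^sub>R (x + Q x)"
    unfolding proj_along_def
  proof (rule the_equality)
    show "(1/2) *\<^sub>R (x + Q x) \<in> V 1 \<and> x - (1/2) *\<^sub>R (x + Q x) \<in> V (-1)" unfolding d using proj_in_V by blast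
    fix v assume "v \<in> V 1 \<and> x - v \<in> V (-1)"
    then have "x + Q x = 2 *\<^sub>R v" by (auto simp: V_def Qd scaleR_2 algebra_simps)
    then show "v = (1/2) *\<^sub>R (x + Q x)" by simp
  qed
  show "proj_along (V (-1)) (V 1) x = (1/2) *\<^sub>R (x - Q x)"
    unfolding proj_along_def
  proof (rule the_equality)
    show "(1/2) *\<^sub>R (x - Q x) \<in> V (-1) \<and> x - (1/2) *\<^sub>R (x - Q x) \<in> V 1" unfolding d using proj_in_V by blast
    fix v assume "v \<in> V (-1) \<and> x - v \<in> V 1"
    then have "x - Q x = 2 *\<^sub>R v" by (auto simp: V_def Qd scaleR_2 algebra_simps)
    then show "v = (1/2) *\<^sub>R (x - Q x)" by simp
  qed
qed

lemma V_invariant: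
  assumes x: "x \<in> Dom S" "x \<in> V s"
  shows "App S x \<in> V s"
proof -
  have "Q (App S x) = App S (s *\<^sub>R x)" using Q_Dom(2)[OF x(1)] x(2) by (simp add: V_def)
  also have "\<dots> = s *\<^sub>R App S x" by (simp add: scaleR_scaleC linear_opD(3)[OF linear_S x(1)])
  finally show ?thesis by (simp add: V_def)
qed

text \<open>Off the axis, on \<^term>\<open>V s\<close> the right-hand side in the equation for \<^term>\<open>\<Psi> z y\<close> reduces to
  \<^term>\<open>s *\<^sub>R y\<close>, so \<^term>\<open>\<lambda>y. s *\<^sub>R \<Psi> z y\<close> is a right inverse; it is a left inverse because
  \<^term>\<open>V s\<close> contains no eigenvector to \<^term>\<open>z\<close>.\<close>

lemma resolvent_set_V:
  assumes s: "s = 1 \<or> s = -1" and z: "s * Re z \<le> 0"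
  shows "z \<in> resolvent_set (V s) (restrict_op S (V s))"
proof -
  have inV: "App S u - z *\<^sub>C u \<in> V s" if "u \<in> Dom S \<inter> V s" for u
    using that by (intro cvs.subspace_diff cvs.subspace_scale csubspace_V V_invariant) auto
  show ?thesis
  proof (cases "Re z = 0")
    case True
    then have zt: "z = iax (Im z)" by (simp add: complex_eq_iff)
    have RV: "R (Im z) y \<in> V s" if "y \<in> V s" for y
      using that by (simp add: V_def Q_R linear_simps(5)[OF bounded_linear_R])
    show ?thesis
    proof (rule resolvent_setI(1)[where G="R (Im z)" and c=M])
      fix y assume "y \<in> V s"
      then show "R (Im z) y \<in> Dom (restrict_op S (V s)) \<and>
          App (restrict_op S (V s)) (R (Im z) y) - z *\<^sub>C R (Im z) y = y"
        using S_R[of "Im z" y] zt R_Dom RV by (simp add: restrict_op_def)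
    next
      fix u assume "u \<in> Dom (restrict_op S (V s))"
      then have u: "u \<in> Dom S \<inter> V s" by (simp add: restrict_op_def)
      then show "App (restrict_op S (V s)) u - z *\<^sub>C u \<in> V s \<and> R (Im z) (App (restrict_op S (V s)) u - z *\<^sub>C u) = u"
        using inV[OF u] R_S[of u "Im z"] zt by (simp add: restrict_op_def)
    qed (rule norm_R_le)
  next
    case False
    then have sgn: "sgn (Re z) = - s" and ss: "s * s = 1" using s z by (auto simp: sgn_if)
    have G: "s *\<^sub>R \<Psi> z y \<in> Dom S \<inter> V s" "App S (s *\<^sub>R \<Psi> z y) - z *\<^sub>C (s *\<^sub>R \<Psi> z y) = y" if y: "y \<in> V s" for y
    proof -
      have Qy: "Q y = s *\<^sub>R y" using y by (simp add: V_def)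
      have "Q (\<Psi> z y) = s *\<^sub>R \<Psi> z y"
        unfolding Q_\<Psi>[OF False] Qy scaleR_scaleC
        by (rule \<Psi>_commute[symmetric]) (simp_all add: bounded_linear_scaleC R_scaleC scaleC_scaleC mult.commute False)
      then have "\<Psi> z y \<in> V s" by (simp add: V_def)
      then show "s *\<^sub>R \<Psi> z y \<in> Dom S \<inter> V s"
        using csubspace_scaleR[OF csubspace_V] csubspace_scaleR[OF subspace_Dom \<Psi>_solves(1)[OF False]] by blast
      have "App S (\<Psi> z y) - z *\<^sub>C \<Psi> z y = s *\<^sub>R y"
        using \<Psi>_solves(2)[OF False, of y] by (simp add: sgn Qy flip: scaleR_2)
      then have "s *\<^sub>R (App S (\<Psi> z y) - z *\<^sub>C \<Psi> z y) = y" using ss by simp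
      then show "App S (s *\<^sub>R \<Psi> z y) - z *\<^sub>C (s *\<^sub>R \<Psi> z y) = y"
        by (simp add: scaleR_scaleC linear_opD(3)[OF linear_S \<Psi>_solves(1)[OF False]] scaleC_scaleC
            cvs.scale_right_diff_distrib mult.commute)
    qed
    have inj: "d = 0" if d: "d \<in> Dom S \<inter> V s" "App S d = z *\<^sub>C d" for d
    proof -
      \<comment> \<open>On an eigenvector the resolvent is the scalar kernel, whose principal value forces the
          wrong sign of \<^term>\<open>Q d\<close>.\<close>
      let ?k = "axis_kernel z"
      have Rd: "R t d = (- ?k t) *\<^sub>C d" for t
      proof (rule R_eqI)
        show "(- ?k t) *\<^sub>C d \<in> Dom S" using d by (intro cvs.subspace_scale subspace_Dom) auto
        define k where "k = ?k t"
        have "App S ((- k) *\<^sub>C d) = (- k) *\<^sub>C (z *\<^sub>C d)"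
          using d linear_opD(3)[OF linear_S, of d "- k"] by (simp only: Int_iff)
        then have "App S ((- k) *\<^sub>C d) - iax t *\<^sub>C ((- k) *\<^sub>C d) = ((- k) * z - iax t * (- k)) *\<^sub>C d"
          unfolding cvs.scale_left_diff_distrib by (simp only: scaleC_scaleC)
        also have "(- k) * z - iax t * (- k) = k * (iax t - z)"
          by (simp add: algebra_simps)
        also have "\<dots> = 1" unfolding k_def using axis_kernel_nz[OF False, of t] by simp
        finally show "App S ((- ?k t) *\<^sub>C d) - iax t *\<^sub>C ((- ?k t) *\<^sub>C d) = d"
          unfolding k_def by simp
      qed
      have blx: "bounded_linear (\<lambda>c. (- c) *\<^sub>C d)"
        by (intro bounded_linear_compose[OF bounded_bilinear.bounded_linear_left[OF bounded_bilinear_scaleC]] bounded_linear_minus bounded_linear_ident)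
      have "integral {-r..r} (\<lambda>t. R t d) = (- integral {-r..r} ?k) *\<^sub>C d" for r
        using integral_linear[OF integrable_continuous_real[OF continuous_axis_kernel[OF False]] blx, of "-r" r]
        by (simp add: o_def Rd)
      moreover have "((\<lambda>r. (- integral {-r..r} ?k) *\<^sub>C d) \<longlongrightarrow> (- complex_of_real (- sgn (Re z) * pi)) *\<^sub>C d) at_top"
        by (intro tendsto_scaleC tendsto_minus pv_axis_kernel[OF False] tendsto_const)
      ultimately have "pv_integral (\<lambda>t. R t d) ((- complex_of_real (- sgn (Re z) * pi)) *\<^sub>C d)" by simp
      moreover have "(- complex_of_real (- sgn (Re z) * pi)) *\<^sub>C d = pi *\<^sub>R ((- s) *\<^sub>R d)"
        by (simp add: sgn scaleR_scaleC scaleC_scaleC mult.commute)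
      ultimately have "Q d = (- s) *\<^sub>R d" by (intro Q_eqI) simp
      then have "s *\<^sub>R d = (- s) *\<^sub>R d" using d by (simp add: V_def)
      then have "(s - - s) *\<^sub>R d = 0" unfolding scaleR_left_diff_distrib by (simp only: right_minus_eq)
      then show ?thesis using ss by auto
    qed
    show ?thesis
    proof (rule resolvent_setI(1)[where G="\<lambda>y. s *\<^sub>R \<Psi> z y" and c="M * (1 + 1 / \<bar>Re z\<bar>)"])
      fix y assume y: "y \<in> V s"
      show "s *\<^sub>R \<Psi> z y \<in> Dom (restrict_op S (V s)) \<and>
          App (restrict_op S (V s)) (s *\<^sub>R \<Psi> z y) - z *\<^sub>C s *\<^sub>R \<Psi> z y = y"
        using G[OF y] by (simp add: restrict_op_def)
      have "norm (s *\<^sub>R \<Psi> z y) = norm (\<Psi> z y)" using s by auto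
      also have "\<dots> \<le> M * (1 + 1 / \<bar>Re z\<bar>) * norm y" using False by (intro \<Psi>_lim(2)) auto
      finally show "norm (s *\<^sub>R \<Psi> z y) \<le> M * (1 + 1 / \<bar>Re z\<bar>) * norm y" .
    next
      fix u assume "u \<in> Dom (restrict_op S (V s))"
      then have u: "u \<in> Dom S \<inter> V s" by (simp add: restrict_op_def)
      define f where "f = App S u - z *\<^sub>C u"
      have f: "f \<in> V s" unfolding f_def by (rule inV[OF u])
      define d where "d = s *\<^sub>R \<Psi> z f - u"
      have "d \<in> Dom S \<inter> V s"
        using cvs.subspace_diff[OF subspace_Dom, of "s *\<^sub>R \<Psi> z f" u] cvs.subspace_diff[OF csubspace_V, of "s *\<^sub>R \<Psi> z f" s u]
          G(1)[OF f] u by (auto simp: d_def)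
      moreover have "App S d = z *\<^sub>C d"
      proof -
        have "App S d - z *\<^sub>C d = (App S (s *\<^sub>R \<Psi> z f) - z *\<^sub>C (s *\<^sub>R \<Psi> z f)) - (App S u - z *\<^sub>C u)"
          using linear_opD(4)[OF linear_S, of "s *\<^sub>R \<Psi> z f" u] G(1)[OF f] u
          by (simp add: d_def cvs.scale_right_diff_distrib)
        then show ?thesis unfolding G(2)[OF f] by (simp add: f_def)
      qed
      ultimately have "d = 0" by (rule inj)
      then show "App (restrict_op S (V s)) u - z *\<^sub>C u \<in> V s \<and>
          s *\<^sub>R \<Psi> z (App (restrict_op S (V s)) u - z *\<^sub>C u) = u"
        using f by (simp add: restrict_op_def f_def d_def)
    qed
  qed
qed

lemma spectral_subspaces_V: "spectral_subspaces S (V 1) (V (-1))"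
proof -
  have "spectrum (V 1) (restrict_op S (V 1)) \<subseteq> {z. Re z > 0}"
  proof
    fix z assume "z \<in> spectrum (V 1) (restrict_op S (V 1))"
    then have "\<not> 1 * Re z \<le> 0" using resolvent_set_V[of 1 z] unfolding spectrum_def by blast
    then show "z \<in> {z. Re z > 0}" by simp
  qed
  moreover have "spectrum (V (-1)) (restrict_op S (V (-1))) \<subseteq> {z. Re z < 0}"
  proof
    fix z assume "z \<in> spectrum (V (-1)) (restrict_op S (V (-1)))"
    then have "\<not> (-1) * Re z \<le> 0" using resolvent_set_V[of "-1" z] unfolding spectrum_def by blast
    then show "z \<in> {z. Re z < 0}" by simp
  qed
  moreover have "{z. \<bar>Re z\<bar> < 1 / M} \<subseteq> resolvent_set UNIV S"
    using resolvent_strip(1) M_pos by (auto simp: field_simps)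
  moreover have "0 < 1 / M" using M_pos by simp
  ultimately have dich: "dichotomy S (V 1) (V (-1))"
    unfolding dichotomy_def using linear_S dense_S complementary_V V_invariant by blast
  have "has_pv_integral_iR (\<lambda>z. resolvent S z x) (\<i> *\<^sub>C (pi *\<^sub>R Q x))" for x
    unfolding has_pv_integral_iR_def resolvent_R(2)
    using integrable_R tendsto_scaleC[OF tendsto_const Q_lim] by blast
  moreover have "(1 / (complex_of_real pi * \<i>)) *\<^sub>C (\<i> *\<^sub>C (pi *\<^sub>R Q x)) = proj_along (V 1) (V (-1)) x - proj_along (V (-1)) (V 1) x" for x
  proof -
    have "(1 / (complex_of_real pi * \<i>)) *\<^sub>C (\<i> *\<^sub>C (pi *\<^sub>R Q x)) = Q x"
      by (simp add: scaleR_scaleC scaleC_scaleC)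
    also have "Q x = (1/2) *\<^sub>R (x + Q x) - (1/2) *\<^sub>R (x - Q x)"
      by (rule half_sum_half_diff(2)[symmetric])
    finally show ?thesis unfolding proj_along_V .
  qed
  ultimately show ?thesis unfolding spectral_subspaces_def using dich by blast
qed

end

section \<open>The resolvent of the Hamiltonian on the imaginary axis\<close>

lemma nonneg_symmetric_cauchy_schwarz:
  assumes sym: "symmetric_op B" and pos: "nonnegative_op B" and x: "x \<in> Dom B" and y: "y \<in> Dom B"
  shows "(cmod (cinner (App B x) y))\<^sup>2 \<le> Re (cinner (App B x) x) * Re (cinner (App B y) y)"
proof (rule cauchy_schwarz_form[where D="Dom B" and h="\<lambda>x y. cinner (App B x) y"])
  have lin: "linear_op B" using sym by (simp add: symmetric_op_def)
  show "csubspace (Dom B)" by (rule linear_opD(1)[OF lin])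
  show "cinner (App B (x + y)) z = cinner (App B x) z + cinner (App B y) z" if "x \<in> Dom B" "y \<in> Dom B" for x y z
    by (simp add: linear_opD(2)[OF lin that] cinner_add_left)
  show "cinner (App B (a *\<^sub>C x)) y = a * cinner (App B x) y" if "x \<in> Dom B" for a x y
    by (simp add: linear_opD(3)[OF lin that] cinner_scaleC_left)
  show "cinner (App B x) y = cnj (cinner (App B y) x)" if "x \<in> Dom B" "y \<in> Dom B" for x y
    using sym that cinner_commute[of x "App B y"] by (simp add: symmetric_op_def)
  show "0 \<le> Re (cinner (App B x) x)" if "x \<in> Dom B" for x
    using pos that by (auto simp: nonnegative_op_def complex_nonneg_Reals_iff)
qed (fact x y)+

lemma nonneg_symmetric_eq_0:
  assumes sym: "symmetric_op B" and pos: "nonnegative_op B" and x: "x \<in> Dom B" and 0: "Re (cinner (App B x) x) = 0"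
  shows "App B x = 0"
proof (rule eq_if_cinner_eq_on_dense)
  show "closure (Dom B) = UNIV" using sym by (simp add: symmetric_op_def densely_defined_def)
  show "cinner y (App B x) = cinner y 0" if "y \<in> Dom B" for y
    using nonneg_symmetric_cauchy_schwarz[OF sym pos x that] 0 cinner_commute[of y "App B x"] by simp
qed

text \<open>Of the two factors in the definition of subordination, the first one decays like
  \<open>N\<^bsup>p - 1\<^esup>\<close> on the range of a resolvent of size \<open>1 / N\<close>, and the second one stays bounded.\<close>

lemma subordinate_resolvent_bound:
  assumes sub: "subordinate p R S" and p: "p < 1" and M: "0 < M"
  shows "\<exists>L\<ge>0. \<forall>N\<ge>1. \<forall>x\<ge>0. \<forall>u\<in>Dom S. norm u \<le> M / N * x \<longrightarrow> norm (App S u) \<le> (1 + M) * x \<longrightarrow>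
     norm (App R u) \<le> L * N powr (p - 1) * x"
proof -
  obtain c where c: "0 \<le> c"
      "\<And>u. u \<in> Dom S \<Longrightarrow> norm (App R u) \<le> c * norm_pow u (1 - p) * norm_pow (App S u) p"
    and p0: "0 \<le> p"
    using sub by (auto simp: subordinate_def)
  have "norm (App R u) \<le> c * (1 + M) * N powr (p - 1) * x"
    if N: "1 \<le> N" and x: "0 \<le> x" and u: "u \<in> Dom S" and nu: "norm u \<le> M / N * x" and nS: "norm (App S u) \<le> (1 + M) * x" for N x u
  proof (cases "x = 0")
    case True
    then have "norm_pow u (1 - p) = 0" using nu p by (simp add: norm_pow_def)
    then show ?thesis using c(2)[OF u] True by simp
  next
    case False
    define X where "X = (1 + M) * x"
    have X: "0 < X" using False x M by (simp add: X_def)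
    have "M / N * x \<le> X / N" using N x by (simp add: X_def divide_right_mono algebra_simps)
    then have "norm_pow u (1 - p) \<le> (X / N) powr (1 - p)"
      using nu p by (simp add: norm_pow_def powr_mono2)
    moreover have "norm_pow (App S u) p \<le> X powr p"
    proof (cases "p = 0")
      case True
      then show ?thesis using X by (simp add: norm_pow_def)
    next
      case False
      then show ?thesis using nS p0 by (simp add: norm_pow_def X_def powr_mono2)
    qed
    ultimately have "norm_pow u (1 - p) * norm_pow (App S u) p \<le> (X / N) powr (1 - p) * X powr p"
      by (intro mult_mono) (auto simp: norm_pow_def)
    also have "\<dots> = X * N powr (p - 1)"
    proof -
      have "(X / N) powr (1 - p) = X powr (1 - p) * N powr (p - 1)"
        using X N powr_minus_divide[of N "1 - p"] by (simp add: powr_divide)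
      then have "(X / N) powr (1 - p) * X powr p = (X powr (1 - p) * X powr p) * N powr (p - 1)" by simp
      also have "X powr (1 - p) * X powr p = X" using X by (simp flip: powr_add)
      finally show ?thesis .
    qed
    finally have "c * (norm_pow u (1 - p) * norm_pow (App S u) p) \<le> c * (X * N powr (p - 1))"
      using c(1) by (rule mult_left_mono)
    then show ?thesis using c(2)[OF u] by (simp add: X_def mult_ac)
  qed
  moreover have "0 \<le> c * (1 + M)" using c M by simp
  ultimately show ?thesis by blast
qed

text \<open>A uniform lower bound on a line and surjectivity at a single point suffice, since a
  Neumann series extends surjectivity by steps of a fixed size.\<close>

lemma axis_resolvent_if_bounded_below:
  fixes S :: "('a::complex_banach, 'a) op"
  assumes S: "linear_op S" and M: "0 < M"
    and below: "\<And>t u. u \<in> Dom S \<Longrightarrow> norm u \<le> M / (1 + \<bar>t\<bar>) * norm (App S u - iax t *\<^sub>C u)"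
    and surj0: "\<And>f. \<exists>u\<in>Dom S. App S u - iax t0 *\<^sub>C u = f"
  shows "axis_resolvent S (\<lambda>t. resolvent S (iax t)) M"
proof -
  define surj where "surj t \<longleftrightarrow> (\<forall>f. \<exists>u\<in>Dom S. App S u - iax t *\<^sub>C u = f)" for t
  have res: "iax t \<in> resolvent_set UNIV S"
      "norm (resolvent S (iax t) f) \<le> M / (1 + \<bar>t\<bar>) * norm f" if "surj t" for t f
    using that resolvent_set_UNIV_if_bounded_below[OF S _ below] unfolding surj_def by blast+
  have Mle: "M / (1 + \<bar>t\<bar>) \<le> M" for t
  proof -
    have "M / (1 + \<bar>t\<bar>) \<le> M / 1" using M by (intro divide_left_mono) auto
    then show ?thesis by simp
  qed
  have step: "surj s" if t: "surj t" and st: "\<bar>s - t\<bar> * M < 1" for s t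
    unfolding surj_def
  proof
    fix f
    let ?it = "iax t" and ?is = "iax s"
    let ?G = "resolvent S ?it"
    define c where "c = iax (t - s)"
    note D = resolvent_setD[OF res(1)[OF t]]
    have Gdiff: "?G (x - y) = ?G x - ?G y" for x y
    proof -
      have Dx: "?G x \<in> Dom S" "?G y \<in> Dom S" using D(1) by auto
      have "App S (?G x - ?G y) - ?it *\<^sub>C (?G x - ?G y) = (App S (?G x) - ?it *\<^sub>C ?G x) - (App S (?G y) - ?it *\<^sub>C ?G y)"
        by (simp add: linear_opD(4)[OF S Dx] cvs.scale_right_diff_distrib)
      also have "\<dots> = x - y" using D(2) by simp
      finally show ?thesis using D(4)[OF cvs.subspace_diff[OF linear_opD(1)[OF S] Dx]] by simp
    qed
    have nG: "norm (?G x) \<le> M * norm x" for x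
      using res(2)[OF t, of x] mult_right_mono[OF Mle, of "norm x" t] by simp
    have "\<exists>y. y + c *\<^sub>C ?G y = f"
    proof (rule neumann_solve[of _ "\<bar>s - t\<bar> * M"])
      show "c *\<^sub>C ?G (x - y) = c *\<^sub>C ?G x - c *\<^sub>C ?G y" for x y
        unfolding Gdiff by (rule cvs.scale_right_diff_distrib)
      have "norm (c *\<^sub>C ?G x) = \<bar>s - t\<bar> * norm (?G x)" for x
        by (simp add: norm_scaleC c_def norm_mult abs_minus_commute flip: of_real_diff)
      then show "norm (c *\<^sub>C ?G x) \<le> \<bar>s - t\<bar> * M * norm x" for x
        using mult_left_mono[OF nG, of "\<bar>s - t\<bar>" x] by simp
    qed (use st M in auto)
    then obtain y where y: "y + c *\<^sub>C ?G y = f" ..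
    have "App S (?G y) - ?is *\<^sub>C ?G y = (App S (?G y) - ?it *\<^sub>C ?G y) + c *\<^sub>C ?G y"
      by (simp add: c_def right_diff_distrib cvs.scale_left_diff_distrib)
    also have "\<dots> = f" using D(2)[of y] y by simp
    finally show "\<exists>u\<in>Dom S. App S u - ?is *\<^sub>C u = f" using D(1)[of y] by blast
  qed
  define \<delta> where "\<delta> = 1 / (2 * M)"
  have \<delta>: "0 < \<delta>" "\<delta> * M < 1" using M by (simp_all add: \<delta>_def)
  have iter: "\<forall>t. \<bar>t - t0\<bar> \<le> real n * \<delta> \<longrightarrow> surj t" for n
  proof (induction n)
    case 0
    then show ?case using surj0 by (simp add: surj_def)
  next
    case (Suc n)
    show ?case
    proof (intro allI impI)
      fix t assume t: "\<bar>t - t0\<bar> \<le> real (Suc n) * \<delta>"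
      define s where "s = t0 + (real n / real (Suc n)) * (t - t0)"
      have "\<bar>s - t0\<bar> = (real n / real (Suc n)) * \<bar>t - t0\<bar>" by (simp add: s_def abs_mult)
      also have "\<dots> \<le> (real n / real (Suc n)) * (real (Suc n) * \<delta>)" by (intro mult_left_mono t) auto
      also have "\<dots> = real n * \<delta>" by simp
      finally have "surj s" using Suc.IH by blast
      have "t - s = (1 - real n / real (Suc n)) * (t - t0)" by (simp add: s_def algebra_simps)
      also have "1 - real n / real (Suc n) = 1 / real (Suc n)" by (simp add: field_simps)
      finally have "\<bar>t - s\<bar> = \<bar>t - t0\<bar> / real (Suc n)" by (simp add: abs_mult)
      also have "\<dots> \<le> \<delta>" using t by (simp add: pos_divide_le_eq mult.commute)
      finally have "\<bar>t - s\<bar> * M \<le> \<delta> * M" using M by (intro mult_right_mono) auto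
      with \<delta> have "\<bar>t - s\<bar> * M < 1" by linarith
      with \<open>surj s\<close> show "surj t" by (rule step)
    qed
  qed
  have all: "surj t" for t
  proof -
    obtain n :: nat where "\<bar>t - t0\<bar> / \<delta> \<le> real n" using real_arch_simple by blast
    then have "\<bar>t - t0\<bar> \<le> real n * \<delta>" using \<delta> by (simp add: pos_divide_le_eq)
    with iter show ?thesis by blast
  qed
  show ?thesis
    by unfold_locales (use S M res[OF all] resolvent_setD(1,2,4)[OF res(1)[OF all]] in auto)
qed

lemma integral_decay_bound:
  fixes h :: "real \<Rightarrow> 'a::banach"
  assumes cont: "continuous_on UNIV h" and p: "p < 1"
    and le: "\<And>t. norm (h t) \<le> c * (1 + \<bar>t\<bar>) powr (p - 2)" and r: "0 \<le> r"
  shows "norm (integral {-r..r} h) \<le> 2 * c / (1 - p)"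
proof -
  have "norm (h 0) \<le> c" using le[of 0] by simp
  then have c0: "0 \<le> c" using norm_ge_zero order_trans by blast
  have half: "norm (integral {0..r} g) \<le> c / (1 - p)"
    if g: "continuous_on UNIV g" "\<And>t. norm (g t) \<le> c * (1 + \<bar>t\<bar>) powr (p - 2)" for g :: "real \<Rightarrow> 'a"
  proof -
    define G where "G t = c * (1 + t) powr (p - 1) / (p - 1)" for t
    have "(G has_real_derivative c * (1 + t) powr (p - 2)) (at t within {0..r})" if "t \<in> {0..r}" for t
    proof -
      have "((\<lambda>t. 1 + t) has_real_derivative 1) (at t)"
        using DERIV_add[OF DERIV_const DERIV_ident] by simp
      then have "((\<lambda>t. (1 + t) powr (p - 1)) has_real_derivative (p - 1) * (1 + t) powr (p - 1 - of_nat 1) * 1) (at t)"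
        using that by (intro DERIV_fun_powr) auto
      then have "((\<lambda>t. (1 + t) powr (p - 1)) has_real_derivative (p - 1) * (1 + t) powr (p - 1 - of_nat 1) * 1) (at t within {0..r})"
        by (rule has_field_derivative_at_within)
      from DERIV_cdivide[OF DERIV_cmult[OF this, of c], of "p - 1"]
      show ?thesis using p unfolding G_def by (simp add: diff_diff_eq)
    qed
    then have int: "((\<lambda>t. c * (1 + t) powr (p - 2)) has_integral (G r - G 0)) {0..r}"
      using r by (intro fundamental_theorem_of_calculus)
        (auto simp flip: has_real_derivative_iff_has_vector_derivative)
    have "norm (integral {0..r} g) \<le> integral {0..r} (\<lambda>t. c * (1 + t) powr (p - 2))"
    proof (rule integral_norm_bound_integral)
      show "g integrable_on {0..r}" by (intro integrable_continuous_real continuous_on_subset[OF g(1)]) auto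
      show "(\<lambda>t. c * (1 + t) powr (p - 2)) integrable_on {0..r}" using int by blast
      show "norm (g t) \<le> c * (1 + t) powr (p - 2)" if "t \<in> {0..r}" for t using g(2)[of t] that by simp
    qed
    also have "\<dots> = G r - G 0" using int by (rule integral_unique)
    also have "\<dots> \<le> c / (1 - p)"
    proof -
      have "0 \<le> c * (1 + r) powr (p - 1) / (1 - p)" using c0 p by simp
      moreover have "G r = - (c * (1 + r) powr (p - 1) / (1 - p))" "G 0 = - (c / (1 - p))"
        using p by (simp_all add: G_def flip: divide_minus_right)
      ultimately show ?thesis by simp
    qed
    finally show ?thesis .
  qed
  have inth: "h integrable_on {a..b}" for a b by (intro integrable_continuous_real continuous_on_subset[OF cont]) auto
  have "integral {-r..r} h = integral {-r..0} h + integral {0..r} h"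
    using r by (intro Henstock_Kurzweil_Integration.integral_combine[symmetric] inth) auto
  also have "integral {-r..0} h = integral {0..r} (\<lambda>t. h (- t))"
    using Henstock_Kurzweil_Integration.integral_reflect_real[of 0 "-r" h] 
      Henstock_Kurzweil_Integration.integral_reflect_real[of r 0 "\<lambda>t. h (- t)"] by simp
  also have "norm (integral {0..r} (\<lambda>t. h (- t)) + integral {0..r} h) \<le> c / (1 - p) + c / (1 - p)"
  proof (intro norm_triangle_mono half cont le)
    show "continuous_on UNIV (\<lambda>t. h (- t))"
      by (rule continuous_on_compose2[OF cont]) (auto intro: continuous_intros)
    show "norm (h (- t)) \<le> c * (1 + \<bar>t\<bar>) powr (p - 2)" for t using le[of "- t"] by simp
  qed
  finally show ?thesis by (simp add: add_divide_distrib[symmetric])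
qed

locale dominant_hamiltonian = A: axis_resolvent_hilbert A RA M
  for A :: "('h::complex_hilbert, 'h) op" and RA M +
  fixes B C :: "('h, 'h) op" and p :: real
  assumes nonneg: "nonnegative_hamiltonian A B C"
    and dominant: "diagonally_dominant p A B C"
    and p_less: "p < 1"
begin

abbreviation As where "As \<equiv> adjoint_op A"
abbreviation Ad where "Ad \<equiv> A.adjR"
abbreviation T where "T \<equiv> hamiltonian_op A B C"

lemma symB: "symmetric_op B" and symC: "symmetric_op C"
  and posB: "nonnegative_op B" and posC: "nonnegative_op C"
  using nonneg by (auto simp: nonnegative_hamiltonian_def hamiltonian_def)

lemma linB: "linear_op B" and linC: "linear_op C"
  using symB symC by (auto simp: symmetric_op_def)

lemma linAs: "linear_op As" by (rule linear_adjoint_op[OF A.dense_S])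

lemma DomB: "v \<in> Dom As \<Longrightarrow> v \<in> Dom B" and DomC: "u \<in> Dom A \<Longrightarrow> u \<in> Dom C"
  using dominant by (auto simp: diagonally_dominant_def subordinate_def)

lemma Dom_T: "Dom T = Dom A \<times> Dom As"
  using DomB DomC by (auto simp: hamiltonian_op_def)

lemma App_T: "App T x = (App A (fst x) + App B (snd x), App C (fst x) - App As (snd x))"
  by (simp add: hamiltonian_op_def split_beta)

lemma linear_T: "linear_op T"
  unfolding linear_op_def
proof (intro conjI ballI allI)
  show "csubspace (Dom T)"
    unfolding Dom_T
    by (rule cvs.subspaceI)
      (auto simp: zero_prod_def scaleC_prod_def
        intro: cvs.subspace_0[OF A.subspace_Dom] cvs.subspace_add[OF A.subspace_Dom] cvs.subspace_scale[OF A.subspace_Dom]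
          cvs.subspace_0[OF linear_opD(1)[OF linAs]] cvs.subspace_add[OF linear_opD(1)[OF linAs]]
          cvs.subspace_scale[OF linear_opD(1)[OF linAs]])
  fix x y assume "x \<in> Dom T" "y \<in> Dom T"
  then have D: "fst x \<in> Dom A" "fst y \<in> Dom A" "snd x \<in> Dom As" "snd y \<in> Dom As"
    by (auto simp: Dom_T)
  show "App T (x + y) = App T x + App T y"
    by (simp add: App_T linear_opD(2)[OF A.linear_S] linear_opD(2)[OF linB] linear_opD(2)[OF linC] linear_opD(2)[OF linAs]
        D DomB DomC)
next
  fix c x assume "x \<in> Dom T"
  then have D: "fst x \<in> Dom A" "snd x \<in> Dom As" by (auto simp: Dom_T)
  show "App T (c *\<^sub>C x) = c *\<^sub>C App T x"
    by (simp add: App_T scaleC_prod_def linear_opD(3)[OF A.linear_S] linear_opD(3)[OF linB] linear_opD(3)[OF linC]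
        linear_opD(3)[OF linAs] D DomB DomC scaleC_add_right cvs.scale_right_diff_distrib)
qed

lemma dense_T: "densely_defined T"
  using A.dense_S A.dense_adjoint unfolding densely_defined_def Dom_T by (simp add: closure_Times)

interpretation adj: axis_resolvent "uminus_op As" "\<lambda>t w. - Ad t w" M
  by (rule A.axis_resolvent_uminus_adjoint)

lemma Ad_diff: "Ad t (x - y) = Ad t x - Ad t y"
  using adj.R_diff[of t x y] by (simp add: algebra_simps)

text \<open>Because of \<open>p < 1\<close> the off-diagonal entries are small compared with the diagonal far out on
  the axis.\<close>

lemma off_diagonal_bound:
  "\<exists>L\<ge>0. \<forall>t w. norm (App C (RA t w)) \<le> L * (1 + \<bar>t\<bar>) powr (p - 1) * norm w \<and>
    norm (App B (Ad t w)) \<le> L * (1 + \<bar>t\<bar>) powr (p - 1) * norm w"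
proof -
  have sub: "subordinate p C A" "subordinate p B As"
    using dominant by (auto simp: diagonally_dominant_def)
  obtain L1 where L1: "0 \<le> L1" "\<And>N x u. 1 \<le> N \<Longrightarrow> 0 \<le> x \<Longrightarrow> u \<in> Dom A \<Longrightarrow> norm u \<le> M / N * x \<Longrightarrow>
      norm (App A u) \<le> (1 + M) * x \<Longrightarrow> norm (App C u) \<le> L1 * N powr (p - 1) * x"
    using subordinate_resolvent_bound[OF sub(1) p_less A.M_pos] by blast
  obtain L2 where L2: "0 \<le> L2" "\<And>N x u. 1 \<le> N \<Longrightarrow> 0 \<le> x \<Longrightarrow> u \<in> Dom As \<Longrightarrow> norm u \<le> M / N * x \<Longrightarrow>
      norm (App As u) \<le> (1 + M) * x \<Longrightarrow> norm (App B u) \<le> L2 * N powr (p - 1) * x"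
    using subordinate_resolvent_bound[OF sub(2) p_less A.M_pos] by blast
  have large: "norm (w + c *\<^sub>C u) \<le> (1 + M) * norm w"
    if u: "norm u \<le> M / (1 + \<bar>t\<bar>) * norm w" and c: "cmod c = \<bar>t\<bar>" for w u :: 'h and c t
  proof -
    have "norm (w + c *\<^sub>C u) \<le> norm w + \<bar>t\<bar> * norm u" using norm_triangle_ineq[of w "c *\<^sub>C u"] c by (simp add: norm_scaleC)
    also have "\<bar>t\<bar> * norm u \<le> \<bar>t\<bar> * (M / (1 + \<bar>t\<bar>) * norm w)" by (intro mult_left_mono u) auto
    also have "\<dots> = (\<bar>t\<bar> / (1 + \<bar>t\<bar>)) * (M * norm w)" by simp
    also have "\<dots> \<le> 1 * (M * norm w)" using A.M_pos by (intro mult_right_mono) auto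
    finally show ?thesis by (simp add: distrib_right)
  qed
  have C: "norm (App C (RA t w)) \<le> L1 * (1 + \<bar>t\<bar>) powr (p - 1) * norm w" for t w
    using large[OF A.norm_R, of "iax t" t w] A.norm_R[of t w]
    by (intro L1(2)) (simp_all add: A.R_Dom A.S_R' norm_mult)
  have B: "norm (App B (Ad t w)) \<le> L2 * (1 + \<bar>t\<bar>) powr (p - 1) * norm w" for t w
    using large[OF A.norm_adjR, of "- iax t" t w] A.norm_adjR[of t w]
    by (intro L2(2)) (simp_all add: A.adjoint_adjR norm_mult)
  have "L1 * X * norm w \<le> (L1 + L2) * X * norm w" "L2 * X * norm w \<le> (L1 + L2) * X * norm w"
    if "0 \<le> X" for X and w :: 'h
    using that L1(1) L2(1) by (auto intro!: mult_right_mono)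
  with B C show ?thesis using L1(1) L2(1) by (intro exI[of _ "L1 + L2"]) (meson add_nonneg_nonneg order_trans powr_ge_zero)
qed

definition energy :: "'h \<times> 'h \<Rightarrow> real" where
  "energy x = Re (cinner (App B (snd x)) (snd x)) + Re (cinner (App C (fst x)) (fst x))"

text \<open>The diagonal entries contribute a purely imaginary number, and so does the spectral
  parameter on the imaginary axis.\<close>

lemma energy_eq:
  assumes x: "x \<in> Dom T" and f: "App T x - iax t *\<^sub>C x = f"
  shows "Re (cinner (fst f) (snd x) + cinner (snd f) (fst x)) = energy x"
proof -
  obtain u v where uv: "x = (u, v)" by (cases x)
  have u: "u \<in> Dom A" and v: "v \<in> Dom As" using x by (simp_all add: Dom_T uv)
  have f1: "fst f = App A u + App B v - iax t *\<^sub>C u" and f2: "snd f = App C u - App As v - iax t *\<^sub>C v"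
    using f by (auto simp: App_T uv scaleC_prod_def)
  have "Re (cinner (App A u) v) = Re (cinner (App As v) u)"
    using A.cinner_R adjoint_opD[OF A.dense_S v u] cinner_commute[of u "App As v"] by simp
  moreover have "Im (cinner u v) = - Im (cinner v u)" using cinner_commute[of u v] by simp
  ultimately show ?thesis
    unfolding f1 f2 energy_def uv by (simp add: cinner_simps)
qed

lemma energy_parts_nonneg:
  assumes "x \<in> Dom T"
  shows "0 \<le> Re (cinner (App B (snd x)) (snd x))" and "0 \<le> Re (cinner (App C (fst x)) (fst x))"
proof -
  have "snd x \<in> Dom B" "fst x \<in> Dom C" using assms DomB DomC by (auto simp: Dom_T)
  then show "0 \<le> Re (cinner (App B (snd x)) (snd x))" and "0 \<le> Re (cinner (App C (fst x)) (fst x))"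
    using posB posC by (auto simp: nonnegative_op_def complex_nonneg_Reals_iff)
qed

text \<open>If \<open>f = (T - \<i> t) x\<close> and \<open>x = (u, v)\<close>, then \<open>u = (A - \<i> t)\<^sup>-\<^sup>1 (f\<^sub>1 - B v)\<close>. Tested with itself,
  \<open>(A - \<i> t)\<^sup>-\<^sup>1 B v\<close> is controlled by the energy through the Cauchy-Schwarz inequality for the form of \<open>B\<close>, and
  the energy is at most of size \<open>\<parallel>f\<parallel> \<parallel>x\<parallel>\<close>; likewise for \<open>v\<close>. This leads to
  \<open>\<parallel>x\<parallel> \<le> 2 a \<parallel>f\<parallel> + const (k \<parallel>f\<parallel> \<parallel>x\<parallel>)\<^bsup>1/2\<^esup>\<close> with \<open>a\<close> and \<open>k\<close> of size \<open>1 / (1 + \<bar>t\<bar>)\<close>, from which \<open>\<parallel>x\<parallel>\<close> is absorbed.\<close>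

lemma T_bounded_below:
  "\<exists>MT>0. \<forall>t. \<forall>x\<in>Dom T. norm x \<le> MT / (1 + \<bar>t\<bar>) * norm (App T x - iax t *\<^sub>C x)"
proof -
  obtain L where L: "0 \<le> L"
      "\<And>t w. norm (App C (RA t w)) \<le> L * (1 + \<bar>t\<bar>) powr (p - 1) * norm w"
      "\<And>t w. norm (App B (Ad t w)) \<le> L * (1 + \<bar>t\<bar>) powr (p - 1) * norm w"
    using off_diagonal_bound by blast
  have L': "norm (App C (RA t w)) \<le> L * norm w" "norm (App B (Ad t w)) \<le> L * norm w" for t w
  proof -
    have "1 + \<bar>t\<bar> \<noteq> 0" using abs_ge_zero[of t] by linarith
    moreover have "(1 + \<bar>t\<bar>) powr (p - 1) \<le> (1 + \<bar>t\<bar>) powr 0" using p_less by (intro powr_mono) auto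
    ultimately have "(1 + \<bar>t\<bar>) powr (p - 1) \<le> 1" by simp
    then have "L * (1 + \<bar>t\<bar>) powr (p - 1) * norm w \<le> L * 1 * norm w"
      using L(1) by (intro mult_right_mono mult_left_mono) auto
    then show "norm (App C (RA t w)) \<le> L * norm w" "norm (App B (Ad t w)) \<le> L * norm w"
      using L(2)[of t w] L(3)[of t w] by simp_all
  qed
  have "norm x \<le> (4 * M + 8 * L * M) / (1 + \<bar>t\<bar>) * norm (App T x - iax t *\<^sub>C x)" if x: "x \<in> Dom T" for t x
  proof -
    obtain u v where uv: "x = (u, v)" by (cases x)
    have u: "u \<in> Dom A" and v: "v \<in> Dom As" using x by (simp_all add: Dom_T uv)
    define f where "f = App T x - iax t *\<^sub>C x"
    define F where "F = norm f"
    define X where "X = norm x"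
    define a where "a = M / (1 + \<bar>t\<bar>)"
    define k where "k = L * a"
    have a0: "0 \<le> a" using A.M_pos by (simp add: a_def)
    then have k0: "0 \<le> k" using L(1) by (simp add: k_def)
    have F0: "0 \<le> F" and X0: "0 \<le> X" by (simp_all add: F_def X_def)
    have f1: "fst f = (App A u - iax t *\<^sub>C u) + App B v" and f2: "snd f = App C u - (App As v + iax t *\<^sub>C v)"
      by (simp_all add: f_def App_T uv scaleC_prod_def)
    have nf: "norm (fst f) \<le> F" "norm (snd f) \<le> F" and nx: "norm u \<le> X" "norm v \<le> X"
      using norm_fst_le[of "fst f" "snd f"] norm_snd_le[of "snd f" "fst f"] norm_fst_le[of u v] norm_snd_le[of v u]
      by (simp_all add: F_def X_def uv)
    have "energy x \<le> 2 * (F * X)"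
    proof -
      have "energy x = Re (cinner (fst f) v + cinner (snd f) u)"
        using energy_eq[OF x f_def[symmetric]] by (simp add: uv)
      also have "\<dots> \<le> cmod (cinner (fst f) v) + cmod (cinner (snd f) u)"
        using complex_Re_le_cmod norm_triangle_ineq order_trans by blast
      also have "\<dots> \<le> F * X + F * X"
        by (intro add_mono order_trans[OF cinner_cauchy_schwarz] mult_mono nf nx) (auto simp: F_def)
      finally show ?thesis by simp
    qed
    then have EB: "Re (cinner (App B v) v) \<le> 2 * (F * X)" and EC: "Re (cinner (App C u) u) \<le> 2 * (F * X)"
      using energy_parts_nonneg[OF x] by (simp_all add: energy_def uv)
    \<comment> \<open>\<open>2 k F X \<le> (2 k F + X / 4)\<^sup>2\<close>; the share \<open>X / 4\<close> of each of the two components can be absorbed.\<close>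
    have weak: "norm y \<le> 2 * k * F + X / 4"
      if sq: "(cmod (cinner y y))\<^sup>2 \<le> e * (k * (norm y)\<^sup>2)" and e: "e \<le> 2 * (F * X)" for y :: 'h and e
    proof -
      have "(norm y)\<^sup>2 * (norm y)\<^sup>2 \<le> e * (k * (norm y)\<^sup>2)"
        using sq unfolding cinner_self norm_of_real by (simp add: power2_eq_square)
      also have "\<dots> \<le> (2 * (F * X)) * (k * (norm y)\<^sup>2)" using k0 by (intro mult_right_mono e) auto
      finally have quartic: "(norm y)\<^sup>2 * (norm y)\<^sup>2 \<le> (2 * k * F * X) * (norm y)\<^sup>2" by (simp add: mult_ac)
      have "(norm y)\<^sup>2 \<le> 2 * k * F * X"
      proof (cases "y = 0")
        case False
        then have "0 < (norm y)\<^sup>2" by simp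
        then show ?thesis by (rule mult_right_le_imp_le[OF quartic])
      qed (use k0 F0 X0 in simp)
      also have "\<dots> \<le> (2 * k * F + X / 4)\<^sup>2"
        using zero_le_power2[of "2 * k * F - X / 4"] by (simp add: power2_eq_square algebra_simps)
      finally show ?thesis using k0 F0 X0 by (intro power2_le_imp_le[of "norm y"]) auto
    qed
    have wB: "norm (RA t (App B v)) \<le> 2 * k * F + X / 4"
    proof (rule weak[OF _ EB])
      let ?y = "RA t (App B v)"
      have e: "Re (cinner (App B (Ad t ?y)) (Ad t ?y)) \<le> (L * norm ?y) * (a * norm ?y)"
        using L'(2) A.norm_adjR L(1) unfolding a_def
        by (intro order_trans[OF complex_Re_le_cmod] order_trans[OF cinner_cauchy_schwarz] mult_mono) auto
      have D: "v \<in> Dom B" "Ad t ?y \<in> Dom B" using v A.adjoint_adjR(1) DomB by auto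
      have "(cmod (cinner ?y ?y))\<^sup>2 = (cmod (cinner (App B v) (Ad t ?y)))\<^sup>2" by (subst A.cinner_R) (rule refl)
      also have "\<dots> \<le> Re (cinner (App B v) v) * Re (cinner (App B (Ad t ?y)) (Ad t ?y))"
        by (rule nonneg_symmetric_cauchy_schwarz[OF symB posB D])
      also have "Re (cinner (App B v) v) * Re (cinner (App B (Ad t ?y)) (Ad t ?y)) \<le> Re (cinner (App B v) v) * ((L * norm ?y) * (a * norm ?y))"
        using energy_parts_nonneg(1)[OF x] by (intro mult_left_mono e) (simp add: uv)
      finally show "(cmod (cinner ?y ?y))\<^sup>2 \<le> Re (cinner (App B v) v) * (k * (norm ?y)\<^sup>2)"
        by (simp add: k_def power2_eq_square mult_ac)
    qed
    have wC: "norm (Ad t (App C u)) \<le> 2 * k * F + X / 4"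
    proof (rule weak[OF _ EC])
      let ?y = "Ad t (App C u)"
      have e: "Re (cinner (App C (RA t ?y)) (RA t ?y)) \<le> (L * norm ?y) * (a * norm ?y)"
        using L'(1) A.norm_R L(1) unfolding a_def
        by (intro order_trans[OF complex_Re_le_cmod] order_trans[OF cinner_cauchy_schwarz] mult_mono) auto
      have D: "u \<in> Dom C" "RA t ?y \<in> Dom C" using u A.R_Dom DomC by auto
      have "cinner ?y ?y = cinner (RA t ?y) (App C u)" by (rule A.cinner_R[symmetric])
      then have "(cmod (cinner ?y ?y))\<^sup>2 = (cmod (cinner (App C u) (RA t ?y)))\<^sup>2"
        using cinner_commute[of "RA t ?y" "App C u"] by simp
      also have "\<dots> \<le> Re (cinner (App C u) u) * Re (cinner (App C (RA t ?y)) (RA t ?y))"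
        by (rule nonneg_symmetric_cauchy_schwarz[OF symC posC D])
      also have "Re (cinner (App C u) u) * Re (cinner (App C (RA t ?y)) (RA t ?y)) \<le> Re (cinner (App C u) u) * ((L * norm ?y) * (a * norm ?y))"
        using energy_parts_nonneg(2)[OF x] by (intro mult_left_mono e) (simp add: uv)
      finally show "(cmod (cinner ?y ?y))\<^sup>2 \<le> Re (cinner (App C u) u) * (k * (norm ?y)\<^sup>2)"
        by (simp add: k_def power2_eq_square mult_ac)
    qed
    have "u = RA t (fst f - App B v)" unfolding f1 using A.R_S[OF u, of t] by simp
    then have "norm u \<le> norm (RA t (fst f)) + norm (RA t (App B v))"
      unfolding A.R_diff using norm_triangle_ineq4 by metis
    also have "\<dots> \<le> a * F + (2 * k * F + X / 4)"
      using A.norm_R[of t "fst f"] mult_left_mono[OF nf(1) a0] wB by (simp add: a_def)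
    finally have nu: "norm u \<le> a * F + (2 * k * F + X / 4)" .
    have "App C u - snd f = App As v + iax t *\<^sub>C v" unfolding f2 by simp
    then have "v = Ad t (App C u - snd f)" using A.adjR_adjoint[OF v, of t] by simp
    then have "norm v \<le> norm (Ad t (App C u)) + norm (Ad t (snd f))"
      unfolding Ad_diff using norm_triangle_ineq4 by metis
    also have "\<dots> \<le> (2 * k * F + X / 4) + a * F"
      using A.norm_adjR[of t "snd f"] mult_left_mono[OF nf(2) a0] wC by (simp add: a_def)
    finally have nv: "norm v \<le> (2 * k * F + X / 4) + a * F" .
    have "X \<le> norm u + norm v" unfolding X_def uv by (rule norm_Pair_le)
    then have "X \<le> 4 * a * F + 8 * k * F" using nu nv by simp
    also have "\<dots> = (4 * M + 8 * L * M) / (1 + \<bar>t\<bar>) * F"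
      by (simp add: a_def k_def add_divide_distrib distrib_right)
    finally show ?thesis by (simp add: X_def F_def f_def)
  qed
  moreover have "0 < 4 * M + 8 * L * M" using A.M_pos L(1) by (intro add_pos_nonneg) auto
  ultimately show ?thesis by blast
qed

text \<open>The off-diagonal part of \<^term>\<open>T\<close> applied to the resolvent of its diagonal part.\<close>

definition perturb :: "real \<Rightarrow> 'h \<times> 'h \<Rightarrow> 'h \<times> 'h" where
  "perturb t y = (App B (- Ad t (snd y)), App C (RA t (fst y)))"

lemma perturb_solves:
  "(RA t (fst y), - Ad t (snd y)) \<in> Dom T"
  "App T (RA t (fst y), - Ad t (snd y)) - iax t *\<^sub>C (RA t (fst y), - Ad t (snd y)) = y + perturb t y"
proof -
  have D: "- Ad t w \<in> Dom As" "App As (- Ad t w) = - App As (Ad t w)" for w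
    using cvs.subspace_neg[OF linear_opD(1)[OF linAs] A.adjoint_adjR(1)] linear_opD(3)[OF linAs A.adjoint_adjR(1), of "-1"]
    by auto
  show "(RA t (fst y), - Ad t (snd y)) \<in> Dom T" by (simp add: Dom_T A.R_Dom D)
  show "App T (RA t (fst y), - Ad t (snd y)) - iax t *\<^sub>C (RA t (fst y), - Ad t (snd y)) = y + perturb t y"
    by (cases y) (simp add: App_T perturb_def scaleC_prod_def A.S_R' D A.adjoint_adjR)
qed

lemma norm_perturb:
  "\<exists>L\<ge>0. \<forall>t y. norm (perturb t y) \<le> L * (1 + \<bar>t\<bar>) powr (p - 1) * norm y"
proof -
  obtain L where L: "0 \<le> L"
      "\<And>t w. norm (App C (RA t w)) \<le> L * (1 + \<bar>t\<bar>) powr (p - 1) * norm w"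
      "\<And>t w. norm (App B (Ad t w)) \<le> L * (1 + \<bar>t\<bar>) powr (p - 1) * norm w"
    using off_diagonal_bound by blast
  have "norm (perturb t y) \<le> 2 * L * (1 + \<bar>t\<bar>) powr (p - 1) * norm y" for t y
  proof -
    let ?l = "L * (1 + \<bar>t\<bar>) powr (p - 1)"
    have l: "0 \<le> ?l" using L(1) by simp
    have neg: "App B (- Ad t (snd y)) = - App B (Ad t (snd y))"
      using linear_opD(3)[OF linB DomB[OF A.adjoint_adjR(1)], of "-1"] by auto
    have "norm (perturb t y) \<le> norm (App B (Ad t (snd y))) + norm (App C (RA t (fst y)))"
      unfolding perturb_def neg using norm_Pair_le by (metis norm_minus_cancel)
    also have "\<dots> \<le> ?l * norm (snd y) + ?l * norm (fst y)" by (intro add_mono L)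
    also have "\<dots> \<le> ?l * norm y + ?l * norm y"
      using norm_fst_le[of "fst y" "snd y"] norm_snd_le[of "snd y" "fst y"] l by (intro add_mono mult_left_mono) auto
    finally show ?thesis by (simp add: mult_ac)
  qed
  then show ?thesis using L(1) by (intro exI[of _ "2 * L"]) auto
qed

lemma perturb_diff: "perturb t (x - y) = perturb t x - perturb t y"
proof -
  have D: "- Ad t w \<in> Dom B" "RA t w \<in> Dom C" for w
    using cvs.subspace_neg[OF linear_opD(1)[OF linAs] A.adjoint_adjR(1)] DomB DomC A.R_Dom by auto
  have "App B (- Ad t (snd x) - - Ad t (snd y)) = App B (- Ad t (snd x)) - App B (- Ad t (snd y))"
    by (rule linear_opD(4)[OF linB D(1) D(1)])
  moreover have "- Ad t (snd x - snd y) = - Ad t (snd x) - - Ad t (snd y)" by (simp add: Ad_diff)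
  ultimately show ?thesis
    unfolding perturb_def by (simp only: fst_diff snd_diff A.R_diff linear_opD(4)[OF linC D(2) D(2)] diff_Pair)
qed

lemma T_surjective_far_out: "\<exists>t0. \<forall>f. \<exists>x\<in>Dom T. App T x - iax t0 *\<^sub>C x = f"
proof -
  obtain L where L: "0 \<le> L" "\<And>t y. norm (perturb t y) \<le> L * (1 + \<bar>t\<bar>) powr (p - 1) * norm y"
    using norm_perturb by blast
  \<comment> \<open>The point is chosen such that \<open>L N\<^bsup>p - 1\<^esup> = L / (L + 1) < 1\<close>.\<close>
  define N where "N = (L + 1) powr (1 / (1 - p))"
  define t0 where "t0 = N - 1"
  have N1: "1 \<le> N" using L(1) p_less unfolding N_def by (intro ge_one_powr_ge_zero) auto
  have "N powr (p - 1) = (L + 1) powr (- 1)"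
  proof -
    have "1 / (1 - p) * (p - 1) = - 1" using p_less by (simp add: field_simps)
    then show ?thesis by (simp only: N_def powr_powr)
  qed
  also have "\<dots> = 1 / (L + 1)" using L(1) by (simp add: powr_minus_divide)
  finally have q: "L * (1 + \<bar>t0\<bar>) powr (p - 1) = L / (L + 1)" using N1 by (simp add: t0_def)
  have "\<exists>x\<in>Dom T. App T x - iax t0 *\<^sub>C x = f" for f
  proof -
    have "\<exists>y. y + perturb t0 y = f"
    proof (rule neumann_solve[of _ "L / (L + 1)"])
      show "norm (perturb t0 y) \<le> L / (L + 1) * norm y" for y using L(2)[of t0 y] unfolding q .
    qed (use L(1) perturb_diff in auto)
    then obtain y where y: "y + perturb t0 y = f" ..
    then show ?thesis using perturb_solves[of t0 y] by metis
  qed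
  then show ?thesis by blast
qed

abbreviation RT :: "real \<Rightarrow> 'h \<times> 'h \<Rightarrow> 'h \<times> 'h" where
  "RT t \<equiv> resolvent T (iax t)"

lemma axis_resolvent_T: "\<exists>MT. axis_resolvent T RT MT"
proof -
  obtain MT where MT: "0 < MT" "\<And>t x. x \<in> Dom T \<Longrightarrow> norm x \<le> MT / (1 + \<bar>t\<bar>) * norm (App T x - iax t *\<^sub>C x)"
    using T_bounded_below by blast
  obtain t0 where t0: "\<And>f. \<exists>x\<in>Dom T. App T x - iax t0 *\<^sub>C x = f" using T_surjective_far_out by blast
  show ?thesis
    using axis_resolvent_if_bounded_below[OF linear_T MT(1) MT(2) t0] by blast
qed

text \<open>The resolvents of \<^term>\<open>T\<close> and of its diagonal part differ by
  \<^term>\<open>RT t (perturb t x)\<close>, which is \<open>O (\<bar>t\<bar>\<^bsup>p - 2\<^esup>)\<close> and hence absolutely integrable.\<close>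

lemma T_integral_bound:
  assumes K: "\<And>r x. 0 < r \<Longrightarrow> norm (integral {-r..r} (\<lambda>t. RA t x)) \<le> K * norm x" and K0: "0 \<le> K"
    and MT: "axis_resolvent T RT MT"
  shows "\<exists>K'\<ge>0. \<forall>r>0. \<forall>x. norm (integral {-r..r} (\<lambda>t. RT t x)) \<le> K' * norm x"
proof -
  interpret T: axis_resolvent T RT MT by (rule MT)
  obtain L where L: "0 \<le> L" "\<And>t y. norm (perturb t y) \<le> L * (1 + \<bar>t\<bar>) powr (p - 1) * norm y"
    using norm_perturb by blast
  define K' where "K' = 2 * K + 2 * (MT * L) / (1 - p)"
  have K'0: "0 \<le> K'" using K0 L(1) T.M_pos p_less by (simp add: K'_def)
  have "norm (integral {-r..r} (\<lambda>t. RT t x)) \<le> K' * norm x" if r: "0 < r" for r x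
  proof -
    let ?h1 = "\<lambda>t. (RA t (fst x), 0 :: 'h)" and ?h2 = "\<lambda>t. (0 :: 'h, - Ad t (snd x))"
    define d where "d t = RT t (perturb t x)" for t
    have eq: "d t = ?h1 t + ?h2 t - RT t x" for t
    proof -
      have "RT t (x + perturb t x) = (RA t (fst x), - Ad t (snd x))"
        by (rule T.R_eqI[OF perturb_solves])
      then show ?thesis by (simp add: d_def T.R_add algebra_simps)
    qed
    have bl: "bounded_linear (\<lambda>u. (u, 0 :: 'h))" "bounded_linear (\<lambda>v. (0 :: 'h, v))"
      by (intro bounded_linear_Pair bounded_linear_ident bounded_linear_zero)+
    have cont: "continuous_on X ?h1" "continuous_on X ?h2" for X
      by (intro continuous_on_Pair A.continuous_R adj.continuous_R continuous_on_const)+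
    have contd: "continuous_on X d" for X
      unfolding eq[abs_def] by (intro continuous_on_diff continuous_on_add cont T.continuous_R)
    have int: "f integrable_on {-r..r}" if "continuous_on {-r..r} f" for f :: "real \<Rightarrow> 'h \<times> 'h"
      using that by (rule integrable_continuous_real)
    have n1: "norm (integral {-r..r} ?h1) \<le> K * norm x"
    proof -
      have "integral {-r..r} ?h1 = (integral {-r..r} (\<lambda>t. RA t (fst x)), 0)"
        using integral_linear[OF A.integrable_R bl(1)] by (simp add: o_def)
      then have "norm (integral {-r..r} ?h1) \<le> K * norm (fst x)" using K[OF r] by (simp add: norm_Pair)
      also have "\<dots> \<le> K * norm x" using norm_fst_le[of "fst x" "snd x"] K0 by (intro mult_left_mono) auto
      finally show ?thesis .
    qed
    have n2: "norm (integral {-r..r} ?h2) \<le> K * norm x"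
    proof -
      have "integral {-r..r} ?h2 = (0, integral {-r..r} (\<lambda>t. - Ad t (snd x)))"
        using integral_linear[OF adj.integrable_R bl(2)] by (simp add: o_def)
      then have "norm (integral {-r..r} ?h2) \<le> K * norm (snd x)"
        using A.adjR_integral_bound[OF K[OF r] K0, of "snd x"] by (simp add: norm_Pair)
      also have "\<dots> \<le> K * norm x" using norm_snd_le[of "snd x" "fst x"] K0 by (intro mult_left_mono) auto
      finally show ?thesis .
    qed
    have n3: "norm (integral {-r..r} d) \<le> 2 * (MT * L * norm x) / (1 - p)"
    proof (rule integral_decay_bound[OF contd p_less])
      fix t :: real
      have pos: "0 < 1 + \<bar>t\<bar>" by (simp add: add_pos_nonneg)
      have "norm (d t) \<le> MT / (1 + \<bar>t\<bar>) * norm (perturb t x)" unfolding d_def by (rule T.norm_R)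
      also have "\<dots> \<le> MT / (1 + \<bar>t\<bar>) * (L * (1 + \<bar>t\<bar>) powr (p - 1) * norm x)"
        using T.M_pos by (intro mult_left_mono L(2)) auto
      also have "\<dots> = MT * L * norm x * ((1 + \<bar>t\<bar>) powr (p - 1) / (1 + \<bar>t\<bar>))" by simp
      also have "(1 + \<bar>t\<bar>) powr (p - 1) / (1 + \<bar>t\<bar>) = (1 + \<bar>t\<bar>) powr (p - 2)"
        using powr_diff[of "1 + \<bar>t\<bar>" "p - 1" 1] pos by (simp add: diff_diff_eq)
      finally show "norm (d t) \<le> MT * L * norm x * (1 + \<bar>t\<bar>) powr (p - 2)" .
    qed (use r in simp)
    have "RT t x = ?h1 t + ?h2 t - d t" for t unfolding eq by simp
    then have "integral {-r..r} (\<lambda>t. RT t x) = integral {-r..r} (\<lambda>t. ?h1 t + ?h2 t - d t)" by presburger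
    also have "\<dots> = integral {-r..r} ?h1 + integral {-r..r} ?h2 - integral {-r..r} d"
      unfolding Henstock_Kurzweil_Integration.integral_diff[OF integrable_add[OF int[OF cont(1)] int[OF cont(2)]] int[OF contd]]
        Henstock_Kurzweil_Integration.integral_add[OF int[OF cont(1)] int[OF cont(2)]] ..
    also have "norm \<dots> \<le> K * norm x + K * norm x + 2 * (MT * L * norm x) / (1 - p)"
      by (intro order_trans[OF norm_triangle_ineq4] add_mono order_trans[OF norm_triangle_ineq] n1 n2 n3)
    also have "\<dots> = K' * norm x" by (simp add: K'_def distrib_right)
    finally show ?thesis .
  qed
  with K'0 show ?thesis by blast
qed

end

section \<open>Graph subspaces\<close>

lemma subspace_eq_graph:
  fixes V :: "('a::complex_normed_vector \<times> 'b::complex_normed_vector) set"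
  assumes V: "csubspace V" and 0: "\<And>v. (0, v) \<in> V \<Longrightarrow> v = 0"
  shows "\<exists>X. linear_op X \<and> V = graph X"
proof -
  have uniq: "v = w" if "(u, v) \<in> V" "(u, w) \<in> V" for u v w
    using 0[of "v - w"] cvs.subspace_diff[OF V that] by simp
  define X where "X = Op {u. \<exists>v. (u, v) \<in> V} (\<lambda>u. SOME v. (u, v) \<in> V)"
  have X: "u \<in> Dom X \<and> App X u = v" if "(u, v) \<in> V" for u v
  proof -
    have "(u, SOME v. (u, v) \<in> V) \<in> V" using that by (rule someI)
    then show ?thesis using uniq[OF that] that by (auto simp: X_def)
  qed
  have X': "(u, App X u) \<in> V" if "u \<in> Dom X" for u using that X by (auto simp: X_def)
  have "V = graph X" using X X' by (force simp: graph_def)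
  moreover have "linear_op X"
    unfolding linear_op_def
  proof (intro conjI ballI allI)
    show "csubspace (Dom X)"
    proof (rule cvs.subspaceI)
      show "0 \<in> Dom X" using X[of 0 0] cvs.subspace_0[OF V] by (simp add: zero_prod_def)
      show "x + y \<in> Dom X" if "x \<in> Dom X" "y \<in> Dom X" for x y
        using X[of "x + y"] cvs.subspace_add[OF V X'[OF that(1)] X'[OF that(2)]] by simp
      show "c *\<^sub>C x \<in> Dom X" if "x \<in> Dom X" for c x
        using X[of "c *\<^sub>C x"] cvs.subspace_scale[OF V X'[OF that], of c] by (simp add: scaleC_prod_def)
    qed
    show "App X (x + y) = App X x + App X y" if "x \<in> Dom X" "y \<in> Dom X" for x y
      using X[of "x + y"] cvs.subspace_add[OF V X'[OF that(1)] X'[OF that(2)]] by simp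
    show "App X (c *\<^sub>C x) = c *\<^sub>C App X x" if "x \<in> Dom X" for c x
      using X[of "c *\<^sub>C x"] cvs.subspace_scale[OF V X'[OF that], of c] by (simp add: scaleC_prod_def)
  qed
  ultimately show ?thesis by blast
qed

text \<open>The form \<open>(u | b) - (v | a)\<close> of \<open>(u, v)\<close> and \<open>(a, b)\<close>, written as
  \<^term>\<open>cinner x (skew_swap y)\<close>, measures the failure of symmetry of an operator on its graph.\<close>

definition skew_swap :: "'h \<times> 'h \<Rightarrow> 'h \<times> 'h::complex_hilbert" where
  "skew_swap y = (snd y, - fst y)"

lemma cinner_skew_swap: "cinner x (skew_swap y) = cinner (fst x) (snd y) - cinner (snd x) (fst y)"
  by (simp add: skew_swap_def cinner_prod_def cinner_minus_right)

lemma skew_swap_diff: "skew_swap (x - y) = skew_swap x - skew_swap y" by (simp add: skew_swap_def)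

lemma bounded_linear_skew_swap: "bounded_linear (skew_swap :: 'h::complex_hilbert \<times> 'h \<Rightarrow> 'h \<times> 'h)"
  unfolding skew_swap_def
  by (intro bounded_linear_Pair bounded_linear_minus bounded_linear_snd bounded_linear_fst)

text \<open>Membership in the orthogonal complement of a graph with respect to this form is the
  defining relation of the adjoint. Maximality also yields the density of the domain: a vector
  \<^term>\<open>w\<close> orthogonal to the domain gives an element \<^term>\<open>(0, w)\<close> of the graph.\<close>

lemma selfadjoint_if_graph_lagrangian:
  fixes X :: "('h::complex_hilbert, 'h) op"
  assumes X: "linear_op X" and lag: "\<And>x. x \<in> graph X \<longleftrightarrow> (\<forall>y\<in>graph X. cinner y (skew_swap x) = 0)"
  shows "selfadjoint_op X"
proof -
  have dense: "densely_defined X"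
    unfolding densely_defined_def
  proof (rule dense_if_orthogonal_trivial[OF linear_opD(1)[OF X]])
    fix w assume "\<And>v. v \<in> Dom X \<Longrightarrow> cinner v w = 0"
    then have "(0, w) \<in> graph X" unfolding lag by (auto simp: graph_def cinner_skew_swap)
    then show "w = 0" using linear_opD(5)[OF X] by (auto simp: graph_def)
  qed
  have iff: "(y, z) \<in> graph X \<longleftrightarrow> (\<forall>u\<in>Dom X. cinner (App X u) y = cinner u z)" for y z
    unfolding lag by (auto simp: graph_def cinner_skew_swap)
  have "(y, z) \<in> graph X \<longleftrightarrow> (y, z) \<in> graph (adjoint_op X)" for y z
  proof
    assume "(y, z) \<in> graph X"
    then have "\<And>u. u \<in> Dom X \<Longrightarrow> cinner (App X u) y = cinner u z" unfolding iff by blast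
    then have "y \<in> Dom (adjoint_op X)" "App (adjoint_op X) y = z" by (intro adjoint_opI[OF dense]; blast)+
    then show "(y, z) \<in> graph (adjoint_op X)" by (auto simp: graph_def)
  next
    assume "(y, z) \<in> graph (adjoint_op X)"
    then have "y \<in> Dom (adjoint_op X)" "z = App (adjoint_op X) y" by (auto simp: graph_def)
    then show "(y, z) \<in> graph X" unfolding iff using adjoint_opD[OF dense] by blast
  qed
  then have "graph X = graph (adjoint_op X)" by auto
  with X dense show ?thesis by (simp add: selfadjoint_op_def)
qed

section \<open>The spectral subspaces of the Hamiltonian\<close>

context dominant_hamiltonian
begin

lemma skew_T:
  assumes x: "x \<in> Dom T" and y: "y \<in> Dom T"
  shows "cinner (App T x) (skew_swap y) = - cinner x (skew_swap (App T y))"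
proof -
  obtain u v a b where uv: "x = (u, v)" and ab: "y = (a, b)" by (cases x, cases y)
  have D: "u \<in> Dom A" "v \<in> Dom As" "a \<in> Dom A" "b \<in> Dom As" using x y by (simp_all add: Dom_T uv ab)
  have "cinner (App A u) b = cinner u (App As b)" by (rule adjoint_opD[OF A.dense_S D(4,1)])
  moreover have "cinner (App As v) a = cinner v (App A a)"
    using adjoint_opD[OF A.dense_S D(2,3)] cinner_commute by metis
  moreover have "cinner (App B v) b = cinner v (App B b)" "cinner (App C u) a = cinner u (App C a)"
    using symB symC D DomB DomC by (auto simp: symmetric_op_def)
  ultimately show ?thesis
    by (simp add: cinner_skew_swap App_T uv ab cinner_add_left cinner_add_right cinner_diff_left cinner_diff_right)
qed

text \<open>In the form \<open>(u | v) + (v | u)\<close> the real part of \<^term>\<open>T\<close> is the energy.\<close>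

lemma energy_swap:
  assumes x: "x \<in> Dom T" and f: "App T x - iax t *\<^sub>C x = f"
  shows "Re (cinner x (prod.swap f)) = energy x"
proof -
  have "cinner x (prod.swap f) = cnj (cinner (fst f) (snd x) + cinner (snd f) (fst x))"
    using cinner_commute[of "fst x" "snd f"] cinner_commute[of "snd x" "fst f"]
    by (simp add: cinner_prod_def)
  then show ?thesis using energy_eq[OF x f] by simp
qed

end

locale dichotomous_hamiltonian =
  dominant_hamiltonian A RA M B C p + T: axis_dichotomy "hamiltonian_op A B C"
    "\<lambda>t. resolvent (hamiltonian_op A B C) (iax t)" MT K
  for A :: "('h::complex_hilbert, 'h) op" and RA M B C p MT K +
  assumes trivial: "(\<Inter>t::real. kernel_op (comp_op B
    (inverse_op (shift_op (adjoint_op A) (- (iax t)))))) = {0}"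
begin

lemma skew_RT: "cinner (RT t x) (skew_swap y) = - cinner x (skew_swap (RT t y))"
proof -
  have eq: "App T (RT t z) = z + iax t *\<^sub>C RT t z" for z by (rule T.S_R')
  have "cinner (x + iax t *\<^sub>C RT t x) (skew_swap (RT t y)) = - cinner (RT t x) (skew_swap (y + iax t *\<^sub>C RT t y))"
    using skew_T[OF T.R_Dom[of t x] T.R_Dom[of t y]] unfolding eq .
  then have "cinner x (skew_swap (RT t y)) + iax t * cinner (RT t x) (skew_swap (RT t y)) =
      - cinner (RT t x) (skew_swap y) + iax t * cinner (RT t x) (skew_swap (RT t y))"
    by (simp add: cinner_skew_swap cinner_simps scaleC_prod_def algebra_simps)
  then show ?thesis by simp
qed

lemma skew_Q: "cinner (T.Q x) (skew_swap y) = - cinner x (skew_swap (T.Q y))"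
proof -
  have bl1: "bounded_linear (\<lambda>z. cinner z (skew_swap y))" by (rule bounded_linear_cinner_left)
  have bl2: "bounded_linear (\<lambda>z. - cinner x (skew_swap z))"
    by (intro bounded_linear_minus bounded_linear_compose[OF
          bounded_bilinear.bounded_linear_right[OF bounded_bilinear_cinner] bounded_linear_skew_swap])
  have "((\<lambda>r. cinner (integral {-r..r} (\<lambda>t. RT t x)) (skew_swap y)) \<longlongrightarrow> cinner (pi *\<^sub>R T.Q x) (skew_swap y)) at_top"
    by (intro bounded_linear.tendsto[OF bl1] T.Q_lim)
  moreover have "cinner (integral {-r..r} (\<lambda>t. RT t x)) (skew_swap y) = - cinner x (skew_swap (integral {-r..r} (\<lambda>t. RT t y)))" for r
    using integral_linear[OF T.integrable_R bl1, of "-r" r x] integral_linear[OF T.integrable_R bl2, of "-r" r y]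
    by (simp add: o_def skew_RT)
  ultimately have "((\<lambda>r. - cinner x (skew_swap (integral {-r..r} (\<lambda>t. RT t y)))) \<longlongrightarrow> cinner (pi *\<^sub>R T.Q x) (skew_swap y)) at_top"
    by simp
  moreover have "((\<lambda>r. - cinner x (skew_swap (integral {-r..r} (\<lambda>t. RT t y)))) \<longlongrightarrow> - cinner x (skew_swap (pi *\<^sub>R T.Q y))) at_top"
    by (intro bounded_linear.tendsto[OF bl2] T.Q_lim)
  ultimately have "cinner (pi *\<^sub>R T.Q x) (skew_swap y) = - cinner x (skew_swap (pi *\<^sub>R T.Q y))"
    by (rule tendsto_unique[OF trivial_limit_at_top_linorder])
  moreover have "cinner (pi *\<^sub>R T.Q x) (skew_swap y) = pi * cinner (T.Q x) (skew_swap y)"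
    by (simp add: scaleR_scaleC cinner_scaleC_left)
  moreover have "cinner x (skew_swap (pi *\<^sub>R T.Q y)) = pi * cinner x (skew_swap (T.Q y))"
    unfolding linear_simps(5)[OF bounded_linear_skew_swap] by (simp add: scaleR_scaleC cinner_scaleC_right)
  ultimately have "complex_of_real pi * cinner (T.Q x) (skew_swap y) = complex_of_real pi * (- cinner x (skew_swap (T.Q y)))"
    by simp
  then show ?thesis unfolding mult_cancel_left by simp
qed

text \<open>Skewness of \<open>Q\<close> makes each of the two eigenspaces of \<open>Q\<close> neutral. If \<^term>\<open>x\<close> is orthogonal to
  one of them, then its component in the other one is orthogonal to both, hence to everything, and vanishes
  since the form is nondegenerate.\<close>

lemma V_lagrangian:
  assumes s: "s = 1 \<or> s = -1"
  shows "x \<in> T.V s \<longleftrightarrow> (\<forall>y\<in>T.V s. cinner y (skew_swap x) = 0)"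
proof
  have neutral: "cinner y (skew_swap x) = 0" if "x \<in> T.V r" "y \<in> T.V r" "r = 1 \<or> r = -1" for x y and r :: real
  proof -
    have "cinner (r *\<^sub>R y) (skew_swap x) = - cinner y (skew_swap (r *\<^sub>R x))"
      using skew_Q[of y x] that(1,2) by (simp add: T.V_def)
    then have "cinner y (skew_swap x) = - cinner y (skew_swap x)"
      using that(3) by (auto simp: cinner_skew_swap cinner_minus_left cinner_minus_right algebra_simps)
    then show ?thesis by simp
  qed
  then show "x \<in> T.V s \<Longrightarrow> \<forall>y\<in>T.V s. cinner y (skew_swap x) = 0" using s by blast
  assume orth: "\<forall>y\<in>T.V s. cinner y (skew_swap x) = 0"
  define P where "P r x = (1/2) *\<^sub>R (x + r *\<^sub>R T.Q x)" for r :: real and x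
  have P: "P r z \<in> T.V r" if "r = 1 \<or> r = -1" for r z
    using that T.proj_in_V[of z] by (auto simp: P_def)
  have Psum: "P s z + P (- s) z = z" for z
    using half_sum_half_diff(1)[of z "s *\<^sub>R T.Q z"] by (simp add: P_def)
  have ms: "- s = 1 \<or> - s = -1" using s by auto
  define d where "d = P (- s) x"
  have d: "d \<in> T.V (- s)" unfolding d_def by (rule P[OF ms])
  have xd: "x = P s x + d" using Psum[of x] by (simp add: d_def)
  have "cinner y (skew_swap d) = 0" for y
  proof -
    have "cinner (P s y) (skew_swap d) = 0"
    proof -
      have "skew_swap d = skew_swap x - skew_swap (P s x)" using skew_swap_diff[of x "P s x"] xd by (metis add_diff_cancel_left')
      then show ?thesis using orth P[OF s] neutral[OF P[OF s] P[OF s] s] by (simp add: cinner_diff_right)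
    qed
    moreover have "cinner (P (- s) y) (skew_swap d) = 0" by (rule neutral[OF d P[OF ms] ms])
    ultimately show ?thesis using Psum[of y] cinner_add_left[of "P s y" "P (- s) y" "skew_swap d"] by simp
  qed
  then have "skew_swap d = 0" using cinner_eq_zero_iff by blast
  then have "d = 0" by (simp add: skew_swap_def prod_eq_iff)
  then show "x \<in> T.V s" using xd P[OF s, of x] by simp
qed

lemma energy_integrand:
  shows "Re (cinner (RT t x) (prod.swap x)) = energy (RT t x)" and "0 \<le> energy (RT t x)"
proof -
  show "Re (cinner (RT t x) (prod.swap x)) = energy (RT t x)"
    by (rule energy_swap[OF T.R_Dom T.S_R])
  show "0 \<le> energy (RT t x)" using energy_parts_nonneg[OF T.R_Dom[of t x]] by (simp add: energy_def)
qed

lemma energy_integral_lim: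
  "pv_integral (\<lambda>t. energy (RT t x)) (pi * Re (cinner (T.Q x) (prod.swap x)))"
  and continuous_energy: "continuous_on X (\<lambda>t. energy (RT t x))"
proof -
  have bl: "bounded_linear (\<lambda>z. Re (cinner z (prod.swap x)))"
    by (intro bounded_linear_compose[OF bounded_linear_Re] bounded_linear_cinner_left)
  have "((\<lambda>r. Re (cinner (integral {-r..r} (\<lambda>t. RT t x)) (prod.swap x))) \<longlongrightarrow> Re (cinner (pi *\<^sub>R T.Q x) (prod.swap x))) at_top"
    by (intro bounded_linear.tendsto[OF bl] T.Q_lim)
  moreover have "Re (cinner (integral {-r..r} (\<lambda>t. RT t x)) (prod.swap x)) = integral {-r..r} (\<lambda>t. energy (RT t x))" for r
    using integral_linear[OF T.integrable_R bl, of "-r" r x] by (simp add: o_def energy_integrand)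
  ultimately show "pv_integral (\<lambda>t. energy (RT t x)) (pi * Re (cinner (T.Q x) (prod.swap x)))"
    using linear_simps(5)[OF bl, of pi "T.Q x"] by simp
  have "continuous_on X (\<lambda>t. Re (cinner (RT t x) (prod.swap x)))"
    by (intro continuous_intros T.continuous_R)
  then show "continuous_on X (\<lambda>t. energy (RT t x))" by (simp only: energy_integrand)
qed

text \<open>The energy is nonnegative, so the truncated integrals increase to their limit. In particular they
  all vanish if the limit does.\<close>

lemma energy_integral_le:
  assumes r: "0 \<le> r"
  shows "integral {-r..r} (\<lambda>t. energy (RT t x)) \<le> pi * Re (cinner (T.Q x) (prod.swap x))"
proof (rule tendsto_lowerbound[OF energy_integral_lim])
  have int: "(\<lambda>t. energy (RT t x)) integrable_on {a..b}" for a b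
    by (intro integrable_continuous_real continuous_energy)
  show "\<forall>\<^sub>F R in at_top. integral {-r..r} (\<lambda>t. energy (RT t x)) \<le> integral {-R..R} (\<lambda>t. energy (RT t x))"
    using eventually_ge_at_top[of r]
    by eventually_elim (intro integral_subset_le int; auto intro!: energy_integrand(2))
qed simp

lemma Q_swap_nonneg: "0 \<le> Re (cinner (T.Q x) (prod.swap x))"
proof -
  have "0 \<le> pi * Re (cinner (T.Q x) (prod.swap x))" using energy_integral_le[of 0 x] by simp
  then show ?thesis using mult_le_cancel_left_pos[OF pi_gt_zero, of 0] by simp
qed

lemma energy_eq_0_if_Q_swap_eq_0:
  assumes 0: "Re (cinner (T.Q x) (prod.swap x)) = 0"
  shows "energy (RT t x) = 0"
proof -
  define r where "r = \<bar>t\<bar> + 1"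
  have "integral {-r..r} (\<lambda>t. energy (RT t x)) \<le> 0" using energy_integral_le[of r x] 0 by (simp add: r_def)
  moreover have "0 \<le> integral {-r..r} (\<lambda>t. energy (RT t x))"
    by (intro integral_nonneg integrable_continuous_real continuous_energy energy_integrand(2))
  ultimately have i0: "integral {-r..r} (\<lambda>t. energy (RT t x)) = 0" by simp
  have "((\<lambda>t. energy (RT t x)) has_integral 0) (cbox (-r) r)"
    using integrable_integral[OF integrable_continuous_real[OF continuous_energy]] unfolding i0[symmetric] by simp
  then show ?thesis
    by (rule has_integral_0_cbox_imp_0[rotated 2]) (auto simp: r_def continuous_energy energy_integrand(2))
qed

text \<open>For \<open>(0, v)\<close> in a spectral subspace the indefinite form vanishes, hence the energy along
  the whole axis does, and with it the off-diagonal part of the resolvent equation. Then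
  \<open>B (A\<^sup>* + \<i> t)\<^sup>-\<^sup>1 v = 0\<close> for every \<^term>\<open>t\<close>.\<close>

lemma V_graph:
  assumes v: "(0, v) \<in> T.V s"
  shows "v = 0"
proof -
  let ?x = "(0, v) :: 'h \<times> 'h"
  have "T.Q ?x = s *\<^sub>R ?x" using v by (simp add: T.V_def)
  then have Q0: "Re (cinner (T.Q ?x) (prod.swap ?x)) = 0"
    by (simp add: cinner_prod_def)
  have BAd: "App B (Ad t v) = 0" for t
  proof -
    define u w where "u = fst (RT t ?x)" and "w = snd (RT t ?x)"
    have D: "RT t ?x \<in> Dom T" by (rule T.R_Dom)
    then have uw: "u \<in> Dom A" "w \<in> Dom As" "u \<in> Dom C" "w \<in> Dom B"
      using DomB DomC by (auto simp: Dom_T u_def w_def)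
    have "Re (cinner (App B w) w) = 0" "Re (cinner (App C u) u) = 0"
      using energy_eq_0_if_Q_swap_eq_0[OF Q0, of t] energy_parts_nonneg[OF D] by (simp_all add: energy_def u_def w_def)
    then have B0: "App B w = 0" and C0: "App C u = 0"
      using nonneg_symmetric_eq_0[OF symB posB uw(4)] nonneg_symmetric_eq_0[OF symC posC uw(3)] by auto
    have "snd (App T (RT t ?x) - iax t *\<^sub>C RT t ?x) = v" unfolding T.S_R by simp
    then have eq: "- App As w - iax t *\<^sub>C w = v" by (simp add: App_T scaleC_prod_def C0 flip: u_def w_def)
    have neg: "- w \<in> Dom As" "App As (- w) = - App As w"
      using cvs.subspace_neg[OF linear_opD(1)[OF linAs] uw(2)] linear_opD(3)[OF linAs uw(2), of "-1"] by auto
    have "App As (- w) + iax t *\<^sub>C (- w) = v" using eq neg by simp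
    then have "Ad t v = - w" using A.adjR_adjoint[OF neg(1), of t] by simp
    then show ?thesis using B0 linear_opD(3)[OF linB uw(4), of "-1"] by simp
  qed
  have "v \<in> kernel_op (comp_op B (inverse_op (shift_op As (- iax t))))" for t
  proof -
    have R: "resolvent As (- iax t) v = Ad t v"
      by (rule resolvent_setI(2)[where V=UNIV and G="Ad t" and c="M / (1 + \<bar>t\<bar>)"])
         (auto simp: A.adjoint_adjR A.adjR_adjoint simp del: times_divide_eq_left intro: A.norm_adjR)
    have "v \<in> App (shift_op As (- iax t)) ` Dom As"
      by (rule image_eqI[of _ _ "Ad t v"]) (simp_all add: App_shift_op A.adjoint_adjR)
    then show ?thesis
      using R BAd[of t] DomB[OF A.adjoint_adjR(1)]
      by (simp add: kernel_op_def comp_op_def) (simp add: inverse_op_def Dom_shift_op)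
  qed
  then have "v \<in> (\<Inter>t::real. kernel_op (comp_op B (inverse_op (shift_op As (- iax t)))))" by blast
  then show ?thesis unfolding trivial by simp
qed

text \<open>The elements \<^term>\<open>u\<close> of \<^term>\<open>riccati_dom A X\<close> are the first components of the elements
  of \<^term>\<open>T.V s\<close> in the domain of \<^term>\<open>T\<close>. As \<open>(1 + s Q) / 2\<close> preserves this domain and is
  continuous, these elements are dense in \<^term>\<open>T.V s\<close>; and the second component of the statement
  \<open>T (u, X u) \<in> V s\<close> is the Riccati equation.\<close>

lemma graph_properties:
  assumes s: "s = 1 \<or> s = -1" and X: "linear_op X" and VX: "T.V s = graph X"
  shows "selfadjoint_op X"
    and "u \<in> Dom X \<Longrightarrow> cinner (App X u) u = complex_of_real (Re (cinner (App X u) u)) \<and> 0 \<le> s * Re (cinner (App X u) u)"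
    and "core X (riccati_dom A X)"
    and "riccati_on A B C X (riccati_dom A X)"
proof -
  show "selfadjoint_op X"
    by (rule selfadjoint_if_graph_lagrangian[OF X]) (use V_lagrangian[OF s] VX in blast)
  show "cinner (App X u) u = complex_of_real (Re (cinner (App X u) u)) \<and> 0 \<le> s * Re (cinner (App X u) u)"
    if u: "u \<in> Dom X"
  proof
    let ?x = "(u, App X u)"
    have x: "?x \<in> T.V s" using u by (auto simp: VX graph_def)
    have "cinner ?x (skew_swap ?x) = 0" using V_lagrangian[OF s, of ?x] x by blast
    then have "cinner u (App X u) = cinner (App X u) u" by (simp add: cinner_skew_swap)
    then have cc: "cnj (cinner (App X u) u) = cinner (App X u) u" using cinner_commute[of u "App X u"] by simp
    then show "cinner (App X u) u = complex_of_real (Re (cinner (App X u) u))" by (simp add: complex_eq_iff)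
    have "cinner ?x (prod.swap ?x) = cinner u (App X u) + cinner (App X u) u" by (simp add: cinner_prod_def)
    then have "Re (cinner ?x (prod.swap ?x)) = 2 * Re (cinner (App X u) u)"
      using cinner_commute[of u "App X u"] by simp
    moreover have "0 \<le> s * Re (cinner ?x (prod.swap ?x))"
      using Q_swap_nonneg[of ?x] x
      by (simp add: T.V_def scaleR_scaleC cinner_scaleC_left del: cinner_prod_def)
    ultimately show "0 \<le> s * Re (cinner (App X u) u)" by (simp add: zero_le_mult_iff)
  qed
  have GX: "graph (restrict_op X (riccati_dom A X)) = T.V s \<inter> Dom T"
    by (auto simp: VX graph_def restrict_op_def riccati_dom_def Dom_T)
  show "core X (riccati_dom A X)"
    unfolding core_def
  proof (intro conjI)
    show "closed_op X" unfolding closed_op_def VX[symmetric] by (rule T.closed_V)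
    show "riccati_dom A X \<subseteq> Dom X" by (auto simp: riccati_dom_def)
    show "csubspace (riccati_dom A X)"
    proof -
      have iff: "u \<in> riccati_dom A X \<longleftrightarrow> u \<in> Dom A \<and> u \<in> Dom X \<and> App X u \<in> Dom As" for u
        by (auto simp: riccati_dom_def)
      show ?thesis
        by (rule cvs.subspaceI)
          (auto simp: iff linear_opD[OF X] intro: cvs.subspace_0[OF A.subspace_Dom] cvs.subspace_add[OF A.subspace_Dom]
            cvs.subspace_scale[OF A.subspace_Dom] cvs.subspace_0[OF linear_opD(1)[OF X]] cvs.subspace_add[OF linear_opD(1)[OF X]]
            cvs.subspace_scale[OF linear_opD(1)[OF X]] cvs.subspace_0[OF linear_opD(1)[OF linAs]]
            cvs.subspace_add[OF linear_opD(1)[OF linAs]] cvs.subspace_scale[OF linear_opD(1)[OF linAs]])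
    qed
    show "graph X = closure (graph (restrict_op X (riccati_dom A X)))"
      unfolding GX VX[symmetric]
    proof
      show "closure (T.V s \<inter> Dom T) \<subseteq> T.V s" by (rule closure_minimal[OF Int_lower1 T.closed_V])
      show "T.V s \<subseteq> closure (T.V s \<inter> Dom T)"
      proof
        fix x assume x: "x \<in> T.V s"
        obtain f where f: "\<And>n. f n \<in> Dom T" "f \<longlonglongrightarrow> x"
          using dense_T closure_sequential[of x "Dom T"] by (auto simp: densely_defined_def)
        define g where "g n = (1/2) *\<^sub>R (f n + s *\<^sub>R T.Q (f n))" for n
        have "g n \<in> T.V s" for n using s T.proj_in_V[of "f n"] by (auto simp: g_def)
        moreover have "g n \<in> Dom T" for n
          unfolding g_def by (intro csubspace_scaleR cvs.subspace_add T.subspace_Dom f(1) T.Q_Dom(1))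
        moreover have "g \<longlonglongrightarrow> (1/2) *\<^sub>R (x + s *\<^sub>R T.Q x)"
          unfolding g_def[abs_def] by (intro tendsto_scaleR tendsto_const tendsto_add f(2) bounded_linear.tendsto[OF T.bounded_linear_Q])
        moreover have "(1/2) *\<^sub>R (x + s *\<^sub>R T.Q x) = x"
        proof -
          have "s *\<^sub>R T.Q x = x" using x s by (auto simp: T.V_def)
          then show ?thesis by simp
        qed
        ultimately show "x \<in> closure (T.V s \<inter> Dom T)" unfolding closure_sequential by auto
      qed
    qed
  qed
  show "riccati_on A B C X (riccati_dom A X)"
    unfolding riccati_on_def
  proof
    fix u assume "u \<in> riccati_dom A X"
    then have u: "u \<in> Dom A" "u \<in> Dom X" "App X u \<in> Dom As" by (auto simp: riccati_dom_def)
    let ?x = "(u, App X u)"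
    have "App T ?x \<in> T.V s" by (rule T.V_invariant) (use u in \<open>auto simp: Dom_T VX graph_def\<close>)
    then have "(App A u + App B (App X u), App C u - App As (App X u)) \<in> graph X" by (simp add: App_T VX)
    then have "App A u + App B (App X u) \<in> Dom X"
        "App X (App A u + App B (App X u)) = App C u - App As (App X u)"
      by (auto simp: graph_def)
    then show "u \<in> Dom A \<and> u \<in> Dom C \<and> u \<in> Dom X \<and> App X u \<in> Dom As \<and> App X u \<in> Dom B
       \<and> App A u + App B (App X u) \<in> Dom X
       \<and> App As (App X u) + App X (App A u + App B (App X u)) - App C u = 0"
      using u DomB DomC by simp
  qed
qed

end

theorem theorem5p3:
  fixes A B C :: "('h::complex_hilbert, 'h) op" and p :: real
  assumes "nonnegative_hamiltonian A B C"
    and "diagonally_dominant p A B C"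
    and "p < 1"
    and "sectorially_dichotomous A"
    and "(\<Inter>t::real. kernel_op (comp_op B
           (inverse_op (shift_op (adjoint_op A) (- (\<i> * complex_of_real t)))))) = {0}"
  shows "dichotomous (hamiltonian_op A B C) \<and>
    (\<exists>Vp Vm Xp Xm.
      spectral_subspaces (hamiltonian_op A B C) Vp Vm \<and>
      linear_op Xp \<and> linear_op Xm \<and> Vp = graph Xp \<and> Vm = graph Xm \<and>
      selfadjoint_op Xp \<and> selfadjoint_op Xm \<and> nonnegative_op Xp \<and> nonpositive_op Xm \<and>
      core Xp (riccati_dom A Xp) \<and> core Xm (riccati_dom A Xm) \<and>
      riccati_on A B C Xp (riccati_dom A Xp) \<and> riccati_on A B C Xm (riccati_dom A Xm))"
proof -
  let ?RA = "\<lambda>t. resolvent A (iax t)"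
  let ?T = "hamiltonian_op A B C"
  obtain M K where M: "axis_resolvent A ?RA M"
    and K: "\<And>r x. 0 < r \<Longrightarrow> norm (integral {-r..r} (\<lambda>t. ?RA t x)) \<le> K * norm x"
    using sectorially_dichotomous_axis_resolvent[OF assms(4)] by blast
  \<comment> \<open>On the zero space the bound may be negative.\<close>
  have K': "norm (integral {-r..r} (\<lambda>t. ?RA t x)) \<le> \<bar>K\<bar> * norm x" if "0 < r" for r x
    using K[OF that, of x] mult_right_mono[OF abs_ge_self[of K], of "norm x"] by simp
  have dA: "densely_defined A" using assms(1) by (simp add: nonnegative_hamiltonian_def hamiltonian_def)
  interpret A: axis_resolvent A ?RA M by (rule M)
  interpret H: dominant_hamiltonian A ?RA M B C p
    by unfold_locales (use dA assms in auto)
  obtain MT where MT: "axis_resolvent ?T H.RT MT" using H.axis_resolvent_T by blast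
  obtain KT where KT: "0 \<le> KT" "\<And>r x. 0 < r \<Longrightarrow> norm (integral {-r..r} (\<lambda>t. H.RT t x)) \<le> KT * norm x"
    using H.T_integral_bound[OF K' abs_ge_zero MT] by blast
  interpret T: axis_resolvent ?T H.RT MT by (rule MT)
  interpret D: dichotomous_hamiltonian A ?RA M B C p MT KT
    by unfold_locales (use H.dense_T KT assms in auto)
  obtain Xp where Xp: "linear_op Xp" "D.T.V 1 = graph Xp"
    using subspace_eq_graph[OF D.T.csubspace_V, of 1] D.V_graph[of _ 1] by blast
  obtain Xm where Xm: "linear_op Xm" "D.T.V (-1) = graph Xm"
    using subspace_eq_graph[OF D.T.csubspace_V, of "-1"] D.V_graph[of _ "-1"] by blast
  have spec: "spectral_subspaces ?T (D.T.V 1) (D.T.V (-1))" by (rule D.T.spectral_subspaces_V)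
  then have "dichotomous ?T" unfolding spectral_subspaces_def dichotomous_def by blast
  moreover have "nonnegative_op Xp" unfolding nonnegative_op_def
    using D.graph_properties(2)[OF _ Xp] by (auto simp: complex_nonneg_Reals_iff complex_eq_iff)
  moreover have "nonpositive_op Xm" unfolding nonpositive_op_def
    using D.graph_properties(2)[OF _ Xm] by (auto simp: complex_nonpos_Reals_iff complex_eq_iff)
  ultimately show ?thesis
    using spec Xp Xm D.graph_properties(1,3,4)[OF _ Xp] D.graph_properties(1,3,4)[OF _ Xm] by blast
qed

end
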